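(* Let $N\ge 1$, let $\Omega\subset\mathbb{R}^N$ be a bounded open set, and let $u\in L^1_{\rm loc}(\Omega)$ be such that its distributional Laplacian satisfies $\Delta u\in\mathcal{M}(\Omega)$. If $u\ge 0$ a.e. in $\Omega$, then $$(\Delta u)_{\rm d}\ge 0\quad\text{on the set }[u=0],$$ where $u$ is identified with its quasicontinuous representative and $[u=0]=\{x\in\Omega:u(x)=0\}$.
   Context: $\mathcal{M}(\Omega)$ is the space of (signed, not necessarily finite) Radon measures on $\Omega$: $\mu\in\mathcal{M}(\Omega)$ if and only if for every open $\omega\subset\subset\Omega$ there is $C_\omega>0$ with $\left|\int_\Omega\varphi\,d\mu\right|\le C_\omega\|\varphi\|_\infty$ for all $\varphi\in C_0^\infty(\omega)$ (smooth functions with compact support in $\omega$). Saying $\Delta u\in\mathcal{M}(\Omega)$ means that the distribution $\Delta u$ is given by such a measure. "cap" denotes the Newtonian ($W^{1,2}$) capacity; in terms of sets of zero capacity and quasicontinuity one may take $\operatorname{cap}(A)=\inf\{\|\varphi\|_{W^{1,2}(\mathbb{R}^N)}^2:\varphi\in W^{1,2}(\mathbb{R}^N),\ \varphi\ge1\text{ a.e. in a neighborhood of }A\}$. A function $v:\Omega\to\mathbb{R}$ is quasicontinuous if for every $\varepsilon>0$ there is an open set $U\subset\Omega$ with $\operatorname{cap}(U)<\varepsilon$ such that $v|_{\Omega\setminus U}$ is continuous. Every $\mu\in\mathcal{M}(\Omega)$ decomposes uniquely as $\mu=\mu_{\rm d}+\mu_{\rm c}$ with $\mu_{\rm d},\mu_{\rm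 c}\in\mathcal{M}(\Omega)$, where the diffuse part satisfies $|\mu_{\rm d}|(A)=0$ for every Borel set $A\subset\Omega$ with $\operatorname{cap}(A)=0$, and the concentrated part satisfies $|\mu_{\rm c}|(\Omega\setminus F)=0$ for some Borel set $F\subset\Omega$ with $\operatorname{cap}(F)=0$. If $u\in L^1_{\rm loc}(\Omega)$ and $\Delta u\in\mathcal{M}(\Omega)$, there exists a quasicontinuous $\tilde u:\Omega\to\mathbb{R}$ with $u=\tilde u$ a.e. in $\Omega$ (unique up to sets of zero capacity); $u$ is identified with $\tilde u$ in pointwise expressions. A measure $\nu\in\mathcal{M}(\Omega)$ is $\ge0$ on a Borel set $E$ (defined up to a $|\nu|$-null set) if $\nu(A)\ge0$ for every Borel set $A\subset E$ that is relatively compact in $\Omega$. *)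

theory Defs
  imports "HOL-Analysis.Analysis"
begin

definition partial :: "'a::euclidean_space \<Rightarrow> ('a \<Rightarrow> real) \<Rightarrow> 'a \<Rightarrow> real" where
  "partial b f = (\<lambda>x. frechet_derivative f (at x) b)"

definition smooth :: "('a::euclidean_space \<Rightarrow> real) \<Rightarrow> bool" where
  "smooth f \<longleftrightarrow> (\<forall>bs. set bs \<subseteq> Basis \<longrightarrow> (\<forall>x. foldr partial bs f differentiable (at x)))"

definition test_functions :: "'a::euclidean_space set \<Rightarrow> ('a \<Rightarrow> real) set" where
  "test_functions W =
    {f. smooth f \<and> compact (closure {x. f x \<noteq> 0}) \<and> closure {x. f x \<noteq> 0} \<subseteq> W}"

definition laplacian :: "('a::euclidean_space \<Rightarrow> real) \<Rightarrow> 'a \<Rightarrow> real" where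
  "laplacian f x = (\<Sum>b\<in>Basis. partial b (partial b f) x)"

definition L1_loc :: "'a::euclidean_space set \<Rightarrow> ('a \<Rightarrow> real) set" where
  "L1_loc W = {f. \<forall>K. compact K \<and> K \<subseteq> W \<longrightarrow> f absolutely_integrable_on K}"

definition L2 :: "('a::euclidean_space \<Rightarrow> 'b::euclidean_space) set" where
  "L2 = {f \<in> borel_measurable lebesgue. integrable lebesgue (\<lambda>x. (norm (f x))\<^sup>2)}"

definition weak_gradient ::
  "('a::euclidean_space \<Rightarrow> real) \<Rightarrow> ('a \<Rightarrow> 'a) \<Rightarrow> bool" where
  "weak_gradient f G \<longleftrightarrow>
    f \<in> L1_loc UNIV \<and> (\<forall>b\<in>Basis. (\<lambda>x. G x \<bullet> b) \<in> L1_loc UNIV) \<and>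
    (\<forall>\<phi>\<in>test_functions UNIV. \<forall>b\<in>Basis.
      (LINT x|lebesgue. f x * partial b \<phi> x) = - (LINT x|lebesgue. (G x \<bullet> b) * \<phi> x))"

text \<open>The pairs \<open>(f, \<nabla>f)\<close> with \<open>f\<close> in \<open>W\<^sup>1\<^sup>,\<^sup>2(\<real>\<^sup>N)\<close>. The weak gradient is
  unique only up to null sets, so it is carried along instead of being chosen.\<close>

definition W12 :: "(('a::euclidean_space \<Rightarrow> real) \<times> ('a \<Rightarrow> 'a)) set" where
  "W12 = {(f, G). f \<in> L2 \<and> G \<in> L2 \<and> weak_gradient f G}"

definition W12_norm_sq :: "('a::euclidean_space \<Rightarrow> real) \<Rightarrow> ('a \<Rightarrow> 'a) \<Rightarrow> real" where
  "W12_norm_sq f G = (LINT x|lebesgue. (f x)\<^sup>2) + (LINT x|lebesgue. (norm (G x))\<^sup>2)"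

definition cap :: "'a::euclidean_space set \<Rightarrow> ennreal" where
  "cap A = Inf {ennreal (W12_norm_sq f G) | f G.
     (f, G) \<in> W12 \<and> (\<exists>V. open V \<and> A \<subseteq> V \<and> (AE x in lebesgue. x \<in> V \<longrightarrow> 1 \<le> f x))}"

definition quasicontinuous :: "'a::euclidean_space set \<Rightarrow> ('a \<Rightarrow> real) \<Rightarrow> bool" where
  "quasicontinuous W v \<longleftrightarrow>
    (\<forall>\<epsilon>::real. 0 < \<epsilon> \<longrightarrow>
      (\<exists>U. open U \<and> U \<subseteq> W \<and> cap U < ennreal \<epsilon> \<and> continuous_on (W - U) v))"

text \<open>A signed, possibly infinite Radon measure on an open set has a value only on relatively
  compact Borel sets, so it is not a single set function on all Borel sets. It is represented by
  its (unique) Jordan decomposition \<open>(\<mu>\<^sup>+, \<mu>\<^sup>-)\<close>: two mutually singular positive Borel measures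
  on \<open>W\<close> that are finite on compact sets (regularity is then automatic). By the Riesz theorem
  these are exactly the functionals \<open>\<phi> \<mapsto> \<integral> \<phi> d\<mu>\<close> bounded by \<open>C \<parallel>\<phi>\<parallel>\<^sub>\<infinity>\<close>, with \<open>C\<close> depending on
  \<open>V\<close>, for test functions \<open>\<phi>\<close> supported in an open \<open>V\<close> relatively compact in \<open>W\<close>.\<close>

type_synonym 'a signed_measure = "'a measure \<times> 'a measure"

definition rel_compact :: "'a::euclidean_space set \<Rightarrow> 'a set \<Rightarrow> bool" where
  "rel_compact W A \<longleftrightarrow> compact (closure A) \<and> closure A \<subseteq> W"

definition pos_radon :: "'a::euclidean_space set \<Rightarrow> 'a measure set" where
  "pos_radon W = {P. sets P = sets (restrict_space borel W) \<and>
     (\<forall>K. compact K \<and> K \<subseteq> W \<longrightarrow> emeasure P K < \<infinity>)}"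

definition radon :: "'a::euclidean_space set \<Rightarrow> 'a signed_measure set" where
  "radon W = {(P, Q). P \<in> pos_radon W \<and> Q \<in> pos_radon W \<and>
     (\<exists>H. H \<in> sets borel \<and> H \<subseteq> W \<and> emeasure P (W - H) = 0 \<and> emeasure Q H = 0)}"

text \<open>\<open>val \<mu> A\<close> is the value \<open>\<mu>(A)\<close> only for Borel sets \<open>A\<close> that are relatively compact in the
  underlying open set.\<close>

definition val :: "'a signed_measure \<Rightarrow> 'a set \<Rightarrow> real" where
  "val \<mu> A = measure (fst \<mu>) A - measure (snd \<mu>) A"

definition total_var :: "'a signed_measure \<Rightarrow> 'a set \<Rightarrow> ennreal" where
  "total_var \<mu> A = emeasure (fst \<mu>) A + emeasure (snd \<mu>) A"

definition signed_integral :: "'a signed_measure \<Rightarrow> ('a \<Rightarrow> real) \<Rightarrow> real" where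
  "signed_integral \<mu> f = (LINT x|fst \<mu>. f x) - (LINT x|snd \<mu>. f x)"

definition has_distr_laplacian ::
  "'a::euclidean_space set \<Rightarrow> ('a \<Rightarrow> real) \<Rightarrow> 'a signed_measure \<Rightarrow> bool" where
  "has_distr_laplacian W u \<mu> \<longleftrightarrow>
    (\<forall>\<phi>\<in>test_functions W. (LINT x:W|lebesgue. u x * laplacian \<phi> x) = signed_integral \<mu> \<phi>)"

definition diffuse :: "'a::euclidean_space set \<Rightarrow> 'a signed_measure \<Rightarrow> bool" where
  "diffuse W \<mu> \<longleftrightarrow> (\<forall>A. A \<in> sets borel \<and> A \<subseteq> W \<and> cap A = 0 \<longrightarrow> total_var \<mu> A = 0)"

definition concentrated :: "'a::euclidean_space set \<Rightarrow> 'a signed_measure \<Rightarrow> bool" where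
  "concentrated W \<mu> \<longleftrightarrow>
    (\<exists>F. F \<in> sets borel \<and> F \<subseteq> W \<and> cap F = 0 \<and> total_var \<mu> (W - F) = 0)"

definition cap_decomposition :: "'a::euclidean_space set \<Rightarrow>
    'a signed_measure \<Rightarrow> 'a signed_measure \<Rightarrow> 'a signed_measure \<Rightarrow> bool" where
  "cap_decomposition W \<mu> \<mu>d \<mu>c \<longleftrightarrow>
    \<mu>d \<in> radon W \<and> \<mu>c \<in> radon W \<and> diffuse W \<mu>d \<and> concentrated W \<mu>c \<and>
    (\<forall>A. A \<in> sets borel \<and> rel_compact W A \<longrightarrow> val \<mu> A = val \<mu>d A + val \<mu>c A)"

text \<open>The set \<open>E\<close> need only agree with a Borel set \<open>B\<close> up to a \<open>|\<nu>|\<close>-null set. For instance, the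
  zero set of a quasicontinuous function is Borel only up to a set of zero capacity.\<close>

definition nonneg_on :: "'a::euclidean_space set \<Rightarrow> 'a signed_measure \<Rightarrow> 'a set \<Rightarrow> bool" where
  "nonneg_on W \<nu> E \<longleftrightarrow>
    (\<exists>B Z. B \<in> sets borel \<and> B \<subseteq> W \<and> Z \<in> sets borel \<and> Z \<subseteq> W \<and> total_var \<nu> Z = 0 \<and>
       (E - B) \<union> (B - E) \<subseteq> Z \<and>
       (\<forall>A. A \<in> sets borel \<and> A \<subseteq> B \<and> rel_compact W A \<longrightarrow> 0 \<le> val \<nu> A))"

end

theory Submission
  imports Defs
begin

text \<open>Why the theorem holds. Write \<open>\<Delta>u = P - Q\<close> with positive measures \<open>P\<close> and \<open>Q\<close>. Off the set of
  zero capacity that carries the concentrated part, the diffuse part is \<open>\<Delta>u\<close> itself, so by the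
  Hahn decomposition and inner regularity it is enough to show \<open>Q K = 0\<close> for every compact
  \<open>K \<subseteq> [u = 0]\<close> with \<open>P K = 0\<close> on which \<open>Q\<close> charges no set of zero capacity (\<open>negative_diffuse_mass_vanishes\<close>).

  The formal reason is a truncation. The function \<open>\<Phi> t = e t / (e + t)\<close> is concave and increasing on
  \<open>t \<ge> 0\<close>, bounded by \<open>e\<close>, and \<open>\<Phi>' 0 = 1\<close>. Hence \<open>\<Delta>(\<Phi> u) = \<Phi>' u \<Delta>u + \<Phi>'' u \<bar>\<nabla>u\<bar>\<^sup>2 \<le> \<Phi>' u (P - Q)\<close>. Testing
  this with a cutoff function \<open>\<phi>\<close> of \<open>K\<close> whose support has \<open>P\<close>-mass at most \<open>\<eta>\<close> gives
  \<open>\<integral> \<phi> (\<Phi>' u) dQ \<le> \<eta> + e \<integral> \<bar>\<Delta>\<phi>\<bar>\<close>. On \<open>K\<close> the factor \<open>\<Phi>' u\<close> is 1, so \<open>Q K\<close> is at most a constant times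
  \<open>\<eta>\<close> plus a term that vanishes with \<open>e\<close>; then let \<open>\<eta>\<close> tend to 0.

  The values of \<open>u\<close> on \<open>K\<close> have a meaning only through the quasicontinuous representative, so the
  argument is carried out for the mollifications \<open>u\<^sub>n = \<rho>\<^sub>n * u\<close>. It yields the same inequality
  (\<open>truncated_energy_estimate\<close>, \<open>mollified_estimate\<close>), with an error \<open>(2 / e) \<integral>\<^sub>K z\<^sub>n dQ\<close> for
  \<open>z\<^sub>n = \<rho>\<^sub>n * (\<phi> \<Phi>(u\<^sub>n))\<close>, and the discarded term with \<open>\<Phi>''\<close> bounds the \<open>z\<^sub>n\<close> in \<open>W\<^sup>1\<^sup>,\<^sup>2\<close>. It remains
  to see that the error is small for some large \<open>n\<close> (\<open>limit_estimate\<close>). If it stayed above some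
  \<open>c > 0\<close>, the same would be true of all convex combinations of the \<open>z\<^sub>n\<close>. Some of these converge
  strongly in \<open>W\<^sup>1\<^sup>,\<^sup>2\<close> to \<open>\<phi> \<Phi>(u)\<close> (\<open>W12_almost_minimal_Cauchy\<close>). A strongly convergent sequence of
  continuous functions has a subsequence that converges to the quasicontinuous representative of its
  limit outside a set of zero capacity. On \<open>K\<close> that representative is 0, and \<open>Q\<close> does not see the
  exceptional set, so the integrals over \<open>K\<close> tend to 0 (\<open>diffuse_integral_vanishes\<close>), a contradiction.

  The convergence outside a set of zero capacity rests on a Chebyshev inequality and a Borel--Cantelli
  lemma for the capacity (\<open>cap_exceed\<close>, \<open>cap_limsup_zero\<close>), hence on completeness of \<open>W\<^sup>1\<^sup>,\<^sup>2\<close> and on a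
  chain rule in \<open>W\<^sup>1\<^sup>,\<^sup>2\<close> (\<open>W12_complete\<close>, \<open>W12_chain\<close>).\<close>

section \<open>Smooth functions\<close>

text \<open>Smoothness asks for all iterated partial derivatives at once, so closure of the smooth
  functions under products or compositions is not accessible to a direct induction. The hull under
  all these operations is mapped to itself by partial derivatives, and its members are differentiable;
  therefore they are smooth.\<close>

inductive smooth_hull :: "('a::euclidean_space \<Rightarrow> real) \<Rightarrow> bool" where
  hull_smooth: "smooth f \<Longrightarrow> smooth_hull f"
| hull_const: "smooth_hull (\<lambda>_. c)"
| hull_inner: "smooth_hull (\<lambda>x. x \<bullet> v)"
| hull_add: "smooth_hull f \<Longrightarrow> smooth_hull g \<Longrightarrow> smooth_hull (\<lambda>x. f x + g x)"
| hull_mult: "smooth_hull f \<Longrightarrow> smooth_hull g \<Longrightarrow> smooth_hull (\<lambda>x. f x * g x)"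
| hull_comp: "(\<And>n t. (G n has_real_derivative G (Suc n) t) (at t)) \<Longrightarrow> smooth_hull f \<Longrightarrow> smooth_hull (\<lambda>x. G n (f x))"
| hull_affine: "smooth_hull f \<Longrightarrow> smooth_hull (\<lambda>x. f (a + c *\<^sub>R x))"

lemma partial_eq: "(f has_derivative f') (at x) \<Longrightarrow> partial b f x = f' b"
  unfolding partial_def by (simp add: frechet_derivative_at[symmetric])

lemma smooth_partial: "smooth (f :: 'a::euclidean_space \<Rightarrow> real) \<Longrightarrow> b \<in> Basis \<Longrightarrow> smooth (partial b f)"
  unfolding smooth_def
proof (intro allI impI)
  fix bs :: "'a list" and x :: 'a assume f: "\<forall>bs. set bs \<subseteq> Basis \<longrightarrow> (\<forall>x. foldr partial bs f differentiable at x)"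
    and "b \<in> Basis" "set bs \<subseteq> Basis"
  then show "foldr partial bs (partial b f) differentiable at x"
    using f[rule_format, of "bs @ [b]"] by simp
qed

lemma smooth_differentiable: "smooth f \<Longrightarrow> f differentiable (at x)"
  unfolding smooth_def by (metis empty_subsetI foldr_Nil id_apply list.set(1))

lemma smooth_has_derivative: "smooth f \<Longrightarrow> (f has_derivative frechet_derivative f (at x)) (at x)"
  using smooth_differentiable frechet_derivative_works by blast

lemma smooth_hull_partial: "smooth_hull f \<Longrightarrow> (\<forall>x. f differentiable (at x)) \<and> (\<forall>b\<in>Basis. smooth_hull (partial b f))"
proof (induction rule: smooth_hull.induct)
  case (hull_smooth f)
  then show ?case using smooth_partial smooth_differentiable smooth_hull.hull_smooth by blast
next
  case (hull_const c)
  have "partial b (\<lambda>_::'a. c) = (\<lambda>_. 0)" for b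
    by (rule ext, rule partial_eq) (auto intro!: derivative_eq_intros)
  then show ?case by (auto intro: smooth_hull.hull_const)
next
  case (hull_inner v)
  have "partial b (\<lambda>x::'a. x \<bullet> v) = (\<lambda>_. b \<bullet> v)" for b
    by (rule ext, rule partial_eq) (auto intro!: derivative_eq_intros)
  moreover have "(\<lambda>x::'a. x \<bullet> v) differentiable at x" for x
    unfolding differentiable_def by (auto intro!: derivative_eq_intros)
  ultimately show ?case by (auto intro: smooth_hull.hull_const)
next
  case (hull_add f g)
  have "partial b (\<lambda>x. f x + g x) = (\<lambda>x. partial b f x + partial b g x)" for b
  proof
    fix x
    show "partial b (\<lambda>x. f x + g x) x = partial b f x + partial b g x"
      unfolding partial_def[of b f] partial_def[of b g] using hull_add
      by (intro partial_eq has_derivative_add) (auto simp: frechet_derivative_works[symmetric])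
  qed
  with hull_add show ?case by (auto intro: smooth_hull.hull_add)
next
  case (hull_mult f g)
  have "partial b (\<lambda>x. f x * g x) = (\<lambda>x. f x * partial b g x + partial b f x * g x)" for b
  proof
    fix x
    show "partial b (\<lambda>x. f x * g x) x = f x * partial b g x + partial b f x * g x"
      unfolding partial_def[of b f] partial_def[of b g] using hull_mult
      by (intro partial_eq has_derivative_mult) (auto simp: frechet_derivative_works[symmetric])
  qed
  with hull_mult show ?case by (auto intro!: smooth_hull.hull_add smooth_hull.hull_mult)
next
  case (hull_comp G f n)
  have D: "((\<lambda>x. G n (f x)) has_derivative (\<lambda>h. G (Suc n) (f x) * frechet_derivative f (at x) h)) (at x)" for x
  proof -
    have "(G n has_derivative (\<lambda>h. G (Suc n) (f x) * h)) (at (f x))"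
      using hull_comp(1)[of n "f x"] by (simp add: has_field_derivative_def)
    moreover have "(f has_derivative frechet_derivative f (at x)) (at x)"
      using hull_comp by (auto simp: frechet_derivative_works[symmetric])
    ultimately show ?thesis using has_derivative_compose by blast
  qed
  have "partial b (\<lambda>x. G n (f x)) = (\<lambda>x. G (Suc n) (f x) * partial b f x)" for b
    by (rule ext, subst partial_eq[OF D]) (simp add: partial_def)
  moreover have "smooth_hull (\<lambda>x. G (Suc n) (f x))" by (rule smooth_hull.hull_comp) (use hull_comp in auto)
  moreover have "(\<lambda>x. G n (f x)) differentiable (at x)" for x
    using D differentiable_def by blast
  ultimately show ?case using hull_comp by (auto intro!: smooth_hull.hull_mult)
next
  case (hull_affine f a c)
  have D: "((\<lambda>x. f (a + c *\<^sub>R x)) has_derivative (\<lambda>h. frechet_derivative f (at (a + c *\<^sub>R x)) (c *\<^sub>R h))) (at x)" for x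
  proof -
    have "((\<lambda>x. a + c *\<^sub>R x) has_derivative (\<lambda>h. c *\<^sub>R h)) (at x)"
      by (auto intro!: derivative_eq_intros)
    moreover have "(f has_derivative frechet_derivative f (at (a + c *\<^sub>R x))) (at (a + c *\<^sub>R x))"
      using hull_affine by (auto simp: frechet_derivative_works[symmetric])
    ultimately show ?thesis using has_derivative_compose by blast
  qed
  have "partial b (\<lambda>x. f (a + c *\<^sub>R x)) = (\<lambda>x. c * partial b f (a + c *\<^sub>R x))" for b
  proof
    fix x
    have "linear (frechet_derivative f (at (a + c *\<^sub>R x)))"
      using hull_affine by (simp add: linear_frechet_derivative)
    then show "partial b (\<lambda>x. f (a + c *\<^sub>R x)) x = c * partial b f (a + c *\<^sub>R x)"
      by (subst partial_eq[OF D]) (simp add: partial_def linear_cmul)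
  qed
  moreover have "(\<lambda>x. f (a + c *\<^sub>R x)) differentiable (at x)" for x
    using D differentiable_def by blast
  ultimately show ?case using hull_affine by (auto intro!: smooth_hull.hull_mult smooth_hull.hull_affine smooth_hull.hull_const)
qed

lemma smooth_hull_imp_smooth: assumes "smooth_hull f" shows "smooth f"
  unfolding smooth_def
proof (intro allI impI)
  fix bs x assume bs: "set bs \<subseteq> (Basis :: 'a set)"
  have "smooth_hull (foldr partial bs f)" using bs by (induction bs) (use assms smooth_hull_partial in auto)
  then show "foldr partial bs f differentiable at x" using smooth_hull_partial by blast
qed

lemma smooth_hull_iff: "smooth_hull f \<longleftrightarrow> smooth f"
  using smooth_hull_imp_smooth hull_smooth by blast

lemmas smooth_intros = hull_const[unfolded smooth_hull_iff] hull_inner[unfolded smooth_hull_iff]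
  hull_add[unfolded smooth_hull_iff] hull_mult[unfolded smooth_hull_iff] hull_affine[unfolded smooth_hull_iff]

lemmas smooth_compose = hull_comp[unfolded smooth_hull_iff]

lemma smooth_sum: "(\<And>i. i \<in> I \<Longrightarrow> smooth (f i)) \<Longrightarrow> smooth (\<lambda>x. \<Sum>i\<in>I. f i x)"
  by (induction I rule: infinite_finite_induct) (auto intro: smooth_intros)

lemma smooth_exp: assumes "smooth f" shows "smooth (\<lambda>x. exp (c * f x))"
proof -
  have "smooth (\<lambda>x. (\<lambda>n t. c ^ n * exp (c * t)) 0 (f x))"
    by (rule smooth_compose[OF _ assms]) (auto intro!: derivative_eq_intros)
  then show ?thesis by simp
qed

text \<open>The derivatives of \<open>exp (-1/t)\<close> have the form \<open>p (1/t) * exp (-1/t)\<close> with a polynomial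
  \<open>p\<close>, and therefore all of them extend by zero to \<open>t \<le> 0\<close>.\<close>

fun flat_poly :: "nat \<Rightarrow> real poly" where
  "flat_poly 0 = 1"
| "flat_poly (Suc n) = [:0, 0, 1:] * (flat_poly n - pderiv (flat_poly n))"

definition flat :: "nat \<Rightarrow> real \<Rightarrow> real" where
  "flat n t = (if t \<le> 0 then 0 else poly (flat_poly n) (1 / t) * exp (- (1 / t)))"

lemma poly_exp_tendsto_0: "((\<lambda>x. poly p x * exp (- x)) \<longlongrightarrow> (0::real)) at_top"
proof -
  have "((\<lambda>x. \<Sum>i\<le>degree p. coeff p i * (x ^ i / exp x)) \<longlongrightarrow> (\<Sum>i\<le>degree p. coeff p i * 0)) at_top"
    by (intro tendsto_sum tendsto_mult tendsto_const tendsto_power_div_exp_0)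
  moreover have "(\<Sum>i\<le>degree p. coeff p i * (x ^ i / exp x)) = poly p x * exp (- x)" for x
    by (simp add: poly_altdef sum_distrib_right exp_minus divide_inverse mult.assoc)
  ultimately show ?thesis by simp
qed

lemma flat_deriv: "(flat n has_real_derivative flat (Suc n) t) (at t)"
proof -
  consider "t < 0" | "t = 0" | "t > 0" by linarith
  then show ?thesis
  proof cases
    case 1
    have "((\<lambda>_. 0) has_real_derivative 0) (at t)" by simp
    then have "(flat n has_real_derivative 0) (at t)"
      by (rule has_field_derivative_transform_within_open[where S="{..<0}"])
        (use 1 in \<open>auto simp: flat_def\<close>)
    with 1 show ?thesis by (simp add: flat_def)
  next
    case 3
    have "((\<lambda>t. poly (flat_poly n) (1 / t) * exp (- (1 / t))) has_real_derivative flat (Suc n) t) (at t)"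
      using 3 by (auto intro!: derivative_eq_intros DERIV_chain2[OF poly_DERIV]
          simp: flat_def field_simps power2_eq_square)
    then show ?thesis
      by (rule has_field_derivative_transform_within_open[where S="{0<..}"])
        (use 3 in \<open>auto simp: flat_def\<close>)
  next
    case 2
    have R: "((\<lambda>h. flat n h / h) \<longlongrightarrow> 0) (at_right 0)"
    proof -
      have "((\<lambda>x. poly (pCons 0 (flat_poly n)) x * exp (- x)) \<longlongrightarrow> 0) at_top"
        by (rule poly_exp_tendsto_0)
      then have "((\<lambda>h. poly (pCons 0 (flat_poly n)) (inverse h) * exp (- inverse h)) \<longlongrightarrow> 0) (at_right (0::real))"
        by (rule filterlim_compose[OF _ filterlim_inverse_at_top_right])
      then show ?thesis
        by (rule tendsto_cong[THEN iffD1, rotated])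
          (auto simp: eventually_at_right_field flat_def field_simps intro!: exI[of _ 1])
    qed
    have L: "((\<lambda>h. flat n h / h) \<longlongrightarrow> 0) (at_left 0)"
      by (rule tendsto_cong[THEN iffD1, rotated, OF tendsto_const])
        (auto simp: eventually_at_left_field flat_def intro!: exI[of _ "-1"])
    have "((\<lambda>h. flat n h / h) \<longlongrightarrow> 0) (at 0)"
      using L R by (simp add: filterlim_at_split)
    then show ?thesis using 2 by (simp add: DERIV_def flat_def)
  qed
qed

lemma flat0: "flat 0 t = (if t \<le> 0 then 0 else exp (- (1 / t)))"
  by (simp add: flat_def)

definition bump :: "'a::euclidean_space \<Rightarrow> real" where
  "bump x = flat 0 (1 - (norm x)\<^sup>2)"

lemma smooth_bump: "smooth (bump :: 'a::euclidean_space \<Rightarrow> real)"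
proof -
  have "smooth (\<lambda>x::'a. 1 + (-1) * (\<Sum>b\<in>Basis. (x \<bullet> b) * (x \<bullet> b)))"
    by (intro smooth_intros smooth_sum)
  moreover have "1 + (-1) * (\<Sum>b\<in>Basis. (x \<bullet> b) * (x \<bullet> b)) = 1 - (norm x)\<^sup>2" for x :: 'a
    unfolding power2_norm_eq_inner euclidean_inner[of x x] by simp
  ultimately have "smooth (\<lambda>x::'a. 1 - (norm x)\<^sup>2)" by simp
  from smooth_compose[where G = flat and n = 0, OF flat_deriv this]
  show ?thesis unfolding bump_def[abs_def] .
qed

lemma bump_nonneg: "0 \<le> bump x" by (simp add: bump_def flat0)

lemma bump_pos_iff: "0 < bump x \<longleftrightarrow> norm x < 1"
proof -
  have "(norm x)\<^sup>2 < 1 \<longleftrightarrow> norm x < 1" using abs_square_less_1[of "norm x"] by simp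
  then show ?thesis by (cases "norm x < 1") (auto simp: bump_def flat0)
qed

lemma bump_eq_0_iff: "bump x = 0 \<longleftrightarrow> 1 \<le> norm x"
  using bump_pos_iff[of x] bump_nonneg[of x] by linarith

lemma bump_minus: "bump (- x) = bump x" by (simp add: bump_def)

lemma test_functionsI:
  assumes "smooth f" "closed C" "bounded C" "C \<subseteq> W" "\<And>x. x \<notin> C \<Longrightarrow> f x = 0"
  shows "f \<in> test_functions W"
proof -
  have "closure {x. f x \<noteq> 0} \<subseteq> C" using assms by (intro closure_minimal) auto
  moreover from this have "compact (closure {x. f x \<noteq> 0})"
    using assms(3) bounded_subset by (auto simp: compact_eq_bounded_closed)
  ultimately show ?thesis using assms unfolding test_functions_def by auto
qed

text \<open>Finitely many bumps have a sum \<open>s\<close> that is positive on \<open>K\<close>. The function \<open>1 - exp (-l s)\<close>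
  vanishes with \<open>s\<close>, stays below 1, and is at least 1/2 on \<open>K\<close> once \<open>l\<close> is large. The lower bound
  must not depend on \<open>V\<close>, because \<open>V\<close> will shrink to \<open>K\<close>.\<close>

lemma cutoff_exists:
  fixes K V :: "'a::euclidean_space set"
  assumes "compact K" "open V" "K \<subseteq> V"
  obtains \<phi> where "\<phi> \<in> test_functions V" "\<And>x. 0 \<le> \<phi> x" "\<And>x. \<phi> x \<le> 1" "\<And>x. x \<in> K \<Longrightarrow> 1 / 2 \<le> \<phi> x"
proof -
  have "\<exists>r. 0 < r \<and> cball x r \<subseteq> V" if "x \<in> K" for x
    using that assms open_contains_cball by (metis subsetD)
  then obtain r where r: "\<And>x. x \<in> K \<Longrightarrow> 0 < r x \<and> cball x (r x) \<subseteq> V" by metis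
  obtain D where D: "D \<subseteq> K" "finite D" "K \<subseteq> (\<Union>x\<in>D. ball x (r x))"
    by (rule compactE_image[OF assms(1), of K "\<lambda>x. ball x (r x)"]) (use r in force)+
  define s where "s x = (\<Sum>p\<in>D. bump (- (inverse (r p)) *\<^sub>R p + inverse (r p) *\<^sub>R x))" for x
  have norm_eq: "norm (- (inverse (r p)) *\<^sub>R p + inverse (r p) *\<^sub>R x) = dist p x / r p" if "p \<in> D" for p x
  proof -
    have "- (inverse (r p)) *\<^sub>R p + inverse (r p) *\<^sub>R x = inverse (r p) *\<^sub>R (x - p)"
      by (simp add: scaleR_diff_right)
    then show ?thesis using r[of p] D that by (simp add: dist_norm norm_minus_commute subset_eq divide_inverse)
  qed
  have s_smooth: "smooth s"
    unfolding s_def by (intro smooth_sum smooth_intros smooth_bump)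
  have s_nonneg: "0 \<le> s x" for x unfolding s_def by (intro sum_nonneg bump_nonneg)
  have s_pos: "0 < s x" if x: "x \<in> K" for x
  proof -
    obtain p where "p \<in> D" "x \<in> ball p (r p)" using D(3) x by blast
    then have "0 < bump (- (inverse (r p)) *\<^sub>R p + inverse (r p) *\<^sub>R x)"
      using norm_eq r D by (auto simp: bump_pos_iff subset_eq)
    then show ?thesis unfolding s_def using \<open>p \<in> D\<close> D bump_nonneg by (intro sum_pos2) auto
  qed
  have "\<exists>c>0. \<forall>x\<in>K. c \<le> s x"
  proof (cases "K = {}")
    case False
    have "continuous_on K s"
      using s_smooth by (intro continuous_at_imp_continuous_on)
        (auto intro: differentiable_imp_continuous_within smooth_differentiable)
    then obtain x where "x \<in> K" "\<forall>y\<in>K. s x \<le> s y"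
      using continuous_attains_inf[OF assms(1) False] by blast
    then show ?thesis using s_pos by blast
  qed (auto intro: exI[of _ 1])
  then obtain c where c: "c > 0" "\<And>x. x \<in> K \<Longrightarrow> c \<le> s x" by blast
  define \<phi> where "\<phi> x = 1 + (-1) * exp (- (ln 2 / c) * s x)" for x
  have "smooth \<phi>" unfolding \<phi>_def by (intro smooth_intros smooth_exp s_smooth)
  moreover have "\<phi> x = 0" if "x \<notin> (\<Union>p\<in>D. cball p (r p))" for x
  proof -
    have "s x = 0" unfolding s_def
    proof (rule sum.neutral, rule ballI)
      fix p assume "p \<in> D"
      then have "1 \<le> dist p x / r p" using that D r[of p] by (auto simp: subset_eq)
      then show "bump (- (inverse (r p)) *\<^sub>R p + inverse (r p) *\<^sub>R x) = 0"
        using norm_eq \<open>p \<in> D\<close> by (simp add: bump_eq_0_iff)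
    qed
    then show ?thesis by (simp add: \<phi>_def)
  qed
  moreover have "(\<Union>p\<in>D. cball p (r p)) \<subseteq> V" using D(1) r by blast
  ultimately have T: "\<phi> \<in> test_functions V"
    using D(2) by (intro test_functionsI[of \<phi> "\<Union>p\<in>D. cball p (r p)"]) (auto simp: compact_imp_closed)
  have B: "0 \<le> \<phi> x" "\<phi> x \<le> 1" for x
  proof -
    have "0 \<le> ln 2 / c * s x" using s_nonneg[of x] c(1) by simp
    then have "exp (- (ln 2 / c * s x)) \<le> 1" by (subst exp_le_one_iff) linarith
    then show "0 \<le> \<phi> x" "\<phi> x \<le> 1"
      unfolding \<phi>_def by (simp_all only: mult_minus_left mult_1_left) (use exp_ge_zero[of "- (ln 2 / c * s x)"] in linarith)+
  qed
  have H: "1 / 2 \<le> \<phi> x" if "x \<in> K" for x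
  proof -
    have "ln 2 * c \<le> ln 2 * s x" using c(2)[OF that] by (intro mult_left_mono) auto
    then have "ln 2 \<le> ln 2 / c * s x" using c(1) by (simp add: pos_le_divide_eq)
    then have "exp (- (ln 2 / c * s x)) \<le> exp (- ln (2::real))" by (subst exp_le_cancel_iff) linarith
    also have "\<dots> = 1 / 2" by (simp add: exp_minus inverse_eq_divide)
    finally show ?thesis unfolding \<phi>_def by (simp only: mult_minus_left mult_1_left)
  qed
  show ?thesis by (rule that[OF T B(1) B(2) H])
qed

section \<open>Directional derivatives and integration by parts\<close>

text \<open>Derivatives along lines are what the fundamental theorem of calculus and differentiation
  under the integral provide. For smooth functions they agree with the partial derivatives.\<close>

definition has_ddir :: "'a::euclidean_space \<Rightarrow> ('a \<Rightarrow> real) \<Rightarrow> ('a \<Rightarrow> real) \<Rightarrow> bool" where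
  "has_ddir b f f' \<longleftrightarrow> (\<forall>x. ((\<lambda>t. f (x + t *\<^sub>R b)) has_real_derivative f' x) (at 0))"

lemma has_ddirD:
  assumes "has_ddir b f f'"
  shows "((\<lambda>t. f (x + t *\<^sub>R b)) has_real_derivative f' (x + s *\<^sub>R b)) (at s)"
proof -
  have 1: "((\<lambda>t. f ((x + s *\<^sub>R b) + t *\<^sub>R b)) has_real_derivative f' (x + s *\<^sub>R b)) (at (s - s))"
    using assms unfolding has_ddir_def by simp
  have "((\<lambda>t. t - s) has_real_derivative 1) (at s)" by (auto intro!: derivative_eq_intros)
  from DERIV_chain2[OF 1 this] show ?thesis by (simp add: algebra_simps)
qed

lemma has_ddir_smooth: assumes "smooth f" shows "has_ddir b f (partial b f)"
  unfolding has_ddir_def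
proof
  fix x
  have 1: "(f has_derivative frechet_derivative f (at x)) (at (x + 0 *\<^sub>R b))"
    using smooth_has_derivative[OF assms] by simp
  have 2: "((\<lambda>t. x + t *\<^sub>R b) has_derivative (\<lambda>t. t *\<^sub>R b)) (at (0::real))"
    by (auto intro!: derivative_eq_intros)
  have "linear (frechet_derivative f (at x))"
    using assms by (simp add: linear_frechet_derivative smooth_differentiable)
  then show "((\<lambda>t. f (x + t *\<^sub>R b)) has_real_derivative partial b f x) (at 0)"
    using has_derivative_compose[OF 2 1]
    by (simp add: has_field_derivative_def partial_def linear_cmul mult_commute_abs)
qed

lemma has_ddir_mult:
  "has_ddir b f f' \<Longrightarrow> has_ddir b g g' \<Longrightarrow> has_ddir b (\<lambda>x. f x * g x) (\<lambda>x. f' x * g x + f x * g' x)"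
  unfolding has_ddir_def by (auto intro!: derivative_eq_intros)

lemma has_ddir_chain:
  assumes "has_ddir b f f'" "\<And>x. (g has_real_derivative g' (f x)) (at (f x))"
  shows "has_ddir b (\<lambda>x. g (f x)) (\<lambda>x. g' (f x) * f' x)"
  unfolding has_ddir_def
proof
  fix x
  have "(g has_real_derivative g' (f x)) (at (f (x + 0 *\<^sub>R b)))" using assms(2)[of x] by simp
  moreover have "((\<lambda>t. f (x + t *\<^sub>R b)) has_real_derivative f' x) (at 0)"
    using assms(1) by (simp add: has_ddir_def)
  ultimately show "((\<lambda>t. g (f (x + t *\<^sub>R b))) has_real_derivative g' (f x) * f' x) (at 0)"
    by (rule DERIV_chain2)
qed

lemma smooth_continuous: "smooth f \<Longrightarrow> continuous_on S f"
  by (intro continuous_at_imp_continuous_on ballI differentiable_imp_continuous_within)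
    (simp add: smooth_differentiable)

lemma smooth_borel: "smooth f \<Longrightarrow> f \<in> borel_measurable borel"
  by (rule borel_measurable_continuous_onI[OF smooth_continuous])

lemma integrable_bounded_support:
  fixes f :: "'a::euclidean_space \<Rightarrow> real"
  assumes "f \<in> borel_measurable borel" "\<And>x. \<bar>f x\<bar> \<le> C" "\<And>x. r < norm x \<Longrightarrow> f x = 0"
  shows "integrable lborel f"
proof (rule integrableI_bounded_set[where A = "cball 0 r" and B = C])
  show "emeasure lborel (cball (0::'a) r) < \<infinity>" by (rule emeasure_bounded_finite) simp
  show "AE x in lborel. x \<in> cball 0 r \<longrightarrow> norm (f x) \<le> C" using assms by simp
  show "AE x in lborel. x \<notin> cball 0 r \<longrightarrow> f x = 0" using assms(3) by simp
qed (use assms in auto)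

lemma continuous_bounded_support:
  fixes f :: "'a::euclidean_space \<Rightarrow> real"
  assumes "continuous_on UNIV f" "\<And>x. r < norm x \<Longrightarrow> f x = 0"
  shows "\<exists>C\<ge>0. \<forall>x. \<bar>f x\<bar> \<le> C"
proof -
  have "compact (f ` cball 0 r)"
    using assms(1) continuous_on_subset by (intro compact_continuous_image) auto
  then have "bounded (f ` cball 0 r)" by (rule compact_imp_bounded)
  then have "\<exists>C. \<forall>x\<in>cball 0 r. \<bar>f x\<bar> \<le> C" by (simp add: bounded_iff)
  then obtain C where C: "\<And>x. x \<in> cball 0 r \<Longrightarrow> \<bar>f x\<bar> \<le> C" by blast
  have "\<bar>f x\<bar> \<le> max C 0" for x using C[of x] assms(2)[of x] by (cases "norm x \<le> r") auto
  then show ?thesis by (intro exI[of _ "max C 0"]) simp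
qed

lemma integrable_continuous_support:
  fixes f :: "'a::euclidean_space \<Rightarrow> real"
  assumes "continuous_on UNIV f" "\<And>x. r < norm x \<Longrightarrow> f x = 0"
  shows "integrable lborel f"
proof -
  obtain C where "\<forall>x. \<bar>f x\<bar> \<le> C" using continuous_bounded_support[OF assms] by blast
  then show ?thesis
    using integrable_bounded_support[OF borel_measurable_continuous_onI[OF assms(1)], of C r] assms(2) by simp
qed

lemma lborel_integral_translate:
  fixes f :: "'a::euclidean_space \<Rightarrow> real"
  assumes [measurable]: "f \<in> borel_measurable borel"
  shows "(LINT x|lborel. f (a + x)) = (LINT x|lborel. f x)"
proof -
  have "(LINT x|lborel. f x) = (LINT x|distr lborel borel ((+) a). f x)" by (simp add: lborel_distr_plus)
  also have "\<dots> = (LINT x|lborel. f (a + x))" by (subst integral_distr) auto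
  finally show ?thesis by simp
qed

lemma lborel_distr_reflect: "distr lborel borel (\<lambda>x. a - x) = (lborel :: 'a::euclidean_space measure)"
  using lborel_affine[of "-1" a] by (simp add: density_1)

lemma lborel_integral_reflect:
  fixes f :: "'a::euclidean_space \<Rightarrow> real"
  assumes [measurable]: "f \<in> borel_measurable borel"
  shows "(LINT x|lborel. f (a - x)) = (LINT x|lborel. f x)"
proof -
  have "(LINT x|lborel. f x) = (LINT x|distr lborel borel (\<lambda>x. a - x). f x)" by (simp add: lborel_distr_reflect)
  also have "\<dots> = (LINT x|lborel. f (a - x))" by (subst integral_distr) auto
  finally show ?thesis by simp
qed

lemma lborel_integrable_reflect:
  fixes f :: "'a::euclidean_space \<Rightarrow> real"
  assumes [measurable]: "f \<in> borel_measurable borel"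
  shows "integrable lborel (\<lambda>x. f (a - x)) \<longleftrightarrow> integrable lborel f"
proof -
  have "integrable lborel f \<longleftrightarrow> integrable (distr lborel borel (\<lambda>x. a - x)) f" by (simp add: lborel_distr_reflect)
  also have "\<dots> \<longleftrightarrow> integrable lborel (\<lambda>x. f (a - x))" by (subst integrable_distr_eq) auto
  finally show ?thesis by simp
qed

text \<open>The support is described by a ball throughout; its complement is open, so a derivative
  vanishes there together with the function.\<close>

lemma has_ddir_support:
  assumes "has_ddir b h h'" "\<And>x. r < norm x \<Longrightarrow> h x = 0" "r < norm x"
  shows "h' x = 0"
proof -
  have "\<forall>\<^sub>F t in at 0. r < norm (x + t *\<^sub>R b)"
  proof (rule order_tendstoD)
    have "((\<lambda>t. norm (x + t *\<^sub>R b)) \<longlongrightarrow> norm (x + 0 *\<^sub>R b)) (at 0)" by (intro tendsto_intros)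
    then show "((\<lambda>t. norm (x + t *\<^sub>R b)) \<longlongrightarrow> norm x) (at 0)" by simp
  qed fact
  then have "\<forall>\<^sub>F t in at 0. h (x + t *\<^sub>R b) = 0" by (rule eventually_mono) (rule assms(2))
  moreover have "((\<lambda>t. h (x + t *\<^sub>R b)) has_real_derivative h' x) (at 0)"
    using assms(1) by (simp add: has_ddir_def)
  ultimately have "((\<lambda>t. 0) has_real_derivative h' x) (at 0)"
    using assms(2)[OF assms(3)] has_field_derivative_cong_eventually[of "\<lambda>t. h (x + t *\<^sub>R b)" "\<lambda>_. 0" 0 UNIV] by simp
  then show ?thesis using DERIV_unique DERIV_const by blast
qed

text \<open>Integrating \<open>h (x + b) - h x = \<integral>\<^sub>0\<^sup>1 h' (x + t b) dt\<close> over \<open>x\<close> gives \<open>0\<close> on the left by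
  translation invariance, and \<open>\<integral> h'\<close> on the right by Fubini and translation invariance.\<close>

lemma integral_ddir_zero:
  fixes h :: "'a::euclidean_space \<Rightarrow> real"
  assumes d: "has_ddir b h h'" and c: "continuous_on UNIV h" "continuous_on UNIV h'"
    and s: "\<And>x. r < norm x \<Longrightarrow> h x = 0"
  shows "(LINT x|lborel. h' x) = 0"
proof -
  have s': "h' x = 0" if "r < norm x" for x by (rule has_ddir_support[OF d s that])
  have [measurable]: "h \<in> borel_measurable borel" "h' \<in> borel_measurable borel"
    using c borel_measurable_continuous_onI by auto
  have int_h: "integrable lborel h" by (rule integrable_continuous_support[OF c(1) s])
  obtain C where C: "0 \<le> C" "\<forall>x. \<bar>h' x\<bar> \<le> C" using continuous_bounded_support[OF c(2) s'] by blast
  define F where "F = (\<lambda>(x, t). h' (x + t *\<^sub>R b) * indicator {0..1::real} t)"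
  have [measurable]: "F \<in> borel_measurable (borel \<Otimes>\<^sub>M borel)" unfolding F_def by measurable
  have "integrable lborel F"
  proof (rule integrable_bounded_support)
    show "F \<in> borel_measurable borel" by (simp flip: borel_prod)
    show "\<bar>F z\<bar> \<le> C" for z using C by (auto simp: F_def indicator_def split: prod.splits)
    show "F z = 0" if "r + norm b + 1 < norm z" for z
    proof (cases z)
      case (Pair x t)
      show ?thesis
      proof (cases "t \<in> {0..1}")
        case True
        then have "\<bar>t\<bar> \<le> 1" "norm (t *\<^sub>R b) \<le> norm b" by (auto simp: mult_left_le_one_le)
        moreover have "norm z \<le> norm x + \<bar>t\<bar>" using norm_Pair_le[of x t] Pair by simp
        moreover have "norm x \<le> norm (x + t *\<^sub>R b) + norm (t *\<^sub>R b)"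
          using norm_triangle_ineq4[of "x + t *\<^sub>R b" "t *\<^sub>R b"] by simp
        ultimately have "r < norm (x + t *\<^sub>R b)" using that by linarith
        then show ?thesis using s' Pair by (simp add: F_def)
      qed (simp add: F_def Pair)
    qed
  qed
  then have int_F: "integrable (lborel \<Otimes>\<^sub>M lborel) F" by (simp add: lborel_prod)
  have FTC: "(LINT t|lborel. F (x, t)) = h (x + b) - h x" for x
  proof -
    have "has_bochner_integral lborel (\<lambda>t. h' (x + t *\<^sub>R b) * indicator {0..1} t) (h (x + 1 *\<^sub>R b) - h (x + 0 *\<^sub>R b))"
    proof (rule has_bochner_integral_FTC_Icc_real)
      show "((\<lambda>t. h (x + t *\<^sub>R b)) has_real_derivative h' (x + t *\<^sub>R b)) (at t)" for t
        by (rule has_ddirD[OF d])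
      show "isCont (\<lambda>t. h' (x + t *\<^sub>R b)) t" for t
        by (rule continuous_at_compose[unfolded o_def, of t "\<lambda>t. x + t *\<^sub>R b" h'])
          (use c(2) in \<open>auto intro!: continuous_intros simp: continuous_on_eq_continuous_at\<close>)
    qed simp
    then show ?thesis by (simp add: F_def has_bochner_integral_iff)
  qed
  have "0 = (LINT x|lborel. h (b + x)) - (LINT x|lborel. h x)" by (simp add: lborel_integral_translate)
  also have "\<dots> = (LINT x|lborel. h (x + b) - h x)"
  proof (subst Bochner_Integration.integral_diff)
    have "integrable (distr lborel borel ((+) b)) h" using int_h by (simp add: lborel_distr_plus)
    then show "integrable lborel (\<lambda>x. h (x + b))" by (subst (asm) integrable_distr_eq) (auto simp: add.commute)
  qed (use int_h in \<open>auto simp: add.commute\<close>)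
  also have "\<dots> = (LINT x|lborel. LINT t|lborel. F (x, t))" by (simp add: FTC)
  also have "\<dots> = (LINT t|lborel. LINT x|lborel. F (x, t))"
    using lborel_pair.Fubini_integral[of "\<lambda>x t. F (x, t)"] int_F by simp
  also have "\<dots> = (LINT t|lborel. (LINT x|lborel. h' x) * indicator {0..1::real} t)"
  proof (rule Bochner_Integration.integral_cong[OF refl])
    fix t :: real
    show "(LINT x|lborel. F (x, t)) = (LINT x|lborel. h' x) * indicator {0..1::real} t"
      using lborel_integral_translate[of h' "t *\<^sub>R b"] by (simp add: F_def add.commute)
  qed
  also have "\<dots> = (LINT x|lborel. h' x)" by simp
  finally show ?thesis by simp
qed

lemma integral_by_parts:
  fixes f :: "'a::euclidean_space \<Rightarrow> real"
  assumes "has_ddir b f f'" "has_ddir b g g'"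
    "continuous_on UNIV f" "continuous_on UNIV f'" "continuous_on UNIV g" "continuous_on UNIV g'"
    and s: "\<And>x. r < norm x \<Longrightarrow> g x = 0"
  shows "(LINT x|lborel. f x * g' x) = - (LINT x|lborel. f' x * g x)"
proof -
  have s': "g' x = 0" if "r < norm x" for x by (rule has_ddir_support[OF assms(2) s that])
  have "(LINT x|lborel. f' x * g x + f x * g' x) = 0"
    by (rule integral_ddir_zero[OF has_ddir_mult[OF assms(1,2)], of r])
      (use assms in \<open>auto intro!: continuous_intros\<close>)
  moreover have "(LINT x|lborel. f' x * g x + f x * g' x) = (LINT x|lborel. f' x * g x) + (LINT x|lborel. f x * g' x)"
    by (intro Bochner_Integration.integral_add integrable_continuous_support[of _ r] continuous_intros)
      (use assms s' in auto)
  ultimately show ?thesis by simp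
qed

section \<open>Convolution with test functions\<close>

abbreviation test :: "('a::euclidean_space \<Rightarrow> real) \<Rightarrow> bool" where
  "test \<psi> \<equiv> \<psi> \<in> test_functions UNIV"

lemma test_smooth: "\<phi> \<in> test_functions W \<Longrightarrow> smooth \<phi>" by (simp add: test_functions_def)

lemma test_UNIV: "\<phi> \<in> test_functions W \<Longrightarrow> test \<phi>" by (simp add: test_functions_def)

lemma test_support: assumes "test \<psi>" shows "\<exists>r. \<forall>x. r < norm x \<longrightarrow> \<psi> x = 0"
proof -
  have "bounded {x. \<psi> x \<noteq> 0}"
    using assms by (auto simp: test_functions_def intro: bounded_subset[OF compact_imp_bounded closure_subset])
  then obtain r where "\<And>x. \<psi> x \<noteq> 0 \<Longrightarrow> norm x \<le> r" by (auto simp: bounded_iff)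
  then have "\<forall>x. r < norm x \<longrightarrow> \<psi> x = 0" by (meson not_le)
  then show ?thesis ..
qed

lemma test_partial: assumes "\<psi> \<in> test_functions W" "b \<in> Basis" shows "partial b \<psi> \<in> test_functions W"
proof (rule test_functionsI[of _ "closure {x. \<psi> x \<noteq> 0}"])
  show "smooth (partial b \<psi>)" using assms by (auto simp: smooth_partial test_functions_def)
  fix x assume x: "x \<notin> closure {x. \<psi> x \<noteq> 0}"
  have "((\<lambda>_. 0) has_derivative (\<lambda>_. 0)) (at x)" by simp
  then have "(\<psi> has_derivative (\<lambda>_. 0)) (at x)"
    by (rule has_derivative_transform_within_open[where s = "- closure {x. \<psi> x \<noteq> 0}"])
      (use x closure_subset[of "{x. \<psi> x \<noteq> 0}"] in auto)
  then show "partial b \<psi> x = 0" by (simp add: partial_eq)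
qed (use assms in \<open>auto simp: test_functions_def compact_imp_bounded\<close>)

lemma test_bounded: assumes "test \<psi>" shows "\<exists>C\<ge>0. \<forall>x. \<bar>\<psi> x\<bar> \<le> C"
proof -
  obtain r where "\<forall>x. r < norm x \<longrightarrow> \<psi> x = 0" using test_support[OF assms] ..
  then show ?thesis
    using continuous_bounded_support[OF smooth_continuous[OF test_smooth[OF assms]], of r] by simp
qed

lemma test_integrable: assumes "test \<psi>" shows "integrable lborel \<psi>"
proof -
  obtain r where "\<forall>x. r < norm x \<longrightarrow> \<psi> x = 0" using test_support[OF assms] ..
  then show ?thesis
    using integrable_continuous_support[OF smooth_continuous[OF test_smooth[OF assms]], of r] by simp
qed

lemma test_affine:
  fixes \<psi> :: "'a::euclidean_space \<Rightarrow> real"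
  assumes "test \<psi>" "c \<noteq> 0" shows "test (\<lambda>x. \<psi> (a + c *\<^sub>R x))"
proof -
  obtain r where r: "\<forall>x. r < norm x \<longrightarrow> \<psi> x = 0" using test_support[OF assms(1)] ..
  show ?thesis
  proof (rule test_functionsI[of _ "cball 0 ((r + norm a) / \<bar>c\<bar>)"])
    show "smooth (\<lambda>x. \<psi> (a + c *\<^sub>R x))" using test_smooth[OF assms(1)] by (rule smooth_intros)
    fix x :: 'a assume "x \<notin> cball 0 ((r + norm a) / \<bar>c\<bar>)"
    then have "r + norm a < norm (c *\<^sub>R x)" using assms(2) by (simp add: field_simps not_le)
    also have "\<dots> \<le> norm (a + c *\<^sub>R x) + norm a" using norm_triangle_ineq4[of "a + c *\<^sub>R x" a] by simp
    finally show "\<psi> (a + c *\<^sub>R x) = 0" using r by simp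
  qed auto
qed

lemma test_reflect: "test \<psi> \<Longrightarrow> test (\<lambda>y. \<psi> (x - y))"
  using test_affine[of \<psi> "-1" x] by simp

lemma partial_reflect:
  assumes "smooth \<psi>" shows "partial b (\<lambda>y. \<psi> (x - y)) = (\<lambda>y. - partial b \<psi> (x - y))"
proof
  fix y
  have "((\<lambda>y. \<psi> (x - y)) has_derivative (\<lambda>h. frechet_derivative \<psi> (at (x - y)) (- h))) (at y)"
    by (rule has_derivative_compose[OF _ smooth_has_derivative[OF assms], of "\<lambda>y. x - y"])
      (auto intro!: derivative_eq_intros)
  moreover have "linear (frechet_derivative \<psi> (at (x - y)))"
    using assms by (simp add: linear_frechet_derivative smooth_differentiable)
  ultimately show "partial b (\<lambda>y. \<psi> (x - y)) y = - partial b \<psi> (x - y)"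
    by (simp add: partial_eq linear_neg) (simp add: partial_def)
qed

text \<open>The measure is a parameter, so that the same operation mollifies functions (\<open>M = lborel\<close>) and
  finite measures (\<open>f = 1\<close>).\<close>

definition conv :: "'a measure \<Rightarrow> ('a::euclidean_space \<Rightarrow> real) \<Rightarrow> ('a \<Rightarrow> real) \<Rightarrow> 'a \<Rightarrow> real" where
  "conv M \<psi> f x = (LINT y|M. \<psi> (x - y) * f y)"

lemma conv_integrable:
  assumes "sets M = sets borel" "integrable M f" "test \<psi>"
  shows "integrable M (\<lambda>y. \<psi> (x - y) * f y)"
proof -
  obtain C where C: "\<forall>x. \<bar>\<psi> x\<bar> \<le> C" using test_bounded[OF assms(3)] by blast
  have [measurable]: "\<psi> \<in> borel_measurable borel" "f \<in> borel_measurable borel"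
    using smooth_borel[OF test_smooth[OF assms(3)]] assms(2) borel_measurable_integrable[of M f]
    by (auto simp: measurable_cong_sets[OF assms(1) refl])
  show ?thesis
  proof (rule Bochner_Integration.integrable_bound)
    show "integrable M (\<lambda>y. C * f y)" using assms(2) by simp
    show "(\<lambda>y. \<psi> (x - y) * f y) \<in> borel_measurable M"
      by (subst measurable_cong_sets[OF assms(1) refl]) measurable
    have "\<bar>\<psi> (x - y)\<bar> * \<bar>f y\<bar> \<le> C * \<bar>f y\<bar>" for y using C by (intro mult_right_mono) auto
    moreover have "0 \<le> C" using C[rule_format, of 0] by linarith
    ultimately show "AE y in M. norm (\<psi> (x - y) * f y) \<le> norm (C * f y)" by (simp add: abs_mult)
  qed
qed

lemma conv_continuous:
  fixes f \<psi> :: "'a::euclidean_space \<Rightarrow> real"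
  assumes M: "sets M = sets borel" "integrable M f" "test \<psi>"
  shows "continuous_on S (conv M \<psi> f)"
proof -
  obtain C where C: "\<forall>x. \<bar>\<psi> x\<bar> \<le> C" using test_bounded[OF assms(3)] by blast
  have cont: "isCont \<psi> x" for x
    using smooth_continuous[OF test_smooth[OF M(3)], of UNIV] by (simp add: continuous_on_eq_continuous_at)
  have m: "(\<lambda>y. \<psi> (x - y) * f y) \<in> borel_measurable M" for x
    using conv_integrable[OF assms] by auto
  have "(\<lambda>n. conv M \<psi> f (X n)) \<longlonglongrightarrow> conv M \<psi> f x" if "X \<longlonglongrightarrow> x" for X x
    unfolding conv_def
  proof (rule integral_dominated_convergence)
    show "integrable M (\<lambda>y. C * \<bar>f y\<bar>)" using M(2) by simp
    have "(\<lambda>n. \<psi> (X n - y) * f y) \<longlonglongrightarrow> \<psi> (x - y) * f y" for y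
      by (intro tendsto_intros isCont_tendsto_compose[OF cont] that)
    then show "AE y in M. (\<lambda>n. \<psi> (X n - y) * f y) \<longlonglongrightarrow> \<psi> (x - y) * f y" by simp
    show "AE y in M. norm (\<psi> (X n - y) * f y) \<le> C * \<bar>f y\<bar>" for n
      using C by (auto simp: abs_mult intro!: mult_right_mono)
  qed (rule m)+
  then show ?thesis unfolding continuous_on_sequentially by (auto simp: o_def)
qed

text \<open>The difference quotients of \<open>\<psi>\<close> are bounded by the maximum of its derivative, so dominated
  convergence applies along every sequence of step sizes.\<close>

lemma conv_has_ddir:
  fixes f \<psi> :: "'a::euclidean_space \<Rightarrow> real"
  assumes M: "sets M = sets borel" "integrable M f" "test \<psi>" and b: "b \<in> Basis"
  shows "has_ddir b (conv M \<psi> f) (conv M (partial b \<psi>) f)"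
  unfolding has_ddir_def
proof
  fix x
  note D = has_ddirD[OF has_ddir_smooth[OF test_smooth[OF M(3)], of b]]
  obtain C where C: "0 \<le> C" "\<forall>x. \<bar>partial b \<psi> x\<bar> \<le> C" using test_bounded[OF test_partial[OF M(3) b]] by blast
  have lip: "\<bar>\<psi> (z + t *\<^sub>R b) - \<psi> z\<bar> \<le> C * \<bar>t\<bar>" for z t
    using field_differentiable_bound[of UNIV "\<lambda>t. \<psi> (z + t *\<^sub>R b)" "\<lambda>t. partial b \<psi> (z + t *\<^sub>R b)" C t 0] D[of z] C(2) by simp
  have int: "integrable M (\<lambda>y. \<psi> (z - y) * f y)" for z by (rule conv_integrable[OF M])
  have lim: "(\<lambda>n. (conv M \<psi> f (x + X n *\<^sub>R b) - conv M \<psi> f x) / X n) \<longlonglongrightarrow> conv M (partial b \<psi>) f x"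
    if X: "\<And>n. X n \<noteq> 0" "X \<longlonglongrightarrow> 0" for X :: "nat \<Rightarrow> real"
  proof -
    define q where "q n y = (\<psi> (x + X n *\<^sub>R b - y) - \<psi> (x - y)) / X n * f y" for n y
    have "(conv M \<psi> f (x + X n *\<^sub>R b) - conv M \<psi> f x) / X n = (LINT y|M. q n y)" for n
      unfolding conv_def q_def using int
      by (subst Bochner_Integration.integral_diff[symmetric]) (auto simp: field_simps simp flip: integral_divide_zero)
    moreover have "(\<lambda>n. LINT y|M. q n y) \<longlonglongrightarrow> (LINT y|M. partial b \<psi> (x - y) * f y)"
    proof (rule integral_dominated_convergence)
      show "integrable M (\<lambda>y. C * \<bar>f y\<bar>)" using M(2) by simp
      show "(\<lambda>y. partial b \<psi> (x - y) * f y) \<in> borel_measurable M"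
        using conv_integrable[OF M(1,2) test_partial[OF M(3) b]] by auto
      have "(\<lambda>y. (\<psi> (x + X n *\<^sub>R b - y) * f y - \<psi> (x - y) * f y) / X n) \<in> borel_measurable M" for n
        using int by auto
      moreover have "q n = (\<lambda>y. (\<psi> (x + X n *\<^sub>R b - y) * f y - \<psi> (x - y) * f y) / X n)" for n
        by (auto simp: q_def field_simps)
      ultimately show "q n \<in> borel_measurable M" for n by simp
      show "AE y in M. norm (q n y) \<le> C * \<bar>f y\<bar>" for n
      proof (rule AE_I2)
        fix y
        have "\<bar>\<psi> (x + X n *\<^sub>R b - y) - \<psi> (x - y)\<bar> \<le> C * \<bar>X n\<bar>"
          using lip[of "x - y" "X n"] by (simp add: algebra_simps)
        then have "\<bar>\<psi> (x + X n *\<^sub>R b - y) - \<psi> (x - y)\<bar> / \<bar>X n\<bar> \<le> C" using X(1)[of n] by (simp add: field_simps)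
        then show "norm (q n y) \<le> C * \<bar>f y\<bar>"
          unfolding q_def real_norm_def abs_mult abs_divide by (rule mult_right_mono) simp
      qed
      show "AE y in M. (\<lambda>n. q n y) \<longlonglongrightarrow> partial b \<psi> (x - y) * f y"
      proof (rule AE_I2)
        fix y
        have "((\<lambda>h. (\<psi> (x - y + h *\<^sub>R b) - \<psi> (x - y)) / h) \<longlongrightarrow> partial b \<psi> (x - y)) (at 0)"
          using D[of "x - y" 0] by (simp add: DERIV_def)
        moreover have "filterlim X (at 0) sequentially" using X by (simp add: filterlim_at)
        ultimately have "(\<lambda>n. (\<psi> (x - y + X n *\<^sub>R b) - \<psi> (x - y)) / X n) \<longlonglongrightarrow> partial b \<psi> (x - y)"
          by (rule filterlim_compose)
        then have "(\<lambda>n. (\<psi> (x - y + X n *\<^sub>R b) - \<psi> (x - y)) / X n * f y) \<longlonglongrightarrow> partial b \<psi> (x - y) * f y"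
          by (rule tendsto_mult_right)
        then show "(\<lambda>n. q n y) \<longlonglongrightarrow> partial b \<psi> (x - y) * f y" by (simp add: q_def algebra_simps)
      qed
    qed
    ultimately show ?thesis by (simp add: conv_def)
  qed
  show "((\<lambda>t. conv M \<psi> f (x + t *\<^sub>R b)) has_real_derivative conv M (partial b \<psi>) f x) (at 0)"
    unfolding DERIV_def tendsto_at_iff_sequentially using lim by (auto simp: o_def)
qed

text \<open>Tonelli first in the variable of the kernel, whose integral is the same for all \<open>y\<close>; this gives
  the joint integrability. The formula moves the mollification from \<open>f M\<close> to the test function \<open>g\<close>.\<close>

lemma conv_Fubini:
  fixes f g \<psi> :: "'a::euclidean_space \<Rightarrow> real"
  assumes M: "sigma_finite_measure M" "sets M = sets borel" "integrable M f"
    and \<psi>: "\<psi> \<in> borel_measurable borel" "integrable lborel \<psi>"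
    and g: "g \<in> borel_measurable borel" "\<And>x. \<bar>g x\<bar> \<le> C"
  shows "integrable lborel (\<lambda>x. conv M \<psi> f x * g x)"
    and "(LINT x|lborel. conv M \<psi> f x * g x) = (LINT y|M. (LINT x|lborel. \<psi> (x - y) * g x) * f y)"
    and "integrable M (\<lambda>y. (LINT x|lborel. \<psi> (x - y) * g x) * f y)"
proof -
  interpret M: sigma_finite_measure M by fact
  interpret P': pair_sigma_finite M lborel ..
  have [measurable_cong]: "sets M = sets borel" by fact
  have [measurable]: "\<psi> \<in> borel_measurable borel" "g \<in> borel_measurable borel" by fact+
  have f[measurable]: "f \<in> borel_measurable borel"
    using M(3) borel_measurable_integrable[of M f] by (simp add: measurable_cong_sets[OF M(2) refl])
  define H where "H y x = \<psi> (x - y) * f y * g x" for y x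
  have tr: "(LINT x|lborel. \<bar>\<psi> (x - y)\<bar>) = (LINT x|lborel. \<bar>\<psi> x\<bar>)" "integrable lborel (\<lambda>x. \<psi> (x - y))" for y
  proof -
    show "(LINT x|lborel. \<bar>\<psi> (x - y)\<bar>) = (LINT x|lborel. \<bar>\<psi> x\<bar>)"
      using lborel_integral_translate[of "\<lambda>x. \<bar>\<psi> x\<bar>" "- y"] by simp
    have "integrable (distr lborel borel ((+) (- y))) \<psi>" using \<psi>(2) by (simp add: lborel_distr_plus)
    then show "integrable lborel (\<lambda>x. \<psi> (x - y))" by (subst (asm) integrable_distr_eq) auto
  qed
  have int_in: "integrable lborel (\<lambda>x. \<psi> (x - y) * g x)" for y
  proof (rule Bochner_Integration.integrable_bound)
    show "integrable lborel (\<lambda>x. C * \<psi> (x - y))" using tr by simp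
    have "\<bar>\<psi> (x - y)\<bar> * \<bar>g x\<bar> \<le> \<bar>\<psi> (x - y)\<bar> * \<bar>C\<bar>" for x using g(2)[of x] by (intro mult_left_mono) auto
    then show "AE x in lborel. norm (\<psi> (x - y) * g x) \<le> norm (C * \<psi> (x - y))" by (simp add: abs_mult mult.commute)
  qed measurable
  have int: "integrable (M \<Otimes>\<^sub>M lborel) (case_prod H)"
  proof (rule P'.Fubini_integrable)
    show "case_prod H \<in> borel_measurable (M \<Otimes>\<^sub>M lborel)" unfolding H_def by measurable
    show "AE y in M. integrable lborel (\<lambda>x. case_prod H (y, x))"
      using int_in by (auto simp: H_def mult.commute mult.left_commute intro!: AE_I2)
    show "integrable M (\<lambda>y. LINT x|lborel. norm (case_prod H (y, x)))"
    proof (rule Bochner_Integration.integrable_bound)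
      show "integrable M (\<lambda>y. (C * (LINT x|lborel. \<bar>\<psi> x\<bar>)) * f y)" using M(3) by simp
      show "(\<lambda>y. LINT x|lborel. norm (case_prod H (y, x))) \<in> borel_measurable M" unfolding H_def by measurable
      have "(LINT x|lborel. norm (H y x)) \<le> C * (LINT x|lborel. \<bar>\<psi> x\<bar>) * \<bar>f y\<bar>" for y
      proof -
        have "(LINT x|lborel. norm (H y x)) \<le> (LINT x|lborel. (C * \<bar>f y\<bar>) * \<bar>\<psi> (x - y)\<bar>)"
        proof (rule integral_mono)
          show "integrable lborel (\<lambda>x. norm (H y x))"
            using int_in[of y] unfolding H_def
            by (intro integrable_norm) (auto simp: mult.commute mult.left_commute)
          show "integrable lborel (\<lambda>x. (C * \<bar>f y\<bar>) * \<bar>\<psi> (x - y)\<bar>)" using tr(2) by simp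
          show "norm (H y x) \<le> (C * \<bar>f y\<bar>) * \<bar>\<psi> (x - y)\<bar>" for x
            using mult_left_mono[OF g(2)[of x], of "\<bar>\<psi> (x - y)\<bar> * \<bar>f y\<bar>"] by (simp add: H_def abs_mult mult_ac)
        qed
        also have "\<dots> = C * (LINT x|lborel. \<bar>\<psi> x\<bar>) * \<bar>f y\<bar>" using tr(1) by simp
        finally show ?thesis .
      qed
      moreover have "0 \<le> C" using g(2)[of 0] by linarith
      ultimately show "AE y in M. norm (LINT x|lborel. norm (case_prod H (y, x))) \<le> norm (C * (LINT x|lborel. \<bar>\<psi> x\<bar>) * f y)"
        by (simp add: abs_mult)
    qed
  qed
  have eq1: "conv M \<psi> f x * g x = (LINT y|M. H y x)" for x by (simp add: conv_def H_def)
  have eq2: "(LINT x|lborel. \<psi> (x - y) * g x) * f y = (LINT x|lborel. H y x)" for y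
    by (simp add: H_def mult.commute mult.left_commute flip: integral_mult_right_zero)
  show "integrable lborel (\<lambda>x. conv M \<psi> f x * g x)" unfolding eq1 using P'.integrable_snd[OF int] by simp
  show "integrable M (\<lambda>y. (LINT x|lborel. \<psi> (x - y) * g x) * f y)" unfolding eq2 using P'.integrable_fst[OF int] by simp
  show "(LINT x|lborel. conv M \<psi> f x * g x) = (LINT y|M. (LINT x|lborel. \<psi> (x - y) * g x) * f y)"
    unfolding eq1 eq2 by (rule P'.Fubini_integral[OF int])
qed

section \<open>Mollifiers\<close>

text \<open>The support of \<open>moll n\<close> is the ball of radius \<open>1 / real (Suc n)\<close>, and this form of the radius
  is kept by the simplifier.\<close>

declare of_nat_Suc [simp del]

definition moll :: "nat \<Rightarrow> 'a::euclidean_space \<Rightarrow> real" where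
  "moll n x = bump (real (Suc n) *\<^sub>R x) / (LINT y|lborel. bump (real (Suc n) *\<^sub>R (y :: 'a)))"

lemma test_bump: "test (bump :: 'a::euclidean_space \<Rightarrow> real)"
  by (rule test_functionsI[of _ "cball 0 1"]) (auto simp: smooth_bump bump_eq_0_iff)

lemma test_bump_scaled: "test (\<lambda>x :: 'a::euclidean_space. bump (real (Suc n) *\<^sub>R x))"
  using test_affine[OF test_bump, of "real (Suc n)" 0] by simp

lemma integral_bump_pos: "0 < (LINT y|lborel. bump (real (Suc n) *\<^sub>R (y :: 'a::euclidean_space)))"
proof (rule ccontr)
  assume "\<not> ?thesis"
  moreover have "0 \<le> (LINT y|lborel. bump (real (Suc n) *\<^sub>R (y :: 'a)))"
    by (intro integral_nonneg_AE AE_I2 bump_nonneg)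
  ultimately have "(LINT y|lborel. bump (real (Suc n) *\<^sub>R (y :: 'a))) = 0" by linarith
  then have AE: "AE y in lborel. bump (real (Suc n) *\<^sub>R (y :: 'a)) = 0"
    by (subst (asm) integral_nonneg_eq_0_iff_AE) (auto intro!: test_integrable test_bump_scaled bump_nonneg)
  have "AE y in lborel. y \<notin> ball (0::'a) (1 / real (Suc n))"
    using AE by eventually_elim (simp add: bump_eq_0_iff field_simps not_less del: of_nat_Suc)
  then have "emeasure lborel (ball (0::'a) (1 / real (Suc n))) = 0"
    by (subst (asm) AE_iff_measurable[OF _ refl]) (auto simp: ball_def)
  moreover have "0 < measure lborel (ball (0::'a) (1 / real (Suc n)))" by (rule content_ball_pos) simp
  ultimately show False by (simp add: measure_def)
qed

lemma test_moll: "test (moll n)"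
proof -
  obtain r where r: "\<forall>x. r < norm x \<longrightarrow> bump (real (Suc n) *\<^sub>R (x :: 'a)) = 0"
    using test_support[OF test_bump_scaled[of n]] ..
  show ?thesis
  proof (rule test_functionsI[of _ "cball 0 r"])
    have "smooth (\<lambda>x :: 'a. bump (real (Suc n) *\<^sub>R x) * (1 / (LINT y|lborel. bump (real (Suc n) *\<^sub>R (y :: 'a)))))"
      by (intro smooth_intros test_smooth[OF test_bump_scaled])
    then show "smooth (moll n :: 'a \<Rightarrow> real)" by (simp add: moll_def[abs_def])
    show "moll n x = 0" if "x \<notin> cball (0::'a) r" for x using r that by (simp add: moll_def)
  qed auto
qed

lemma moll_nonneg: "0 \<le> moll n x"
  unfolding moll_def using integral_bump_pos[of n, where 'a = 'a] by (intro divide_nonneg_pos bump_nonneg) simp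

lemma moll_integral: "(LINT x|lborel. moll n (x :: 'a::euclidean_space)) = 1"
  unfolding moll_def using integral_bump_pos[of n, where 'a = 'a] by simp

lemma moll_minus: "moll n (x - y) = moll n (y - x)"
  unfolding moll_def using bump_minus[of "real (Suc n) *\<^sub>R (x - y)"] by (simp add: algebra_simps del: of_nat_Suc)

lemma moll_support: "1 / real (Suc n) \<le> norm x \<Longrightarrow> moll n x = 0"
  unfolding moll_def by (simp add: bump_eq_0_iff field_simps del: of_nat_Suc)

lemma moll_borel[measurable]: "moll n \<in> borel_measurable borel"
  by (rule smooth_borel[OF test_smooth[OF test_moll]])

lemma moll_integrable: "integrable lborel (moll n)" by (rule test_integrable[OF test_moll])

lemma moll_integral_shift:
  fixes x y :: "'a::euclidean_space"
  shows "(LINT x|lborel. moll n (x - y)) = 1" "integrable lborel (\<lambda>x. moll n (x - y))"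
  "(LINT y|lborel. moll n (x - y)) = 1"
proof -
  have 1: "(LINT y|lborel. moll n (x - y)) = 1" for x :: 'a
    using lborel_integral_reflect[OF moll_borel[of n], of x] by (simp add: moll_integral)
  from 1[of x] show "(LINT y|lborel. moll n (x - y)) = 1" .
  from 1[of y] show "(LINT x|lborel. moll n (x - y)) = 1" by (subst moll_minus)
  show "integrable lborel (\<lambda>x. moll n (x - y))"
    using moll_integrable[of n] lborel_integrable_reflect[OF moll_borel[of n], of y] by (subst moll_minus) simp
qed

abbreviation mollify :: "nat \<Rightarrow> ('a::euclidean_space \<Rightarrow> real) \<Rightarrow> 'a \<Rightarrow> real" where
  "mollify n \<equiv> conv lborel (moll n)"

abbreviation L1_dist :: "('a::euclidean_space \<Rightarrow> real) \<Rightarrow> ('a \<Rightarrow> real) \<Rightarrow> real" where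
  "L1_dist f g \<equiv> LINT x|lborel. \<bar>f x - g x\<bar>"

lemmas conv_moll_integrable = conv_integrable[OF _ _ test_moll]

text \<open>A mollified value is an average over a small ball, hence it inherits every bound that
  holds there.\<close>

lemma conv_moll_bounds:
  fixes f :: "'a::euclidean_space \<Rightarrow> real"
  assumes "integrable lborel f" "\<And>y. dist x y < 1 / real (Suc n) \<Longrightarrow> a \<le> f y" "\<And>y. dist x y < 1 / real (Suc n) \<Longrightarrow> f y \<le> b"
  shows "a \<le> mollify n f x" "mollify n f x \<le> b"
proof -
  have i: "integrable lborel (\<lambda>y. moll n (x - y) * f y)" by (rule conv_moll_integrable) (use assms in auto)
  have j: "integrable lborel (\<lambda>y. moll n (x - y) * c)" for c
    using moll_integral_shift(2)[of n x] by (subst moll_minus) simp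
  have c: "(LINT y|lborel. moll n (x - y) * c) = c" for c using moll_integral_shift(3)[of n x] by simp
  have le: "moll n (x - y) * a \<le> moll n (x - y) * f y \<and> moll n (x - y) * f y \<le> moll n (x - y) * b" for y
  proof (cases "dist x y < 1 / real (Suc n)")
    case True
    then show ?thesis using assms(2,3)[of y] moll_nonneg[of n "x - y"] by (auto intro: mult_left_mono)
  next
    case False
    then show ?thesis using moll_support[of n "x - y"] by (simp add: dist_norm)
  qed
  have "(LINT y|lborel. moll n (x - y) * a) \<le> mollify n f x"
    unfolding conv_def by (rule integral_mono[OF j i]) (use le in blast)
  moreover have "mollify n f x \<le> (LINT y|lborel. moll n (x - y) * b)"
    unfolding conv_def by (rule integral_mono[OF i j]) (use le in blast)
  ultimately show "a \<le> mollify n f x" "mollify n f x \<le> b" by (simp_all only: c)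
qed

lemma conv_moll_nonneg: "(\<And>x. 0 \<le> f x) \<Longrightarrow> 0 \<le> conv M (moll n) f x"
  unfolding conv_def by (intro integral_nonneg_AE AE_I2 mult_nonneg_nonneg moll_nonneg) auto

lemma conv_moll_zero:
  "(\<And>y. dist x y < 1 / real (Suc n) \<Longrightarrow> f y = 0) \<Longrightarrow> conv M (moll n) f x = 0"
  unfolding conv_def
proof -
  assume f: "\<And>y. dist x y < 1 / real (Suc n) \<Longrightarrow> f y = 0"
  have "moll n (x - y) * f y = 0" for y
    using f[of y] moll_support[of n "x - y"] by (cases "dist x y < 1 / real (Suc n)") (auto simp: dist_norm)
  then have "(\<lambda>y. moll n (x - y) * f y) = (\<lambda>_. 0)" by blast
  then show "(LINT y|M. moll n (x - y) * f y) = 0" by simp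
qed

lemma conv_borel:
  fixes f \<psi> :: "'a::euclidean_space \<Rightarrow> real"
  shows "sets M = sets borel \<Longrightarrow> integrable M f \<Longrightarrow> test \<psi> \<Longrightarrow> conv M \<psi> f \<in> borel_measurable borel"
  by (rule borel_measurable_continuous_onI[OF conv_continuous])

lemma conv_moll_borel[measurable (raw)]:
  "integrable lborel f \<Longrightarrow> mollify n f \<in> borel_measurable borel"
  by (rule conv_borel) (auto intro: test_moll)

lemma integral_conv_moll:
  fixes f :: "'a::euclidean_space \<Rightarrow> real"
  assumes "integrable lborel f"
  shows "integrable lborel (mollify n f)"
    "(LINT x|lborel. mollify n f x) = (LINT x|lborel. f x)"
  using conv_Fubini[OF sigma_finite_lborel _ assms moll_borel moll_integrable, of "\<lambda>_. 1" 1 n]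
  by (simp_all add: moll_integral_shift(1))

lemma conv_diff:
  assumes "sets M = sets borel" "integrable M f" "integrable M g" "test \<psi>"
  shows "conv M \<psi> (\<lambda>x. f x - g x) x = conv M \<psi> f x - conv M \<psi> g x"
  unfolding conv_def using conv_integrable[OF assms(1,2,4)] conv_integrable[OF assms(1,3,4)]
  by (simp add: right_diff_distrib)

lemma conv_add:
  assumes "sets M = sets borel" "integrable M f" "integrable M g" "test \<psi>"
  shows "conv M \<psi> (\<lambda>x. f x + g x) x = conv M \<psi> f x + conv M \<psi> g x"
  unfolding conv_def using conv_integrable[OF assms(1,2,4)] conv_integrable[OF assms(1,3,4)]
  by (simp add: distrib_left)

lemma conv_moll_L1:
  fixes f :: "'a::euclidean_space \<Rightarrow> real"
  assumes f: "integrable lborel f"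
  shows "(LINT x|lborel. \<bar>mollify n f x\<bar>) \<le> (LINT x|lborel. \<bar>f x\<bar>)"
proof -
  have fa: "integrable lborel (\<lambda>x. \<bar>f x\<bar>)" using f by simp
  have "\<bar>mollify n f x\<bar> \<le> mollify n (\<lambda>x. \<bar>f x\<bar>) x" for x
    unfolding conv_def
    using integral_abs_bound[of lborel "\<lambda>y. moll n (x - y) * f y"] by (simp add: abs_mult moll_nonneg)
  then have "(LINT x|lborel. \<bar>mollify n f x\<bar>) \<le> (LINT x|lborel. mollify n (\<lambda>x. \<bar>f x\<bar>) x)"
    using integral_conv_moll(1)[OF f] integral_conv_moll(1)[OF fa] by (intro integral_mono) auto
  then show ?thesis by (simp add: integral_conv_moll(2)[OF fa])
qed

text \<open>Jensen: \<open>(\<rho> * f)\<^sup>2 \<le> \<rho> * f\<^sup>2\<close> because the variance of \<open>f\<close> under the probability density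
  \<open>\<rho> (x - y) dy\<close> is nonnegative.\<close>

lemma conv_moll_L2:
  fixes f :: "'a::euclidean_space \<Rightarrow> real"
  assumes f: "integrable lborel f" and f2: "integrable lborel (\<lambda>x. (f x)\<^sup>2)"
  shows "integrable lborel (\<lambda>x. (mollify n f x)\<^sup>2)"
    "(LINT x|lborel. (mollify n f x)\<^sup>2) \<le> (LINT x|lborel. (f x)\<^sup>2)"
proof -
  have le: "(mollify n f x)\<^sup>2 \<le> mollify n (\<lambda>x. (f x)\<^sup>2) x" for x
  proof -
    define m where "m = mollify n f x"
    have i1: "integrable lborel (\<lambda>y. moll n (x - y) * f y)"
      and i2: "integrable lborel (\<lambda>y. moll n (x - y) * (f y)\<^sup>2)"
      by (rule conv_moll_integrable; use f f2 in auto)+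
    have i0: "integrable lborel (\<lambda>y. moll n (x - y))" using moll_integral_shift(2)[of n x] by (subst moll_minus)
    have "0 \<le> (LINT y|lborel. moll n (x - y) * (f y - m)\<^sup>2)"
      by (intro integral_nonneg_AE AE_I2 mult_nonneg_nonneg moll_nonneg) auto
    also have "\<dots> = (LINT y|lborel. moll n (x - y) * (f y)\<^sup>2 - 2 * m * (moll n (x - y) * f y) + m\<^sup>2 * moll n (x - y))"
      by (simp add: power2_diff algebra_simps)
    also have "\<dots> = mollify n (\<lambda>x. (f x)\<^sup>2) x - 2 * m * m + m\<^sup>2"
      using i0 i1 i2 by (simp add: moll_integral_shift(3) conv_def m_def)
    finally show ?thesis by (simp add: m_def power2_eq_square)
  qed
  note c2 = integral_conv_moll[OF f2, of n]
  show i: "integrable lborel (\<lambda>x. (mollify n f x)\<^sup>2)"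
    by (rule Bochner_Integration.integrable_bound[OF c2(1)]) (use f le in \<open>auto intro: order_trans[OF le abs_ge_self]\<close>)
  show "(LINT x|lborel. (mollify n f x)\<^sup>2) \<le> (LINT x|lborel. (f x)\<^sup>2)"
    using integral_mono[OF i c2(1) le] c2(2) by simp
qed

text \<open>Integration by parts moves the derivative from the kernel to \<open>f\<close>, so gradients of
  mollifications inherit the bounds of \<open>\<nabla>f\<close>.\<close>

lemma conv_partial:
  fixes f :: "'a::euclidean_space \<Rightarrow> real"
  assumes \<psi>: "smooth \<psi>" and b: "b \<in> Basis" and f: "has_ddir b f f'" "continuous_on UNIV f" "continuous_on UNIV f'"
    and s: "\<And>x. r < norm x \<Longrightarrow> f x = 0"
  shows "conv lborel (partial b \<psi>) f = conv lborel \<psi> f'"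
proof
  fix x
  have sm: "smooth (\<lambda>y. \<psi> (x - y))" using hull_affine[of \<psi> x "-1"] \<psi> by (simp add: smooth_hull_iff)
  have "(LINT y|lborel. \<psi> (x - y) * f' y) = - (LINT y|lborel. partial b (\<lambda>y. \<psi> (x - y)) y * f y)"
    using integral_by_parts[OF has_ddir_smooth[OF sm] f(1) smooth_continuous[OF sm]
        smooth_continuous[OF smooth_partial[OF sm b]] f(2,3) s] by simp
  then show "conv lborel (partial b \<psi>) f x = conv lborel \<psi> f' x"
    by (simp add: conv_def partial_reflect[OF \<psi>])
qed

subsection \<open>Convergence in \<open>L\<^sup>1\<close>\<close>

text \<open>The functions that are \<open>L\<^sup>1\<close>-limits of their mollifications form a closed subspace, because
  mollification contracts the \<open>L\<^sup>1\<close>-norm. It contains the continuous functions of compact support,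
  then the indicators of compact sets, of sets of finite measure, and so all integrable functions.\<close>

definition mollifies :: "('a::euclidean_space \<Rightarrow> real) \<Rightarrow> bool" where
  "mollifies f \<longleftrightarrow> integrable lborel f \<and> (\<lambda>n. L1_dist (mollify n f) f) \<longlonglongrightarrow> 0"

lemma integrable_indicator_cball: "integrable lborel (indicator (cball a r) :: 'a::euclidean_space \<Rightarrow> real)"
  by (intro integrable_real_indicator emeasure_bounded_finite) auto

lemma mollifies_continuous:
  fixes f :: "'a::euclidean_space \<Rightarrow> real"
  assumes c: "continuous_on UNIV f" and s: "\<And>x. r < norm x \<Longrightarrow> f x = 0"
  shows "mollifies f"
proof -
  have f: "integrable lborel f" by (rule integrable_continuous_support[OF assms])
  obtain C where C: "0 \<le> C" "\<forall>x. \<bar>f x\<bar> \<le> C" using continuous_bounded_support[OF assms] by blast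
  have lim: "(\<lambda>n. mollify n f x) \<longlonglongrightarrow> f x" for x
  proof (rule LIMSEQ_I)
    fix e :: real assume e: "0 < e"
    obtain d where d: "d > 0" "\<And>y. dist y x < d \<Longrightarrow> dist (f y) (f x) < e / 2"
      using c e unfolding continuous_on_iff by (metis UNIV_I half_gt_zero)
    obtain N where N: "1 / real (Suc N) < d" using d(1) nat_approx_posE by blast
    have "norm (mollify n f x - f x) < e" if "N \<le> n" for n
    proof -
      have "1 / real (Suc n) \<le> 1 / real (Suc N)" using that by (simp add: frac_le)
      then have *: "\<bar>f y - f x\<bar> < e / 2" if "dist x y < 1 / real (Suc n)" for y
        using d(2)[of y] that N by (simp add: dist_commute dist_real_def abs_minus_commute)
      have "f x - e / 2 \<le> f y \<and> f y \<le> f x + e / 2" if "dist x y < 1 / real (Suc n)" for y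
        using *[OF that] by linarith
      then have "f x - e / 2 \<le> mollify n f x" "mollify n f x \<le> f x + e / 2"
        using conv_moll_bounds[OF f, of x n "f x - e / 2" "f x + e / 2"] by simp_all
      then show ?thesis using e by (simp add: real_norm_def abs_if)
    qed
    then show "\<exists>no. \<forall>n\<ge>no. norm (mollify n f x - f x) < e" by blast
  qed
  have "(\<lambda>n. L1_dist (mollify n f) f) \<longlonglongrightarrow> (LINT x|(lborel::'a measure). 0)"
  proof (rule integral_dominated_convergence)
    show "integrable lborel (\<lambda>x. 2 * C * indicator (cball 0 (r + 1)) x :: real)"
      by (simp add: integrable_indicator_cball)
    show "AE x in lborel. (\<lambda>n. \<bar>mollify n f x - f x\<bar>) \<longlonglongrightarrow> 0"
      using tendsto_rabs_zero[OF LIM_zero[OF lim]] by simp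
    fix n
    show "(\<lambda>x. \<bar>mollify n f x - f x\<bar>) \<in> borel_measurable lborel"
      using f borel_measurable_integrable[OF f] by measurable
    show "AE x in lborel. norm \<bar>mollify n f x - f x\<bar> \<le> 2 * C * indicator (cball 0 (r + 1)) x"
    proof (rule AE_I2)
      fix x :: 'a
      show "norm \<bar>mollify n f x - f x\<bar> \<le> 2 * C * indicator (cball 0 (r + 1)) x"
      proof (cases "norm x \<le> r + 1")
        case True
        have "- C \<le> f y" "f y \<le> C" for y using C(2)[rule_format, of y] by linarith+
        then have "- C \<le> mollify n f x" "mollify n f x \<le> C"
          using conv_moll_bounds[OF f, of x n "- C" C] by simp_all
        then show ?thesis using True C(2)[rule_format, of x] by simp
      next
        case False
        have "mollify n f x = 0"
        proof (rule conv_moll_zero)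
          fix y assume "dist x y < 1 / real (Suc n)"
          moreover have "1 / real (Suc n) \<le> 1" by simp
          moreover have "norm x \<le> norm y + dist x y" using norm_triangle_ineq2[of x y] by (simp add: dist_norm)
          ultimately show "f y = 0" using False by (intro s) linarith
        qed
        then show ?thesis using False s[of x] by simp
      qed
    qed
  qed simp
  then show ?thesis using f by (simp add: mollifies_def)
qed

lemma mollifies_approx:
  fixes f :: "'a::euclidean_space \<Rightarrow> real"
  assumes f: "integrable lborel f"
    and g: "\<And>e. 0 < e \<Longrightarrow> \<exists>g. mollifies g \<and> (L1_dist f g) < e"
  shows "mollifies f"
  unfolding mollifies_def
proof (intro conjI LIMSEQ_I f)
  fix e :: real assume e: "0 < e"
  obtain g where "mollifies g" and fg: "(L1_dist f g) < e / 4" using g[of "e / 4"] e by auto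
  then have g: "integrable lborel g" and lim: "(\<lambda>n. L1_dist (mollify n g) g) \<longlonglongrightarrow> 0"
    by (simp_all add: mollifies_def)
  obtain N where N: "\<And>n. N \<le> n \<Longrightarrow> \<bar>LINT x|lborel. \<bar>mollify n g x - g x\<bar>\<bar> < e / 4"
    using LIMSEQ_D[OF lim, of "e / 4"] e by (auto simp del: abs_of_nonneg)
  have "norm ((L1_dist (mollify n f) f) - 0) < e" if "N \<le> n" for n
  proof -
    have i: "integrable lborel (mollify n f)" "integrable lborel (mollify n g)"
      "integrable lborel (\<lambda>x. f x - g x)" "integrable lborel (mollify n (\<lambda>x. f x - g x))"
      using f g by (auto intro!: integral_conv_moll)
    have "(L1_dist (mollify n f) f) \<le> (LINT x|lborel.
        \<bar>mollify n (\<lambda>x. f x - g x) x\<bar> + \<bar>mollify n g x - g x\<bar> + \<bar>f x - g x\<bar>)"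
      using i f g by (intro integral_mono) (auto simp: conv_diff test_moll)
    also have "\<dots> = (LINT x|lborel. \<bar>mollify n (\<lambda>x. f x - g x) x\<bar>)
        + (L1_dist (mollify n g) g) + (L1_dist f g)"
      using i f g by simp
    also have "\<dots> < e" using conv_moll_L1[OF i(3), of n] fg N[OF that] e by linarith
    finally show ?thesis by (simp add: integral_nonneg_AE)
  qed
  then show "\<exists>no. \<forall>n\<ge>no. norm ((L1_dist (mollify n f) f) - 0) < e" by blast
qed

lemma mollifies_dominated:
  fixes f :: "'a::euclidean_space \<Rightarrow> real"
  assumes s: "\<And>i. mollifies (s i)" and lim: "\<And>x. (\<lambda>i. s i x) \<longlonglongrightarrow> f x"
    and w: "integrable lborel w" "\<And>i x. \<bar>s i x\<bar> \<le> w x"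
  shows "mollifies f"
proof (rule mollifies_approx)
  have m[measurable]: "s i \<in> borel_measurable lborel" for i
    using s[of i] by (auto simp: mollifies_def)
  have fm[measurable]: "f \<in> borel_measurable lborel"
    by (rule borel_measurable_LIMSEQ_real[of lborel s]) (use lim in auto)
  have fw: "\<bar>f x\<bar> \<le> w x" for x
    using tendsto_rabs[OF lim[of x]] w(2) by (intro LIMSEQ_le_const2) auto
  show f: "integrable lborel f"
    by (rule Bochner_Integration.integrable_bound[OF w(1)]) (use fw in \<open>auto intro: order_trans[OF fw abs_ge_self]\<close>)
  have "(\<lambda>i. L1_dist f (s i)) \<longlonglongrightarrow> (LINT x|(lborel::'a measure). 0)"
  proof (rule integral_dominated_convergence)
    show "integrable lborel (\<lambda>x. 2 * w x)" using w(1) by simp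
    have "(\<lambda>i. \<bar>f x - s i x\<bar>) \<longlonglongrightarrow> \<bar>f x - f x\<bar>" for x by (intro tendsto_intros lim)
    then show "AE x in lborel. (\<lambda>i. \<bar>f x - s i x\<bar>) \<longlonglongrightarrow> 0" by simp
    show "AE x in lborel. norm \<bar>f x - s i x\<bar> \<le> 2 * w x" for i
    proof (rule AE_I2)
      show "norm \<bar>f x - s i x\<bar> \<le> 2 * w x" for x
        using fw[of x] w(2)[of i x] by (simp add: abs_le_iff)
    qed
  qed measurable
  then have L: "(\<lambda>i. L1_dist f (s i)) \<longlonglongrightarrow> 0" by simp
  fix e :: real assume "0 < e"
  then obtain i where "(L1_dist f (s i)) < e"
    using order_tendstoD(2)[OF L, of e] by (auto simp: eventually_sequentially)
  then show "\<exists>g. mollifies g \<and> (L1_dist f g) < e" using s[of i] by (intro exI[of _ "s i"]) simp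
qed

lemma mollifies_indicator_compact:
  assumes "compact K" shows "mollifies (indicator K :: 'a::euclidean_space \<Rightarrow> real)"
proof (cases "K = {}")
  case True
  have "mollifies (\<lambda>_ :: 'a. 0 :: real)" by (rule mollifies_continuous[of _ 0]) auto
  moreover have "(indicator K :: 'a \<Rightarrow> real) = (\<lambda>_. 0)" using True by auto
  ultimately show ?thesis by simp
next
  case False
  have cl: "closed K" using assms by (rule compact_imp_closed)
  obtain r where r: "\<And>x. x \<in> K \<Longrightarrow> norm x \<le> r" using compact_imp_bounded[OF assms] by (auto simp: bounded_iff)
  define s where "s i x = max 0 (1 - real i * infdist x K)" for i :: nat and x
  have z: "s (Suc i) x = 0" if "r + 1 < norm x" for i x
  proof -
    have "1 \<le> infdist x K"
      unfolding infdist_def using False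
    proof (simp, intro cINF_greatest)
      fix y assume "y \<in> K"
      then show "1 \<le> dist x y" using r[of y] that norm_triangle_ineq2[of x y] by (simp add: dist_norm)
    qed
    then have "1 \<le> real (Suc i) * infdist x K" using mult_mono[of 1 "real (Suc i)" 1 "infdist x K"] by simp
    then show ?thesis by (simp add: s_def)
  qed
  have lim: "(\<lambda>i. s (Suc i) x) \<longlonglongrightarrow> indicator K x" for x
  proof (cases "x \<in> K")
    case True
    then have "s (Suc i) x = 1" for i by (simp add: s_def)
    then show ?thesis using True by simp
  next
    case F: False
    then have pos: "0 < infdist x K" using False cl in_closed_iff_infdist_zero infdist_nonneg[of x K] by fastforce
    obtain N :: nat where N: "1 / infdist x K \<le> real N" using real_arch_simple by blast
    have "s (Suc i) x = indicator K x" if "N \<le> i" for i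
    proof -
      have "1 / infdist x K \<le> real (Suc i)" using N that by linarith
      then have "1 \<le> real (Suc i) * infdist x K" using pos by (simp add: field_simps)
      then show ?thesis using F by (simp add: s_def)
    qed
    then show ?thesis by (intro tendsto_eventually) (auto simp: eventually_sequentially)
  qed
  show ?thesis
  proof (rule mollifies_dominated[of "\<lambda>i. s (Suc i)"])
    show "mollifies (s (Suc i))" for i
      by (rule mollifies_continuous[of _ "r + 1"]) (use z in \<open>auto simp: s_def intro!: continuous_intros\<close>)
    show "integrable lborel (indicator (cball 0 (r + 1)) :: 'a \<Rightarrow> real)"
      by (simp add: integrable_indicator_cball)
    show "\<bar>s (Suc i) x\<bar> \<le> indicator (cball 0 (r + 1)) x" for i x
    proof (cases "norm x \<le> r + 1")
      case True
      have "0 \<le> real (Suc i) * infdist x K" by (intro mult_nonneg_nonneg infdist_nonneg) simp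
      then show ?thesis using True by (simp add: s_def del: of_nat_Suc)
    qed (use z in auto)
  qed (rule lim)
qed

lemma conv_moll_converges_L1:
  fixes f :: "'a::euclidean_space \<Rightarrow> real"
  assumes "integrable lborel f"
  shows "(\<lambda>n. L1_dist (mollify n f) f) \<longlonglongrightarrow> 0"
proof -
  have "mollifies f" using assms
  proof (induction rule: integrable_induct)
    case (base A c)
    have ind: "mollifies (indicator A :: 'a \<Rightarrow> real)"
    proof (rule mollifies_approx)
      show iA: "integrable lborel (indicator A :: 'a \<Rightarrow> real)" using base by (simp add: integrable_real_indicator)
      fix e :: real assume e: "0 < e"
      have A: "A \<in> sets lebesgue" using base by simp
      obtain K where K: "closed K" "K \<subseteq> A" "emeasure lebesgue (A - K) < ennreal e"
        by (rule sets_lebesgue_inner_closed[OF A e]) (rule that)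
      have Kb[measurable]: "K \<in> sets borel" using K(1) by simp
      have [measurable]: "A \<in> sets borel" using base(1) by simp
      have less: "emeasure lborel (A - K) < ennreal e" using K(3) by simp
      then have "emeasure lborel (A - K) = ennreal (measure lborel (A - K))"
        by (intro emeasure_eq_ennreal_measure) auto
      then have "measure lborel (A - K) < e" using less by (simp add: ennreal_less_iff)
      moreover have "(LINT x|lborel. \<bar>indicator A x - indicator K x :: real\<bar>) = (LINT x|lborel. indicator (A - K) x)"
        using K(2) by (intro Bochner_Integration.integral_cong) (auto simp: indicator_def)
      moreover have "\<dots> = measure lborel (A - K)" by simp
      ultimately have "(LINT x|lborel. \<bar>indicator A x - indicator K x :: real\<bar>) < e" by simp
      moreover have "mollifies (indicator K :: 'a \<Rightarrow> real)"
      proof (rule mollifies_dominated[of "\<lambda>i. indicator (K \<inter> cball 0 (real i))"])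
        show "mollifies (indicator (K \<inter> cball 0 (real i)) :: 'a \<Rightarrow> real)" for i
          using K(1) by (intro mollifies_indicator_compact closed_Int_compact) auto
        show "(\<lambda>i. indicator (K \<inter> cball 0 (real i)) x :: real) \<longlonglongrightarrow> indicator K x" for x
        proof -
          obtain N :: nat where "norm x \<le> real N" using real_arch_simple by blast
          then have "indicator (K \<inter> cball 0 (real i)) x = (indicator K x :: real)" if "N \<le> i" for i
            using that by (auto simp: indicator_def)
          then show ?thesis by (intro tendsto_eventually) (auto simp: eventually_sequentially)
        qed
        show "\<bar>indicator (K \<inter> cball 0 (real i)) x\<bar> \<le> (indicator A x :: real)" for i x
          using K(2) by (auto simp: indicator_def)
      qed (rule iA)
      ultimately show "\<exists>g. mollifies g \<and> (L1_dist (indicator A) g) < e" by blast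
    qed
    have "(\<lambda>n. \<bar>c\<bar> * (L1_dist (mollify n (indicator A)) (indicator A))) \<longlonglongrightarrow> \<bar>c\<bar> * 0"
      using ind by (intro tendsto_intros) (auto simp: mollifies_def)
    moreover have "mollify n (\<lambda>x. indicator A x *\<^sub>R c) x - indicator A x *\<^sub>R c
        = c * (mollify n (indicator A) x - indicator A x)" for n x
      unfolding conv_def by (simp add: algebra_simps flip: integral_mult_right_zero)
    ultimately show ?case using ind by (simp add: mollifies_def abs_mult)
  next
    case (add f g)
    show ?case unfolding mollifies_def
    proof (intro conjI)
      have f: "integrable lborel f" "integrable lborel g" using add by auto
      then show "integrable lborel (\<lambda>x. f x + g x)" by simp
      note i = integral_conv_moll(1)[OF f(1)] integral_conv_moll(1)[OF f(2)]
      show "(\<lambda>n. LINT x|lborel. \<bar>mollify n (\<lambda>x. f x + g x) x - (f x + g x)\<bar>) \<longlonglongrightarrow> 0"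
      proof (rule tendsto_sandwich[OF _ _ tendsto_const])
        show "(\<lambda>n. (L1_dist (mollify n f) f) + (L1_dist (mollify n g) g)) \<longlonglongrightarrow> 0"
          using tendsto_add[of _ 0 _ _ 0] add by (simp add: mollifies_def)
        have "(LINT x|lborel. \<bar>mollify n (\<lambda>x. f x + g x) x - (f x + g x)\<bar>)
          \<le> (LINT x|lborel. \<bar>mollify n f x - f x\<bar> + \<bar>mollify n g x - g x\<bar>)" for n
          using i f integral_conv_moll(1)[of "\<lambda>x. f x + g x"] by (intro integral_mono) (auto simp: conv_add test_moll)
        then show "\<forall>\<^sub>F n in sequentially. (LINT x|lborel. \<bar>mollify n (\<lambda>x. f x + g x) x - (f x + g x)\<bar>)
          \<le> (L1_dist (mollify n f) f) + (L1_dist (mollify n g) g)"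
          using i f by simp
      qed (simp add: integral_nonneg_AE)
    qed
  next
    case (lim f s)
    then show ?case by (intro mollifies_dominated[of s f "\<lambda>x. 2 * \<bar>f x\<bar>"]) auto
  qed
  then show ?thesis by (simp add: mollifies_def)
qed

section \<open>The space \<open>L\<^sup>2\<close>\<close>

abbreviation l2sq :: "('a::euclidean_space \<Rightarrow> 'b::euclidean_space) \<Rightarrow> real" where
  "l2sq f \<equiv> LINT x|lebesgue. (norm (f x))\<^sup>2"

lemma L2_D: assumes "f \<in> L2"
  shows "f \<in> borel_measurable lebesgue" "integrable lebesgue (\<lambda>x. (norm (f x))\<^sup>2)"
  using assms by (auto simp: L2_def)

lemma L2_dominated:
  fixes f :: "'a::euclidean_space \<Rightarrow> 'b::euclidean_space"
  assumes "f \<in> borel_measurable lebesgue" "integrable lebesgue w" "\<And>x. (norm (f x))\<^sup>2 \<le> w x"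
  shows "f \<in> L2"
proof -
  have "integrable lebesgue (\<lambda>x. (norm (f x))\<^sup>2)"
    by (rule Bochner_Integration.integrable_bound[OF assms(2)])
      (use assms(1) in \<open>auto intro: order_trans[OF assms(3) abs_ge_self]\<close>)
  with assms(1) show ?thesis by (simp add: L2_def)
qed

lemma parallelogram: "(norm (x + y))\<^sup>2 + (norm (x - y))\<^sup>2 = 2 * (norm x)\<^sup>2 + 2 * (norm (y :: 'b::real_inner))\<^sup>2"
  unfolding power2_norm_eq_inner by (simp add: algebra_simps inner_commute)

lemma norm_sq_sum_le: "(norm (x + y))\<^sup>2 \<le> 2 * (norm x)\<^sup>2 + 2 * (norm (y :: 'b::real_inner))\<^sup>2"
  using parallelogram[of x y] zero_le_power2[of "norm (x - y)"] by linarith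

lemma L2_add: assumes "f \<in> L2" "g \<in> L2" shows "(\<lambda>x. f x + g x) \<in> L2"
  by (rule L2_dominated[of _ "\<lambda>x. 2 * (norm (f x))\<^sup>2 + 2 * (norm (g x))\<^sup>2"])
    (use L2_D[OF assms(1)] L2_D[OF assms(2)] norm_sq_sum_le in auto)

lemma L2_scaleR: assumes "f \<in> L2" shows "(\<lambda>x. c *\<^sub>R f x) \<in> L2"
  by (rule L2_dominated[of _ "\<lambda>x. c\<^sup>2 * (norm (f x))\<^sup>2"])
    (use L2_D[OF assms] in \<open>auto simp: power_mult_distrib\<close>)

lemma L2_diff: assumes "f \<in> L2" "g \<in> L2" shows "(\<lambda>x. f x - g x) \<in> L2"
  using L2_add[OF assms(1) L2_scaleR[OF assms(2), of "-1"]] by simp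

lemma L2_inner: assumes "G \<in> L2" shows "(\<lambda>x. G x \<bullet> b) \<in> L2"
proof (rule L2_dominated[of _ "\<lambda>x. (norm b)\<^sup>2 * (norm (G x))\<^sup>2"])
  show "(norm (G x \<bullet> b))\<^sup>2 \<le> (norm b)\<^sup>2 * (norm (G x))\<^sup>2" for x
    using power_mono[OF Cauchy_Schwarz_ineq2[of "G x" b], of 2] by (simp add: power_mult_distrib mult.commute)
qed (use L2_D[OF assms] in auto)

lemma L2_times_integrable:
  fixes f g :: "'a::euclidean_space \<Rightarrow> real"
  assumes "f \<in> L2" "g \<in> L2" shows "integrable lebesgue (\<lambda>x. f x * g x)"
proof (rule Bochner_Integration.integrable_bound)
  show "integrable lebesgue (\<lambda>x. (norm (f x))\<^sup>2 + (norm (g x))\<^sup>2)" using L2_D[OF assms(1)] L2_D[OF assms(2)] by simp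
  have "\<bar>a * b\<bar> \<le> a\<^sup>2 + b\<^sup>2" for a b :: real
  proof -
    have "2 * \<bar>a\<bar> * \<bar>b\<bar> \<le> a\<^sup>2 + b\<^sup>2" using sum_squares_bound[of "\<bar>a\<bar>" "\<bar>b\<bar>"] by simp
    moreover have "0 \<le> \<bar>a\<bar> * \<bar>b\<bar>" by simp
    ultimately show ?thesis unfolding abs_mult by linarith
  qed
  then show "AE x in lebesgue. norm (f x * g x) \<le> norm ((norm (f x))\<^sup>2 + (norm (g x))\<^sup>2)" by simp
qed (use L2_D[OF assms(1)] L2_D[OF assms(2)] in auto)

lemma L2_bounded_support:
  fixes f :: "'a::euclidean_space \<Rightarrow> real"
  assumes "f \<in> borel_measurable borel" "\<And>x. \<bar>f x\<bar> \<le> C" "\<And>x. r < norm x \<Longrightarrow> f x = 0"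
  shows "f \<in> L2"
proof -
  have m: "f \<in> borel_measurable lebesgue" using assms(1) by (simp add: measurable_completion)
  have "integrable lborel (\<lambda>x. (f x)\<^sup>2)"
  proof (rule integrable_bounded_support)
    show "\<bar>(f x)\<^sup>2\<bar> \<le> C\<^sup>2" for x using power_mono[OF assms(2)[of x], of 2] by simp
  qed (use assms in auto)
  then have "integrable lebesgue (\<lambda>x. (norm (f x))\<^sup>2)" using assms(1) by (simp add: integrable_completion)
  with m show ?thesis by (simp add: L2_def)
qed

lemma L2_test: assumes "test \<psi>" shows "\<psi> \<in> L2"
proof -
  obtain r where r: "\<forall>x. r < norm x \<longrightarrow> \<psi> x = 0" using test_support[OF assms] ..
  obtain C where C: "\<forall>x. \<bar>\<psi> x\<bar> \<le> C" using test_bounded[OF assms] by blast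
  show ?thesis by (rule L2_bounded_support[of _ C r]) (use r C smooth_borel[OF test_smooth[OF assms]] in auto)
qed

lemma L2_imp_L1_loc:
  fixes f :: "'a::euclidean_space \<Rightarrow> real"
  assumes "f \<in> L2" shows "f \<in> L1_loc UNIV"
  unfolding L1_loc_def set_integrable_def
proof (intro CollectI allI impI)
  fix K :: "'a set" assume K: "compact K \<and> K \<subseteq> UNIV"
  then have "bounded K" using compact_imp_bounded by blast
  then obtain r where r: "\<And>x. x \<in> K \<Longrightarrow> norm x \<le> r" by (auto simp: bounded_iff)
  have "(indicator K :: 'a \<Rightarrow> real) \<in> L2"
  proof (rule L2_bounded_support[of _ 1 r])
    show "(indicator K :: 'a \<Rightarrow> real) \<in> borel_measurable borel" using K by (simp add: compact_imp_closed)
    show "indicator K x = (0 :: real)" if "r < norm x" for x using r[of x] that by (force simp: indicator_def)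
  qed (simp add: indicator_def)
  from L2_times_integrable[OF this assms] show "integrable lebesgue (\<lambda>x. indicator K x *\<^sub>R f x)" by simp
qed

text \<open>By \<open>2 \<bar>a b\<bar> \<le> a\<^sup>2 / t + t b\<^sup>2\<close>: choose \<open>t\<close> so small that the second term is below the tolerance,
  and then \<open>n\<close> so large that the first one is.\<close>

lemma L2_weak_limit:
  fixes f :: "nat \<Rightarrow> 'a::euclidean_space \<Rightarrow> real"
  assumes f: "\<And>n. f n \<in> L2" and lim: "(\<lambda>n. l2sq (f n)) \<longlonglongrightarrow> 0" and g: "g \<in> L2"
  shows "(\<lambda>n. LINT x|lebesgue. f n x * g x) \<longlonglongrightarrow> 0"
proof (rule LIMSEQ_I)
  fix e :: real assume e: "0 < e"
  define t where "t = e / (l2sq g + 1)"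
  have g0: "0 \<le> l2sq g" by (intro integral_nonneg_AE) auto
  then have t: "0 < t" unfolding t_def using e by (intro divide_pos_pos) linarith+
  have bound: "\<bar>LINT x|lebesgue. f n x * g x\<bar> \<le> l2sq (f n) / (2 * t) + t / 2 * l2sq g" for n
  proof -
    have "\<bar>a * b\<bar> \<le> (norm a)\<^sup>2 / (2 * t) + t / 2 * (norm b)\<^sup>2" for a b :: real
    proof -
      have "0 \<le> (\<bar>a\<bar> - t * \<bar>b\<bar>)\<^sup>2" by simp
      then have "2 * t * \<bar>a * b\<bar> \<le> a\<^sup>2 + t\<^sup>2 * b\<^sup>2" by (simp add: power2_diff power_mult_distrib abs_mult algebra_simps)
      then show ?thesis using t by (simp add: field_simps power2_eq_square)
    qed
    then have "(LINT x|lebesgue. \<bar>f n x * g x\<bar>) \<le> (LINT x|lebesgue. (norm (f n x))\<^sup>2 / (2 * t) + t / 2 * (norm (g x))\<^sup>2)"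
      using L2_times_integrable[OF f[of n] g] L2_D[OF f[of n]] L2_D[OF g] by (intro integral_mono) auto
    also have "\<dots> = l2sq (f n) / (2 * t) + t / 2 * l2sq g" using L2_D[OF f[of n]] L2_D[OF g] by simp
    finally show ?thesis using integral_abs_bound[of lebesgue "\<lambda>x. f n x * g x"] by linarith
  qed
  have "t * l2sq g \<le> e"
  proof -
    define A where "A = l2sq g"
    have "A * e \<le> (A + 1) * e" using e by (intro mult_right_mono) auto
    moreover have "0 \<le> A" using g0 by (simp only: A_def)
    ultimately have "e / (A + 1) * A \<le> e" by (simp add: pos_divide_le_eq mult.commute)
    then show ?thesis by (simp only: t_def A_def)
  qed
  moreover obtain N where N: "\<And>n. N \<le> n \<Longrightarrow> l2sq (f n) < t * e"
    using order_tendstoD(2)[OF lim, of "t * e"] t e by (auto simp: eventually_sequentially)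
  have "norm ((LINT x|lebesgue. f n x * g x) - 0) < e" if "N \<le> n" for n
  proof -
    have "l2sq (f n) / (2 * t) < e / 2" using N[OF that] t by (simp add: field_simps)
    then show ?thesis using bound[of n] \<open>t * l2sq g \<le> e\<close> by simp
  qed
  then show "\<exists>no. \<forall>n\<ge>no. norm ((LINT x|lebesgue. f n x * g x) - 0) < e" by blast
qed

lemma l2sq_eq_nn: "f \<in> L2 \<Longrightarrow> ennreal (l2sq f) = (\<integral>\<^sup>+x. ennreal ((norm (f x))\<^sup>2) \<partial>lebesgue)"
  using L2_D by (subst nn_integral_eq_integral) auto

text \<open>Here \<open>d m n\<close> is a squared distance.\<close>

definition Cauchy_seq :: "(nat \<Rightarrow> nat \<Rightarrow> real) \<Rightarrow> bool" where
  "Cauchy_seq d \<longleftrightarrow> (\<forall>e>0. \<exists>N. \<forall>m\<ge>N. \<forall>n\<ge>N. d m n < e)"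

lemma Cauchy_seq_mono:
  assumes "Cauchy_seq d" and le: "\<And>m n. d' m n \<le> d m n"
  shows "Cauchy_seq d'"
  unfolding Cauchy_seq_def
proof (intro allI impI)
  fix e :: real assume "0 < e"
  then obtain N where N: "\<forall>m\<ge>N. \<forall>n\<ge>N. d m n < e" using assms(1) unfolding Cauchy_seq_def by blast
  show "\<exists>N. \<forall>m\<ge>N. \<forall>n\<ge>N. d' m n < e"
    by (intro exI[of _ N] allI impI order_le_less_trans[OF le]) (use N in blast)
qed

text \<open>Riesz--Fischer: along a subsequence with \<open>\<parallel>g\<^sub>k\<^sub>+\<^sub>1 - g\<^sub>k\<parallel>\<^sup>2 \<le> 8\<^sup>-\<^sup>k\<close> the sum of
  \<open>4\<^sup>k \<bar>g\<^sub>k\<^sub>+\<^sub>1 - g\<^sub>k\<bar>\<^sup>2\<close> has finite integral, so its terms are eventually below 1 almost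
  everywhere.\<close>

lemma L2_complete:
  fixes g :: "nat \<Rightarrow> 'a::euclidean_space \<Rightarrow> 'b::euclidean_space"
  assumes L2: "\<And>n. g n \<in> L2" and Cau: "Cauchy_seq (\<lambda>m n. l2sq (\<lambda>x. g m x - g n x))"
  obtains h r where "h \<in> L2" "(\<lambda>n. l2sq (\<lambda>x. g n x - h x)) \<longlonglongrightarrow> 0"
    "strict_mono r" "AE x in lebesgue. (\<lambda>k. g (r k) x) \<longlonglongrightarrow> h x"
proof -
  have m[measurable]: "g n \<in> borel_measurable lebesgue" for n using L2_D(1)[OF L2] .
  have "\<exists>N. \<forall>m\<ge>N. \<forall>n\<ge>N. l2sq (\<lambda>x. g m x - g n x) < 1 / 8 ^ k" for k
    using Cau unfolding Cauchy_seq_def by simp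
  then obtain N where N: "\<And>k m n. N k \<le> m \<Longrightarrow> N k \<le> n \<Longrightarrow> l2sq (\<lambda>x. g m x - g n x) < 1 / 8 ^ k" by metis
  define r where "r = rec_nat (N 0) (\<lambda>k p. max (Suc p) (N (Suc k)))"
  have r_Suc: "r (Suc k) = max (Suc (r k)) (N (Suc k))" for k by (simp add: r_def)
  have r_mono: "strict_mono r" by (rule strict_mono_Suc_iff[THEN iffD2]) (auto simp: r_Suc less_max_iff_disj)
  have rN: "N k \<le> r k" for k by (cases k) (simp_all add: r_def)
  define d where "d k x = g (r (Suc k)) x - g (r k) x" for k x
  have d_L2: "d k \<in> L2" for k unfolding d_def by (intro L2_diff L2)
  have dm[measurable]: "d k \<in> borel_measurable lebesgue" for k using L2_D(1)[OF d_L2] .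
  have d_small: "l2sq (d k) \<le> 1 / 8 ^ k" for k
    using N[of k "r (Suc k)" "r k"] rN[of k] strict_monoD[OF r_mono, of k "Suc k"] by (simp add: d_def)
  have AE_conv: "AE x in lebesgue. convergent (\<lambda>k. g (r k) x)"
  proof -
    have "(\<integral>\<^sup>+x. (\<Sum>k. ennreal (4 ^ k * (norm (d k x))\<^sup>2)) \<partial>lebesgue) = (\<Sum>k. \<integral>\<^sup>+x. ennreal (4 ^ k * (norm (d k x))\<^sup>2) \<partial>lebesgue)"
      by (rule nn_integral_suminf) measurable
    also have "\<dots> \<le> (\<Sum>k. ennreal ((1 / 2) ^ k))"
    proof (rule suminf_le)
      fix k
      have "(\<integral>\<^sup>+x. ennreal (4 ^ k * (norm (d k x))\<^sup>2) \<partial>lebesgue) = ennreal (4 ^ k * l2sq (d k))"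
        using L2_D[OF d_L2[of k]] by (subst nn_integral_eq_integral) auto
      also have "\<dots> \<le> ennreal ((1 / 2) ^ k)"
      proof (rule ennreal_leI)
        have "4 ^ k * l2sq (d k) \<le> 4 ^ k * (1 / 8 ^ k)" using d_small by (intro mult_left_mono) auto
        also have "\<dots> = (4 / 8) ^ k" unfolding power_divide by simp
        also have "(4 / 8) ^ k = (1 / 2 :: real) ^ k" by (rule arg_cong[where f = "\<lambda>a. a ^ k"]) simp
        finally show "4 ^ k * l2sq (d k) \<le> (1 / 2) ^ k" .
      qed
      finally show "(\<integral>\<^sup>+x. ennreal (4 ^ k * (norm (d k x))\<^sup>2) \<partial>lebesgue) \<le> ennreal ((1 / 2) ^ k)" .
    qed auto
    also have "\<dots> < \<infinity>" by (subst suminf_ennreal2) (auto simp: summable_geometric)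
    finally have "AE x in lebesgue. (\<Sum>k. ennreal (4 ^ k * (norm (d k x))\<^sup>2)) \<noteq> \<infinity>"
      by (intro nn_integral_PInf_AE) auto
    then show ?thesis
    proof eventually_elim
      case (elim x)
      have "summable (\<lambda>k. 4 ^ k * (norm (d k x))\<^sup>2)" using elim by (intro summable_suminf_not_top) auto
      then have "(\<lambda>k. 4 ^ k * (norm (d k x))\<^sup>2) \<longlonglongrightarrow> 0" by (rule summable_LIMSEQ_zero)
      then have "\<forall>\<^sub>F k in sequentially. 4 ^ k * (norm (d k x))\<^sup>2 < 1" by (rule order_tendstoD) simp
      then have "\<forall>\<^sub>F k in sequentially. norm (d k x) \<le> (1 / 2) ^ k"
      proof eventually_elim
        case (elim k)
        have four: "(4::real) ^ k = (2 ^ k)\<^sup>2" by (simp add: power2_eq_square flip: power_mult_distrib)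
        have "(2 ^ k * norm (d k x))\<^sup>2 < 1\<^sup>2" using elim unfolding four power_mult_distrib by simp
        then have "2 ^ k * norm (d k x) < 1" by (rule power2_less_imp_less) simp
        then have "norm (d k x) < 1 / 2 ^ k" by (simp add: pos_less_divide_eq mult.commute)
        then show ?case by (simp add: power_one_over)
      qed
      then have "summable (\<lambda>k. d k x)"
        by (rule summable_comparison_test_ev) (simp add: summable_geometric)
      then have "convergent (\<lambda>n. \<Sum>k<n. d k x)" by (simp add: summable_iff_convergent)
      then have "convergent (\<lambda>n. (\<Sum>k<n. d k x) + g (r 0) x)" by (intro convergent_add convergent_const)
      moreover have "(\<Sum>k<n. d k x) + g (r 0) x = g (r n) x" for n
        unfolding d_def by (subst sum_lessThan_telescope) simp
      ultimately show ?case by simp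
    qed
  qed
  define h where "h x = lim (\<lambda>k. g (r k) x)" for x
  have hm[measurable]: "h \<in> borel_measurable lebesgue" unfolding h_def by measurable
  have AE_lim: "AE x in lebesgue. (\<lambda>k. g (r k) x) \<longlonglongrightarrow> h x"
    using AE_conv by eventually_elim (simp only: h_def convergent_LIMSEQ_iff)
  have Fatou: "(\<integral>\<^sup>+x. ennreal ((norm (g n x - h x))\<^sup>2) \<partial>lebesgue) \<le> ennreal e"
    if "\<And>m. M \<le> m \<Longrightarrow> l2sq (\<lambda>x. g n x - g m x) \<le> e" "0 \<le> e" for n M e
  proof -
    have "(\<integral>\<^sup>+x. ennreal ((norm (g n x - h x))\<^sup>2) \<partial>lebesgue)
        = (\<integral>\<^sup>+x. liminf (\<lambda>k. ennreal ((norm (g n x - g (r k) x))\<^sup>2)) \<partial>lebesgue)"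
    proof (rule nn_integral_cong_AE)
      show "AE x in lebesgue. ennreal ((norm (g n x - h x))\<^sup>2) = liminf (\<lambda>k. ennreal ((norm (g n x - g (r k) x))\<^sup>2))"
        using AE_lim
      proof eventually_elim
        case (elim x)
        then have "(\<lambda>k. ennreal ((norm (g n x - g (r k) x))\<^sup>2)) \<longlonglongrightarrow> ennreal ((norm (g n x - h x))\<^sup>2)"
          by (intro tendsto_intros tendsto_ennrealI)
        then show ?case by (rule lim_imp_Liminf[OF trivial_limit_sequentially, symmetric])
      qed
    qed
    also have "\<dots> \<le> liminf (\<lambda>k. \<integral>\<^sup>+x. ennreal ((norm (g n x - g (r k) x))\<^sup>2) \<partial>lebesgue)"
      by (rule nn_integral_liminf) measurable
    also have "\<dots> \<le> ennreal e"
    proof (rule Liminf_le)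
      have "\<forall>\<^sub>F k in sequentially. M \<le> r k"
        by (rule eventually_sequentiallyI[of M]) (rule order_trans[OF _ seq_suble[OF r_mono]])
      then show "\<forall>\<^sub>F k in sequentially. (\<integral>\<^sup>+x. ennreal ((norm (g n x - g (r k) x))\<^sup>2) \<partial>lebesgue) \<le> ennreal e"
      proof eventually_elim
        case (elim k)
        show ?case unfolding l2sq_eq_nn[OF L2_diff[OF L2[of n] L2[of "r k"]], symmetric]
          by (rule ennreal_leI[OF that(1)[OF elim]])
      qed
    qed simp
    finally show ?thesis .
  qed
  have diff_L2: "(\<lambda>x. g (N 0) x - h x) \<in> L2"
  proof -
    have "(\<integral>\<^sup>+x. ennreal ((norm (g (N 0) x - h x))\<^sup>2) \<partial>lebesgue) \<le> ennreal 1"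
      by (rule Fatou[of "N 0"]) (use N[of 0 "N 0"] in \<open>auto intro: less_imp_le\<close>)
    then have "integrable lebesgue (\<lambda>x. (norm (g (N 0) x - h x))\<^sup>2)"
      by (intro integrableI_bounded) (auto simp: order_le_less_trans)
    then show ?thesis by (simp add: L2_def)
  qed
  have h: "h \<in> L2" using L2_diff[OF L2[of "N 0"] diff_L2] by simp
  have lim0: "(\<lambda>n. l2sq (\<lambda>x. g n x - h x)) \<longlonglongrightarrow> 0"
  proof (rule LIMSEQ_I)
    fix e :: real assume e: "0 < e"
    obtain M where M: "\<And>m n. M \<le> m \<Longrightarrow> M \<le> n \<Longrightarrow> l2sq (\<lambda>x. g m x - g n x) < e / 2"
      using Cau[unfolded Cauchy_seq_def, rule_format, of "e / 2"] e by auto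
    have "norm (l2sq (\<lambda>x. g n x - h x) - 0) < e" if "M \<le> n" for n
    proof -
      have "ennreal (l2sq (\<lambda>x. g n x - h x)) \<le> ennreal (e / 2)"
        unfolding l2sq_eq_nn[OF L2_diff[OF L2[of n] h]]
        by (rule Fatou[of M]) (use M that e in \<open>auto intro: less_imp_le\<close>)
      then have "l2sq (\<lambda>x. g n x - h x) \<le> e / 2" using e by (simp add: ennreal_le_iff)
      moreover have "0 \<le> l2sq (\<lambda>x. g n x - h x)" by (intro integral_nonneg_AE) auto
      ultimately show ?thesis using e by simp
    qed
    then show "\<exists>no. \<forall>n\<ge>no. norm (l2sq (\<lambda>x. g n x - h x) - 0) < e" by blast
  qed
  show ?thesis by (rule that[OF h lim0 r_mono AE_lim])
qed

section \<open>The space \<open>W\<^sup>1\<^sup>,\<^sup>2\<close>\<close>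

text \<open>Square integrable functions are locally integrable, so among them the functions with a weak
  gradient are characterised by the integration by parts formula alone.\<close>

definition weak_ibp :: "('a::euclidean_space \<Rightarrow> real) \<Rightarrow> ('a \<Rightarrow> 'a) \<Rightarrow> bool" where
  "weak_ibp f G \<longleftrightarrow> (\<forall>\<phi>. test \<phi> \<longrightarrow> (\<forall>b\<in>Basis.
      (LINT x|lebesgue. f x * partial b \<phi> x) = - (LINT x|lebesgue. (G x \<bullet> b) * \<phi> x)))"

lemma W12_iff: "(f, G) \<in> W12 \<longleftrightarrow> f \<in> L2 \<and> G \<in> L2 \<and> weak_ibp f G"
  unfolding W12_def weak_gradient_def weak_ibp_def using L2_imp_L1_loc L2_inner by fastforce

lemma W12_D: assumes "(f, G) \<in> W12" shows "f \<in> L2" "G \<in> L2" "weak_ibp f G"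
  using assms by (auto simp: W12_iff)

abbreviation W12_dist ::
  "('a::euclidean_space \<Rightarrow> real) \<Rightarrow> ('a \<Rightarrow> 'a) \<Rightarrow> ('a \<Rightarrow> real) \<Rightarrow> ('a \<Rightarrow> 'a) \<Rightarrow> real" where
  "W12_dist f F g G \<equiv> W12_norm_sq (\<lambda>x. f x - g x) (\<lambda>x. F x - G x)"

lemma W12_norm_sq_eq: "W12_norm_sq f G = l2sq f + l2sq G" by (simp add: W12_norm_sq_def)

lemma W12_norm_sq_nonneg: "0 \<le> W12_norm_sq f G"
  unfolding W12_norm_sq_def by (intro add_nonneg_nonneg integral_nonneg_AE) auto

lemma W12_add: assumes "(f, F) \<in> W12" "(g, G) \<in> W12" shows "(\<lambda>x. f x + g x, \<lambda>x. F x + G x) \<in> W12"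
proof -
  note f = W12_D[OF assms(1)] and g = W12_D[OF assms(2)]
  have "weak_ibp (\<lambda>x. f x + g x) (\<lambda>x. F x + G x)"
    unfolding weak_ibp_def
  proof (intro allI impI ballI)
    fix \<phi> :: "'a \<Rightarrow> real" and b :: 'a assume \<phi>: "test \<phi>" and b: "b \<in> Basis"
    note L2p = L2_test[OF \<phi>] L2_test[OF test_partial[OF \<phi> b]]
    have "(LINT x|lebesgue. (f x + g x) * partial b \<phi> x)
      = (LINT x|lebesgue. f x * partial b \<phi> x) + (LINT x|lebesgue. g x * partial b \<phi> x)"
      unfolding distrib_right using L2_times_integrable[OF f(1) L2p(2)] L2_times_integrable[OF g(1) L2p(2)] by simp
    moreover have "(LINT x|lebesgue. ((F x + G x) \<bullet> b) * \<phi> x)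
      = (LINT x|lebesgue. (F x \<bullet> b) * \<phi> x) + (LINT x|lebesgue. (G x \<bullet> b) * \<phi> x)"
      unfolding distrib_right inner_add_left
      using L2_times_integrable[OF L2_inner[OF f(2)] L2p(1)] L2_times_integrable[OF L2_inner[OF g(2)] L2p(1)] by simp
    ultimately show "(LINT x|lebesgue. (f x + g x) * partial b \<phi> x) = - (LINT x|lebesgue. ((F x + G x) \<bullet> b) * \<phi> x)"
      using f(3) g(3) \<phi> b by (simp add: weak_ibp_def)
  qed
  then show ?thesis using f g by (simp add: W12_iff L2_add)
qed

lemma W12_scale: assumes "(f, F) \<in> W12" shows "(\<lambda>x. c * f x, \<lambda>x. c *\<^sub>R F x) \<in> W12"
proof -
  note f = W12_D[OF assms]
  have "weak_ibp (\<lambda>x. c * f x) (\<lambda>x. c *\<^sub>R F x)"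
    using f(3) by (simp add: weak_ibp_def mult.assoc)
  then show ?thesis using f L2_scaleR[OF f(1), of c] L2_scaleR[OF f(2), of c] by (simp add: W12_iff)
qed

lemma W12_diff: assumes "(f, F) \<in> W12" "(g, G) \<in> W12" shows "(\<lambda>x. f x - g x, \<lambda>x. F x - G x) \<in> W12"
  using W12_add[OF assms(1) W12_scale[OF assms(2), of "-1"]] by simp

lemma W12_zero: "(\<lambda>_. 0, \<lambda>_. 0) \<in> W12"
  by (auto simp: W12_iff weak_ibp_def L2_def)

lemma l2sq_parallelogram:
  assumes "f \<in> L2" "g \<in> L2"
  shows "l2sq (\<lambda>x. f x + g x) + l2sq (\<lambda>x. f x - g x) = 2 * l2sq f + 2 * l2sq g"
proof -
  note i = L2_D(2)[OF assms(1)] L2_D(2)[OF assms(2)] L2_D(2)[OF L2_add[OF assms]] L2_D(2)[OF L2_diff[OF assms]]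
  have "l2sq (\<lambda>x. f x + g x) + l2sq (\<lambda>x. f x - g x) = (LINT x|lebesgue. (norm (f x + g x))\<^sup>2 + (norm (f x - g x))\<^sup>2)"
    using i by simp
  also have "\<dots> = 2 * l2sq f + 2 * l2sq g" unfolding parallelogram using i by simp
  finally show ?thesis .
qed

lemma W12_parallelogram:
  assumes "(f, F) \<in> W12" "(g, G) \<in> W12"
  shows "W12_norm_sq (\<lambda>x. f x + g x) (\<lambda>x. F x + G x) + W12_dist f F g G
    = 2 * W12_norm_sq f F + 2 * W12_norm_sq g G"
proof -
  have sum: "(a + a') + (b + b') = 2 * (c + c') + 2 * (d + d')"
    if "a + b = 2 * c + 2 * d" "a' + b' = 2 * c' + 2 * d'" for a a' b b' c c' d d' :: real
    using that by (simp add: algebra_simps)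
  show ?thesis unfolding W12_norm_sq_eq
    by (rule sum[OF l2sq_parallelogram[OF W12_D(1)[OF assms(1)] W12_D(1)[OF assms(2)]]
          l2sq_parallelogram[OF W12_D(2)[OF assms(1)] W12_D(2)[OF assms(2)]]])
qed

lemma W12_norm_sq_add_le:
  assumes "(f, F) \<in> W12" "(g, G) \<in> W12"
  shows "W12_norm_sq (\<lambda>x. f x + g x) (\<lambda>x. F x + G x) \<le> 2 * W12_norm_sq f F + 2 * W12_norm_sq g G"
  using W12_parallelogram[OF assms] W12_norm_sq_nonneg[of "\<lambda>x. f x - g x" "\<lambda>x. F x - G x"] by linarith

lemma W12_norm_sq_scale: "W12_norm_sq (\<lambda>x. c * f x) (\<lambda>x. c *\<^sub>R F x) = c\<^sup>2 * W12_norm_sq f F"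
  by (simp add: W12_norm_sq_def power_mult_distrib distrib_left)

text \<open>The \<open>L\<^sup>2\<close>-limits of the functions and of their gradients form a pair in \<open>W\<^sup>1\<^sup>,\<^sup>2\<close>, because both
  sides of the integration by parts formula are continuous in \<open>L\<^sup>2\<close>.\<close>

lemma W12_complete:
  fixes f :: "nat \<Rightarrow> 'a::euclidean_space \<Rightarrow> real"
  assumes W: "\<And>n. (f n, F n) \<in> W12"
    and Cau: "Cauchy_seq (\<lambda>m n. W12_dist (f m) (F m) (f n) (F n))"
  obtains h H r where "(h, H) \<in> W12" "(\<lambda>n. W12_dist (f n) (F n) h H) \<longlonglongrightarrow> 0"
    "strict_mono r" "AE x in lebesgue. (\<lambda>k. f (r k) x) \<longlonglongrightarrow> h x"
proof -
  note f = W12_D(1)[OF W] and F = W12_D(2)[OF W]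
  have nn: "0 \<le> l2sq u" for u :: "'a \<Rightarrow> 'b::euclidean_space" by (intro integral_nonneg_AE) auto
  have le: "l2sq (\<lambda>x. f m x - f n x) \<le> W12_dist (f m) (F m) (f n) (F n)"
    "l2sq (\<lambda>x. F m x - F n x) \<le> W12_dist (f m) (F m) (f n) (F n)" for m n
    unfolding W12_norm_sq_eq using nn[of "\<lambda>x. f m x - f n x"] nn[of "\<lambda>x. F m x - F n x"] by linarith+
  note Cf = Cauchy_seq_mono[OF Cau le(1)] Cauchy_seq_mono[OF Cau le(2)]
  obtain h r where h: "h \<in> L2" "(\<lambda>n. l2sq (\<lambda>x. f n x - h x)) \<longlonglongrightarrow> 0"
    and r: "strict_mono r" "AE x in lebesgue. (\<lambda>k. f (r k) x) \<longlonglongrightarrow> h x"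
    by (rule L2_complete[OF f Cf(1)]) (rule that)
  obtain H r' where H: "H \<in> L2" "(\<lambda>n. l2sq (\<lambda>x. F n x - H x)) \<longlonglongrightarrow> 0"
    and r': "strict_mono (r' :: nat \<Rightarrow> nat)" "AE x in lebesgue. (\<lambda>k. F (r' k) x) \<longlonglongrightarrow> H x"
    by (rule L2_complete[OF F Cf(2)]) (rule that)
  have "weak_ibp h H" unfolding weak_ibp_def
  proof (intro allI impI ballI)
    fix \<phi> :: "'a \<Rightarrow> real" and b :: 'a assume \<phi>: "test \<phi>" and b: "b \<in> Basis"
    note L2p = L2_test[OF \<phi>] L2_test[OF test_partial[OF \<phi> b]]
    have 1: "(\<lambda>n. LINT x|lebesgue. (f n x - h x) * partial b \<phi> x) \<longlonglongrightarrow> 0"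
      by (rule L2_weak_limit[OF L2_diff[OF f h(1)] h(2) L2p(2)])
    have lim0: "(\<lambda>n. l2sq (\<lambda>x. (F n x - H x) \<bullet> b)) \<longlonglongrightarrow> 0"
    proof (rule tendsto_sandwich[OF _ _ tendsto_const H(2)])
      show "\<forall>\<^sub>F n in sequentially. 0 \<le> l2sq (\<lambda>x. (F n x - H x) \<bullet> b)" by (simp add: nn)
      have "(norm ((F n x - H x) \<bullet> b))\<^sup>2 \<le> (norm (F n x - H x))\<^sup>2" for n x
        using Basis_le_norm[OF b, of "F n x - H x"] by (intro power_mono) auto
      then have "l2sq (\<lambda>x. (F n x - H x) \<bullet> b) \<le> l2sq (\<lambda>x. F n x - H x)" for n
        using L2_D(2)[OF L2_diff[OF F[of n] H(1)]] L2_D(2)[OF L2_inner[OF L2_diff[OF F[of n] H(1)], of b]]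
        by (intro integral_mono) auto
      then show "\<forall>\<^sub>F n in sequentially. l2sq (\<lambda>x. (F n x - H x) \<bullet> b) \<le> l2sq (\<lambda>x. F n x - H x)" by simp
    qed
    have 2: "(\<lambda>n. LINT x|lebesgue. ((F n x - H x) \<bullet> b) * \<phi> x) \<longlonglongrightarrow> 0"
      by (rule L2_weak_limit[OF L2_inner[OF L2_diff[OF F H(1)]] lim0 L2p(1)])
    have e1: "(LINT x|lebesgue. (f n x - h x) * partial b \<phi> x)
        = (LINT x|lebesgue. f n x * partial b \<phi> x) - (LINT x|lebesgue. h x * partial b \<phi> x)" for n
      unfolding left_diff_distrib using L2_times_integrable[OF f[of n] L2p(2)] L2_times_integrable[OF h(1) L2p(2)] by simp
    have e2: "(LINT x|lebesgue. ((F n x - H x) \<bullet> b) * \<phi> x)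
        = (LINT x|lebesgue. (F n x \<bullet> b) * \<phi> x) - (LINT x|lebesgue. (H x \<bullet> b) * \<phi> x)" for n
      unfolding left_diff_distrib inner_diff_left
      using L2_times_integrable[OF L2_inner[OF F[of n], of b] L2p(1)] L2_times_integrable[OF L2_inner[OF H(1), of b] L2p(1)] by simp
    have "(\<lambda>n. (LINT x|lebesgue. (f n x - h x) * partial b \<phi> x) + (LINT x|lebesgue. ((F n x - H x) \<bullet> b) * \<phi> x)) \<longlonglongrightarrow> 0 + 0"
      by (intro tendsto_add 1 2)
    moreover have "(LINT x|lebesgue. (f n x - h x) * partial b \<phi> x) + (LINT x|lebesgue. ((F n x - H x) \<bullet> b) * \<phi> x)
      = - ((LINT x|lebesgue. h x * partial b \<phi> x) + (LINT x|lebesgue. (H x \<bullet> b) * \<phi> x))" for n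
      unfolding e1 e2 using W12_D(3)[OF W[of n]] \<phi> b by (simp add: weak_ibp_def)
    ultimately have "- ((LINT x|lebesgue. h x * partial b \<phi> x) + (LINT x|lebesgue. (H x \<bullet> b) * \<phi> x)) = 0"
      using LIMSEQ_unique tendsto_const by fastforce
    then show "(LINT x|lebesgue. h x * partial b \<phi> x) = - (LINT x|lebesgue. (H x \<bullet> b) * \<phi> x)" by linarith
  qed
  then have hH: "(h, H) \<in> W12" using h H by (simp add: W12_iff)
  have "(\<lambda>n. W12_dist (f n) (F n) h H) \<longlonglongrightarrow> 0 + 0"
    unfolding W12_norm_sq_eq by (intro tendsto_add h H)
  then have lim: "(\<lambda>n. W12_dist (f n) (F n) h H) \<longlonglongrightarrow> 0" by simp
  show ?thesis by (rule that[OF hH lim r])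
qed

lemma integrable_bounded_mult:
  fixes f h :: "'a \<Rightarrow> real"
  assumes f: "integrable M f" and h: "h \<in> borel_measurable M" "\<And>x. \<bar>h x\<bar> \<le> C"
  shows "integrable M (\<lambda>x. h x * f x)"
proof (rule Bochner_Integration.integrable_bound)
  show "integrable M (\<lambda>x. C * f x)" using f by simp
  have "\<bar>h x\<bar> * \<bar>f x\<bar> \<le> \<bar>C\<bar> * \<bar>f x\<bar>" for x by (rule mult_right_mono) (use h(2)[of x] in auto)
  then show "AE x in M. norm (h x * f x) \<le> norm (C * f x)" by (simp add: abs_mult)
qed (use f h(1) in auto)

lemma integral_bounded_mult_tendsto_0:
  fixes f h :: "nat \<Rightarrow> 'a \<Rightarrow> real"
  assumes f: "\<And>n. integrable M (f n)" and lim: "(\<lambda>n. LINT x|M. \<bar>f n x\<bar>) \<longlonglongrightarrow> 0"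
    and h: "\<And>n. h n \<in> borel_measurable M" "\<And>n x. \<bar>h n x\<bar> \<le> C"
  shows "(\<lambda>n. LINT x|M. h n x * f n x) \<longlonglongrightarrow> 0"
proof (rule Lim_null_comparison)
  show "(\<lambda>n. C * (LINT x|M. \<bar>f n x\<bar>)) \<longlonglongrightarrow> 0" using tendsto_mult_right_zero[OF lim] .
  have "\<bar>LINT x|M. h n x * f n x\<bar> \<le> C * (LINT x|M. \<bar>f n x\<bar>)" for n
  proof -
    have "\<bar>LINT x|M. h n x * f n x\<bar> \<le> (LINT x|M. \<bar>h n x * f n x\<bar>)" by (rule integral_abs_bound)
    also have "\<dots> \<le> (LINT x|M. C * \<bar>f n x\<bar>)"
    proof (rule integral_mono)
      show "integrable M (\<lambda>x. \<bar>h n x * f n x\<bar>)" using integrable_bounded_mult[OF f h] by simp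
      show "integrable M (\<lambda>x. C * \<bar>f n x\<bar>)" using f[of n] by simp
      show "\<bar>h n x * f n x\<bar> \<le> C * \<bar>f n x\<bar>" for x unfolding abs_mult by (rule mult_right_mono[OF h(2)]) simp
    qed
    also have "\<dots> = C * (LINT x|M. \<bar>f n x\<bar>)" by simp
    finally show ?thesis .
  qed
  then show "\<forall>\<^sub>F n in sequentially. norm (LINT x|M. h n x * f n x) \<le> C * (LINT x|M. \<bar>f n x\<bar>)" by simp
qed

lemma borel_version_on_ball:
  fixes f :: "'a::euclidean_space \<Rightarrow> real"
  assumes f: "f \<in> L2"
  shows "\<exists>f1\<in>borel_measurable borel. integrable lborel f1 \<and> (\<forall>x. x \<notin> cball 0 r \<longrightarrow> f1 x = 0)
    \<and> (AE x in lebesgue. x \<in> cball 0 r \<longrightarrow> f1 x = f x)"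
proof -
  obtain f0 where f0: "f0 \<in> borel_measurable lborel" "AE x in lborel. f x = f0 x"
    using completion_ex_borel_measurable_real[OF L2_D(1)[OF f]] by blast
  have AE0: "AE x in lebesgue. f x = f0 x" using f0(2) by (rule AE_completion)
  define f1 where "f1 x = indicator (cball 0 r) x * f0 x" for x
  have ind: "(indicator (cball 0 r) :: 'a \<Rightarrow> real) \<in> borel_measurable borel"
    by (rule borel_measurable_indicator[OF borel_closed[OF closed_cball]])
  have m: "f1 \<in> borel_measurable borel"
    unfolding f1_def[abs_def] by (rule borel_measurable_times[OF ind]) (use f0(1) in simp)
  have "(indicator (cball 0 r) :: 'a \<Rightarrow> real) \<in> L2"
    by (rule L2_bounded_support[OF ind, of 1 r]) (auto simp: indicator_def)
  then have I: "integrable lebesgue (\<lambda>x. indicator (cball 0 r) x * f x)" using f by (rule L2_times_integrable)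
  have "AE x in lebesgue. indicator (cball 0 r) x * f x = f1 x"
    using AE0 by eventually_elim (simp add: f1_def)
  then have "integrable lebesgue f1"
    by (intro integrable_cong_AE_imp[OF I]) (use m in \<open>auto simp: measurable_completion\<close>)
  then have "integrable lborel f1" using m by (simp add: integrable_completion)
  moreover have "AE x in lebesgue. x \<in> cball 0 r \<longrightarrow> f1 x = f x"
    using AE0 by eventually_elim (simp add: f1_def)
  ultimately show ?thesis using m by (intro bexI[of _ f1]) (auto simp: f1_def)
qed

text \<open>Mollify \<open>f\<close>, apply the classical chain rule, and let the mollification tend to the identity.
  In \<open>S' (\<rho>\<^sub>n * f) (\<rho>\<^sub>n * \<nabla>f)\<close> the second factor converges in \<open>L\<^sup>1\<close>, and the first one boundedly and
  almost everywhere along a subsequence. Only the values on a ball around the support of the test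
  function enter, so \<open>f\<close> and its gradient can be cut off to be integrable; the radius \<open>R + 2\<close> leaves
  room for the mollifier.\<close>

lemma W12_chain:
  fixes f :: "'a::euclidean_space \<Rightarrow> real"
  assumes W: "(f, G) \<in> W12" and S: "\<And>t. (S has_real_derivative S' t) (at t)"
    and S': "continuous_on UNIV S'" "\<And>t. \<bar>S' t\<bar> \<le> C" and S0: "S 0 = 0"
  shows "(\<lambda>x. S (f x), \<lambda>x. S' (f x) *\<^sub>R G x) \<in> W12"
proof -
  note f = W12_D(1)[OF W] and G = W12_D(2)[OF W]
  have Scont: "continuous_on UNIV S"
    using S by (intro continuous_at_imp_continuous_on ballI DERIV_isCont) auto
  have Sm[measurable]: "S \<in> borel_measurable borel" "S' \<in> borel_measurable borel"
    using Scont S'(1) by (auto intro: borel_measurable_continuous_onI)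
  have fm[measurable]: "f \<in> borel_measurable lebesgue" and Gm[measurable]: "G \<in> borel_measurable lebesgue"
    using L2_D(1)[OF f] L2_D(1)[OF G] .
  have lip: "\<bar>S s - S t\<bar> \<le> C * \<bar>s - t\<bar>" for s t
    using field_differentiable_bound[of UNIV S S' C s t] S S'(2) by simp
  have C0: "0 \<le> C" using S'(2)[of 0] by linarith
  have L2S: "(\<lambda>x. S (f x)) \<in> L2"
  proof (rule L2_dominated[of _ "\<lambda>x. C\<^sup>2 * (norm (f x))\<^sup>2"])
    show "(norm (S (f x)))\<^sup>2 \<le> C\<^sup>2 * (norm (f x))\<^sup>2" for x
      using power_mono[OF lip[of "f x" 0], of 2] S0 by (simp add: power_mult_distrib)
  qed (use L2_D(2)[OF f] in auto)
  have L2G: "(\<lambda>x. S' (f x) *\<^sub>R G x) \<in> L2"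
  proof (rule L2_dominated[of _ "\<lambda>x. C\<^sup>2 * (norm (G x))\<^sup>2"])
    show "(norm (S' (f x) *\<^sub>R G x))\<^sup>2 \<le> C\<^sup>2 * (norm (G x))\<^sup>2" for x
    proof -
      have "(S' (f x))\<^sup>2 \<le> C\<^sup>2" using power_mono[OF S'(2)[of "f x"], of 2] by simp
      then show ?thesis by (simp add: power_mult_distrib mult_right_mono)
    qed
  qed (use L2_D(2)[OF G] in auto)
  have "weak_ibp (\<lambda>x. S (f x)) (\<lambda>x. S' (f x) *\<^sub>R G x)"
    unfolding weak_ibp_def
  proof (intro allI impI ballI)
    fix \<phi> :: "'a \<Rightarrow> real" and b :: 'a assume \<phi>: "test \<phi>" and b: "b \<in> Basis"
    obtain R where R: "\<forall>x. R < norm x \<longrightarrow> \<phi> x = 0" using test_support[OF \<phi>] ..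
    have R': "partial b \<phi> x = 0" if "R < norm x" for x
      by (rule has_ddir_support[OF has_ddir_smooth[OF test_smooth[OF \<phi>]] _ that]) (use R in blast)
    obtain K1 where K1: "\<forall>x. \<bar>\<phi> x\<bar> \<le> K1" using test_bounded[OF \<phi>] by blast
    obtain K2 where K2: "\<forall>x. \<bar>partial b \<phi> x\<bar> \<le> K2" using test_bounded[OF test_partial[OF \<phi> b]] by blast
    have [measurable]: "\<phi> \<in> borel_measurable borel" "partial b \<phi> \<in> borel_measurable borel"
      using smooth_borel test_smooth \<phi> test_partial[OF \<phi> b] by blast+
    define B where "B = cball (0::'a) (R + 2)"
    obtain f1 where f1m[measurable]: "f1 \<in> borel_measurable borel" and f1: "integrable lborel f1"
      "\<forall>x. x \<notin> B \<longrightarrow> f1 x = 0" "AE x in lebesgue. x \<in> B \<longrightarrow> f1 x = f x"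
      using borel_version_on_ball[OF f, of "R + 2"] unfolding B_def by blast
    obtain g1 where g1m[measurable]: "g1 \<in> borel_measurable borel" and g1: "integrable lborel g1"
      "\<forall>x. x \<notin> B \<longrightarrow> g1 x = 0" "AE x in lebesgue. x \<in> B \<longrightarrow> g1 x = G x \<bullet> b"
      using borel_version_on_ball[OF L2_inner[OF G], of "R + 2" b] unfolding B_def by blast
    define u where "u n = mollify n f1" for n
    define v where "v n = mollify n g1" for n
    have um[measurable]: "u n \<in> borel_measurable borel" and vm[measurable]: "v n \<in> borel_measurable borel" for n
      unfolding u_def v_def using f1(1) g1(1) by (auto intro: conv_moll_borel)
    have ui: "integrable lborel (u n)" and vi: "integrable lborel (v n)" for n
      unfolding u_def v_def using f1(1) g1(1) integral_conv_moll by auto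
    \<comment> \<open>near the support of the test function the derivative of the mollification is the
      mollification of the weak derivative\<close>
    have grad: "conv lborel (partial b (moll n)) f1 x = v n x" if x: "norm x \<le> R" for n x
    proof -
      define \<psi> where "\<psi> y = moll n (x - y)" for y
      have \<psi>: "test \<psi>" unfolding \<psi>_def by (rule test_reflect[OF test_moll])
      have d\<psi>: "partial b \<psi> = (\<lambda>y. - partial b (moll n) (x - y))"
        unfolding \<psi>_def by (rule partial_reflect[OF test_smooth[OF test_moll]])
      have [measurable]: "\<psi> \<in> borel_measurable borel" "partial b \<psi> \<in> borel_measurable borel"
        using smooth_borel test_smooth \<psi> test_partial[OF \<psi> b] by blast+
      have [measurable]: "f1 \<in> borel_measurable lebesgue" "g1 \<in> borel_measurable lebesgue"
        "\<psi> \<in> borel_measurable lebesgue" "partial b \<psi> \<in> borel_measurable lebesgue"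
        by (rule measurable_completion, simp)+
      have far: "1 < norm (x - y)" if "y \<notin> B" for y
        using that x norm_triangle_ineq2[of y x] by (simp add: B_def norm_minus_commute)
      have one: "1 / real (Suc n) \<le> 1" by simp
      have z1: "\<psi> y = 0" if "y \<notin> B" for y
        unfolding \<psi>_def by (rule moll_support) (use far[OF that] one in linarith)
      have z2: "partial b \<psi> y = 0" if "y \<notin> B" for y
      proof -
        have "moll n z = 0" if "1 < norm z" for z :: 'a by (rule moll_support) (use that one in linarith)
        then have "partial b (moll n) (x - y) = 0"
          by (rule has_ddir_support[OF has_ddir_smooth[OF test_smooth[OF test_moll]] _ far[OF that]])
        then show ?thesis by (simp add: d\<psi>)
      qed
      have "(LINT y|lborel. f1 y * partial b \<psi> y) = (LINT y|lebesgue. f1 y * partial b \<psi> y)"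
        by (rule integral_completion[symmetric]) measurable
      also have "\<dots> = (LINT y|lebesgue. f y * partial b \<psi> y)"
      proof (rule integral_cong_AE)
        show "AE y in lebesgue. f1 y * partial b \<psi> y = f y * partial b \<psi> y"
          using f1(3)
        proof eventually_elim
          case (elim y) then show ?case using z2[of y] by (cases "y \<in> B") auto
        qed
      qed measurable
      also have "\<dots> = - (LINT y|lebesgue. (G y \<bullet> b) * \<psi> y)"
        using W12_D(3)[OF W] \<psi> b by (simp add: weak_ibp_def)
      also have "(LINT y|lebesgue. (G y \<bullet> b) * \<psi> y) = (LINT y|lebesgue. g1 y * \<psi> y)"
      proof (rule integral_cong_AE)
        show "AE y in lebesgue. (G y \<bullet> b) * \<psi> y = g1 y * \<psi> y"
          using g1(3)
        proof eventually_elim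
          case (elim y) then show ?case using z1[of y] by (cases "y \<in> B") auto
        qed
      qed measurable
      also have "(LINT y|lebesgue. g1 y * \<psi> y) = (LINT y|lborel. g1 y * \<psi> y)"
        by (rule integral_completion) measurable
      finally have "(LINT y|lborel. f1 y * partial b (moll n) (x - y)) = (LINT y|lborel. g1 y * \<psi> y)"
        by (simp add: d\<psi>)
      then show ?thesis by (simp add: \<psi>_def conv_def v_def mult.commute)
    qed
    have ibp: "(LINT x|lborel. S (u n x) * partial b \<phi> x) = - (LINT x|lborel. S' (u n x) * v n x * \<phi> x)" for n
    proof -
      have d: "has_ddir b (\<lambda>x. S (u n x)) (\<lambda>x. S' (u n x) * conv lborel (partial b (moll n)) f1 x)"
        unfolding u_def by (rule has_ddir_chain[OF conv_has_ddir S]) (use f1 b in \<open>auto intro: test_moll\<close>)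
      have cu: "continuous_on UNIV (u n)" unfolding u_def by (rule conv_continuous) (use f1 in \<open>auto intro: test_moll\<close>)
      have cp: "continuous_on UNIV (conv lborel (partial b (moll n)) f1)"
        by (rule conv_continuous) (use f1 b in \<open>auto intro: test_partial test_moll\<close>)
      have "(LINT x|lborel. S (u n x) * partial b \<phi> x)
          = - (LINT x|lborel. S' (u n x) * conv lborel (partial b (moll n)) f1 x * \<phi> x)"
      proof (rule integral_by_parts[OF d has_ddir_smooth[OF test_smooth[OF \<phi>]]])
        show "continuous_on UNIV (\<lambda>x. S (u n x))" "continuous_on UNIV (\<lambda>x. S' (u n x) * conv lborel (partial b (moll n)) f1 x)"
          using continuous_on_compose2[OF Scont cu] continuous_on_compose2[OF S'(1) cu] cp by (auto intro!: continuous_intros)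
        show "continuous_on UNIV \<phi>" "continuous_on UNIV (partial b \<phi>)"
          using smooth_continuous test_smooth \<phi> test_partial[OF \<phi> b] by blast+
        show "\<phi> x = 0" if "R < norm x" for x using R that by blast
      qed
      also have "(LINT x|lborel. S' (u n x) * conv lborel (partial b (moll n)) f1 x * \<phi> x)
        = (LINT x|lborel. S' (u n x) * v n x * \<phi> x)"
      proof (rule Bochner_Integration.integral_cong[OF refl])
        fix x show "S' (u n x) * conv lborel (partial b (moll n)) f1 x * \<phi> x = S' (u n x) * v n x * \<phi> x"
          using grad[of x n] R by (cases "norm x \<le> R") auto
      qed
      finally show ?thesis .
    qed
    have Lu: "(\<lambda>n. L1_dist (u n) f1) \<longlonglongrightarrow> 0" unfolding u_def by (rule conv_moll_converges_L1[OF f1(1)])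
    have Lv: "(\<lambda>n. L1_dist (v n) g1) \<longlonglongrightarrow> 0" unfolding v_def by (rule conv_moll_converges_L1[OF g1(1)])
    have "\<exists>r. strict_mono r \<and> (AE x in lborel. (\<lambda>n. u (r n) x - f1 x) \<longlonglongrightarrow> 0)"
      by (rule tendsto_L1_AE_subseq) (use Lu ui f1(1) in auto)
    then obtain r :: "nat \<Rightarrow> nat" where r: "strict_mono r" "AE x in lborel. (\<lambda>n. u (r n) x - f1 x) \<longlonglongrightarrow> 0" by blast
    have Si: "integrable lborel (\<lambda>x. S (w x))" if "integrable lborel w" for w :: "'a \<Rightarrow> real"
    proof (rule Bochner_Integration.integrable_bound)
      show "integrable lborel (\<lambda>x. C * w x)" using that by simp
      show "AE x in lborel. norm (S (w x)) \<le> norm (C * w x)" using lip[of _ 0] S0 C0 by (simp add: abs_mult)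
    qed (use that in measurable)
    have A: "(\<lambda>n. LINT x|lborel. S (u n x) * partial b \<phi> x) \<longlonglongrightarrow> (LINT x|lborel. S (f1 x) * partial b \<phi> x)"
    proof -
      have "(\<lambda>n. LINT x|lborel. partial b \<phi> x * (S (u n x) - S (f1 x))) \<longlonglongrightarrow> 0"
      proof (rule integral_bounded_mult_tendsto_0[of lborel "\<lambda>n x. S (u n x) - S (f1 x)" "\<lambda>_. partial b \<phi>" K2])
        show "integrable lborel (\<lambda>x. S (u n x) - S (f1 x))" for n using Si[OF ui] Si[OF f1(1)] by simp
        show "(\<lambda>n. LINT x|lborel. \<bar>S (u n x) - S (f1 x)\<bar>) \<longlonglongrightarrow> 0"
        proof (rule tendsto_sandwich[OF _ _ tendsto_const tendsto_mult_right_zero[OF Lu, of C]])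
          have "(LINT x|lborel. \<bar>S (u n x) - S (f1 x)\<bar>) \<le> (LINT x|lborel. C * \<bar>u n x - f1 x\<bar>)" for n
            by (rule integral_mono) (use Si[OF ui[of n]] Si[OF f1(1)] ui f1(1) lip in auto)
          then show "\<forall>\<^sub>F n in sequentially. (LINT x|lborel. \<bar>S (u n x) - S (f1 x)\<bar>) \<le> C * (L1_dist (u n) f1)" by simp
        qed (auto intro!: integral_nonneg_AE)
      qed (use K2 in auto)
      moreover have "(LINT x|lborel. partial b \<phi> x * (S (u n x) - S (f1 x)))
        = (LINT x|lborel. S (u n x) * partial b \<phi> x) - (LINT x|lborel. S (f1 x) * partial b \<phi> x)" for n
        using integrable_bounded_mult[OF Si[OF ui[of n]], of "partial b \<phi>" K2]
          integrable_bounded_mult[OF Si[OF f1(1)], of "partial b \<phi>" K2] K2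
        by (simp add: right_diff_distrib mult.commute)
      ultimately show ?thesis by (simp add: LIM_zero_iff)
    qed
    have bdd: "\<bar>S' (w x) * \<phi> x\<bar> \<le> C * K1" for w :: "'a \<Rightarrow> real" and x
      unfolding abs_mult by (rule mult_mono) (use S'(2) K1 C0 in auto)
    have B: "(\<lambda>n. LINT x|lborel. S' (u (r n) x) * v (r n) x * \<phi> x) \<longlonglongrightarrow> (LINT x|lborel. S' (f1 x) * g1 x * \<phi> x)"
    proof -
      have "(\<lambda>n. LINT x|lborel. (S' (u n x) * \<phi> x) * (v n x - g1 x)) \<longlonglongrightarrow> 0"
        by (rule integral_bounded_mult_tendsto_0[of lborel _ _ "C * K1"]) (use Lv vi g1(1) bdd in auto)
      then have 1: "(\<lambda>n. LINT x|lborel. (S' (u (r n) x) * \<phi> x) * (v (r n) x - g1 x)) \<longlonglongrightarrow> 0"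
        using LIMSEQ_subseq_LIMSEQ[OF _ r(1)] by (fastforce simp: o_def)
      have 2: "(\<lambda>n. LINT x|lborel. (S' (u (r n) x) * \<phi> x) * g1 x) \<longlonglongrightarrow> (LINT x|lborel. (S' (f1 x) * \<phi> x) * g1 x)"
      proof (rule integral_dominated_convergence)
        show "integrable lborel (\<lambda>x. C * K1 * \<bar>g1 x\<bar>)" using g1(1) by simp
        show "AE x in lborel. (\<lambda>n. S' (u (r n) x) * \<phi> x * g1 x) \<longlonglongrightarrow> S' (f1 x) * \<phi> x * g1 x"
          using r(2)
        proof eventually_elim
          case (elim x)
          then have "(\<lambda>n. u (r n) x) \<longlonglongrightarrow> f1 x" by (simp add: LIM_zero_iff)
          moreover have "isCont S' (f1 x)" using S'(1) by (simp add: continuous_on_eq_continuous_at)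
          ultimately have "(\<lambda>n. S' (u (r n) x)) \<longlonglongrightarrow> S' (f1 x)" by (rule isCont_tendsto_compose[rotated])
          then show ?case by (intro tendsto_intros)
        qed
        show "AE x in lborel. norm (S' (u (r n) x) * \<phi> x * g1 x) \<le> C * K1 * \<bar>g1 x\<bar>" for n
        proof (rule AE_I2)
          show "norm (S' (u (r n) x) * \<phi> x * g1 x) \<le> C * K1 * \<bar>g1 x\<bar>" for x
            unfolding real_norm_def abs_mult[of _ "g1 x"] by (rule mult_right_mono[OF bdd]) simp
        qed
      qed measurable
      have "(\<lambda>n. (LINT x|lborel. (S' (u (r n) x) * \<phi> x) * (v (r n) x - g1 x)) + (LINT x|lborel. (S' (u (r n) x) * \<phi> x) * g1 x))
        \<longlonglongrightarrow> 0 + (LINT x|lborel. (S' (f1 x) * \<phi> x) * g1 x)"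
        by (rule tendsto_add[OF 1 2])
      moreover have "(LINT x|lborel. (S' (u m x) * \<phi> x) * (v m x - g1 x)) + (LINT x|lborel. (S' (u m x) * \<phi> x) * g1 x)
          = (LINT x|lborel. S' (u m x) * v m x * \<phi> x)" for m
      proof -
        have "integrable lborel (\<lambda>x. (S' (u m x) * \<phi> x) * (v m x - g1 x))" "integrable lborel (\<lambda>x. (S' (u m x) * \<phi> x) * g1 x)"
          by (rule integrable_bounded_mult[of _ _ _ "C * K1"]; use vi g1(1) bdd in auto)+
        then show ?thesis
          by (subst Bochner_Integration.integral_add[symmetric]) (auto simp: algebra_simps intro!: Bochner_Integration.integral_cong)
      qed
      ultimately show ?thesis by (simp add: mult.assoc mult.commute[of "\<phi> _"])
    qed
    have "(\<lambda>n. LINT x|lborel. S (u (r n) x) * partial b \<phi> x) \<longlonglongrightarrow> (LINT x|lborel. S (f1 x) * partial b \<phi> x)"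
      using LIMSEQ_subseq_LIMSEQ[OF A r(1)] by (simp add: o_def)
    moreover have "(\<lambda>n. LINT x|lborel. S (u (r n) x) * partial b \<phi> x) \<longlonglongrightarrow> - (LINT x|lborel. S' (f1 x) * g1 x * \<phi> x)"
      unfolding ibp by (rule tendsto_minus[OF B])
    ultimately have eq: "(LINT x|lborel. S (f1 x) * partial b \<phi> x) = - (LINT x|lborel. S' (f1 x) * g1 x * \<phi> x)"
      by (rule LIMSEQ_unique)
    have out: "\<phi> x = 0" "partial b \<phi> x = 0" if "x \<notin> B" for x
    proof -
      have "R < norm x" using that by (simp add: B_def)
      then show "\<phi> x = 0" "partial b \<phi> x = 0" using R R' by blast+
    qed
    have [measurable]: "f1 \<in> borel_measurable lebesgue" "g1 \<in> borel_measurable lebesgue"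
      "\<phi> \<in> borel_measurable lebesgue" "partial b \<phi> \<in> borel_measurable lebesgue"
      by (rule measurable_completion, simp)+
    have "(LINT x|lebesgue. S (f x) * partial b \<phi> x) = (LINT x|lebesgue. S (f1 x) * partial b \<phi> x)"
    proof (rule integral_cong_AE)
      show "AE x in lebesgue. S (f x) * partial b \<phi> x = S (f1 x) * partial b \<phi> x"
        using f1(3)
      proof eventually_elim
        case (elim x) then show ?case using out[of x] by (cases "x \<in> B") auto
      qed
    qed measurable
    also have "\<dots> = (LINT x|lborel. S (f1 x) * partial b \<phi> x)" by (rule integral_completion) measurable
    also note eq
    also have "(LINT x|lborel. S' (f1 x) * g1 x * \<phi> x) = (LINT x|lebesgue. S' (f1 x) * g1 x * \<phi> x)"
      by (rule integral_completion[symmetric]) measurable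
    also have "\<dots> = (LINT x|lebesgue. ((S' (f x) *\<^sub>R G x) \<bullet> b) * \<phi> x)"
    proof (rule integral_cong_AE)
      show "AE x in lebesgue. S' (f1 x) * g1 x * \<phi> x = ((S' (f x) *\<^sub>R G x) \<bullet> b) * \<phi> x"
        using f1(3) g1(3)
      proof eventually_elim
        case (elim x) then show ?case using out[of x] by (cases "x \<in> B") auto
      qed
    qed measurable
    finally show "(LINT x|lebesgue. S (f x) * partial b \<phi> x) = - (LINT x|lebesgue. ((S' (f x) *\<^sub>R G x) \<bullet> b) * \<phi> x)" .
  qed
  then show ?thesis using L2S L2G by (simp add: W12_iff)
qed

text \<open>Capacity estimates add functions that are at least 1 on different sets, so these must be made
  nonnegative. The smooth function \<open>squash\<close> does what \<open>\<bar>t\<bar>\<close> would do: it is nonnegative, at least 1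
  where \<open>\<bar>t\<bar> \<ge> 1\<close>, vanishes at 0, and has a bounded derivative.\<close>

definition squash :: "real \<Rightarrow> real" where "squash t = 2 * t\<^sup>2 / (1 + t\<^sup>2)"

lemma squash_nonneg: "0 \<le> squash t" by (simp add: squash_def)

lemma squash_ge_1: "1 \<le> t \<Longrightarrow> 1 \<le> squash t"
proof -
  assume "1 \<le> t"
  then have "1 \<le> t\<^sup>2" by (simp add: one_le_power)
  moreover have "0 < 1 + t\<^sup>2" by (simp add: add_pos_nonneg)
  ultimately show ?thesis by (simp add: squash_def pos_le_divide_eq)
qed

lemma W12_squash:
  fixes f :: "'a::euclidean_space \<Rightarrow> real"
  assumes W: "(f, G) \<in> W12"
  shows "\<exists>H. (\<lambda>x. squash (f x), H) \<in> W12 \<and> W12_norm_sq (\<lambda>x. squash (f x)) H \<le> 4 * W12_norm_sq f G"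
proof -
  define S' where "S' t = 4 * t / (1 + t\<^sup>2)\<^sup>2" for t :: real
  have pos: "0 < 1 + t\<^sup>2" for t :: real by (simp add: add_pos_nonneg)
  have ne: "1 + t\<^sup>2 \<noteq> 0" for t :: real using pos[of t] by linarith
  have D: "(squash has_real_derivative S' t) (at t)" for t
    unfolding squash_def[abs_def] S'_def
    by (rule derivative_eq_intros refl ne)+ (simp add: field_simps power2_eq_square)
  have c: "continuous_on UNIV S'" unfolding S'_def by (intro continuous_intros) (simp add: ne)
  have b: "\<bar>S' t\<bar> \<le> 2" for t
  proof -
    have "0 \<le> (\<bar>t\<bar> - 1)\<^sup>2" by simp
    then have 1: "2 * \<bar>t\<bar> \<le> 1 + t\<^sup>2" by (simp add: power2_diff)
    have "(1 + t\<^sup>2) * 1 \<le> (1 + t\<^sup>2) * (1 + t\<^sup>2)" by (rule mult_left_mono) auto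
    then have "4 * \<bar>t\<bar> \<le> 2 * (1 + t\<^sup>2)\<^sup>2" using 1 by (simp add: power2_eq_square)
    moreover have "0 < (1 + t\<^sup>2)\<^sup>2" using pos[of t] by simp
    ultimately have "4 * \<bar>t\<bar> / (1 + t\<^sup>2)\<^sup>2 \<le> 2" by (simp add: pos_divide_le_eq)
    then show ?thesis by (simp add: S'_def abs_mult abs_divide)
  qed
  have lip: "\<bar>squash t\<bar> \<le> 2 * \<bar>t\<bar>" for t
    using field_differentiable_bound[of UNIV squash S' 2 t 0] D b by (simp add: squash_def)
  have W': "(\<lambda>x. squash (f x), \<lambda>x. S' (f x) *\<^sub>R G x) \<in> W12"
    by (rule W12_chain[OF W D c b]) (simp add: squash_def)
  note i = L2_D(2)[OF W12_D(1)[OF W]] L2_D(2)[OF W12_D(2)[OF W]] L2_D(2)[OF W12_D(1)[OF W']] L2_D(2)[OF W12_D(2)[OF W']]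
  have "l2sq (\<lambda>x. squash (f x)) \<le> (LINT x|lebesgue. 4 * (norm (f x))\<^sup>2)"
  proof (rule integral_mono)
    show "(norm (squash (f x)))\<^sup>2 \<le> 4 * (norm (f x))\<^sup>2" for x
      using power_mono[OF lip[of "f x"], of 2] by (simp add: power_mult_distrib)
  qed (use i in auto)
  moreover have "l2sq (\<lambda>x. S' (f x) *\<^sub>R G x) \<le> (LINT x|lebesgue. 4 * (norm (G x))\<^sup>2)"
  proof (rule integral_mono)
    show "(norm (S' (f x) *\<^sub>R G x))\<^sup>2 \<le> 4 * (norm (G x))\<^sup>2" for x
    proof -
      have "(S' (f x))\<^sup>2 \<le> 4" using power_mono[OF b[of "f x"], of 2] by simp
      then show ?thesis by (simp add: power_mult_distrib mult_right_mono)
    qed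
  qed (use i in auto)
  ultimately have "W12_norm_sq (\<lambda>x. squash (f x)) (\<lambda>x. S' (f x) *\<^sub>R G x) \<le> 4 * W12_norm_sq f G"
    unfolding W12_norm_sq_eq by simp
  with W' show ?thesis by (intro exI[of _ "\<lambda>x. S' (f x) *\<^sub>R G x"]) blast
qed

lemma W12_classical:
  fixes z :: "'a::euclidean_space \<Rightarrow> real"
  assumes d: "\<And>b. b \<in> Basis \<Longrightarrow> has_ddir b z (D b)" and c: "continuous_on UNIV z"
    "\<And>b. b \<in> Basis \<Longrightarrow> continuous_on UNIV (D b)" and s: "\<And>x. r < norm x \<Longrightarrow> z x = 0"
  shows "(z, \<lambda>x. \<Sum>b\<in>Basis. D b x *\<^sub>R b) \<in> W12"
    and "W12_norm_sq z (\<lambda>x. \<Sum>b\<in>Basis. D b x *\<^sub>R b) = (LINT x|lborel. (z x)\<^sup>2) + (\<Sum>b\<in>Basis. LINT x|lborel. (D b x)\<^sup>2)"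
proof -
  have s': "D b x = 0" if "b \<in> Basis" "r < norm x" for b x by (rule has_ddir_support[OF d[OF that(1)] s that(2)])
  have L2c: "h \<in> L2" if h: "continuous_on UNIV h" "\<And>x. r < norm x \<Longrightarrow> h x = 0" for h :: "'a \<Rightarrow> real"
  proof -
    obtain C where "\<forall>x. \<bar>h x\<bar> \<le> C" using continuous_bounded_support[OF h] by blast
    then show ?thesis using h borel_measurable_continuous_onI[OF h(1)] by (intro L2_bounded_support[of h C r]) auto
  qed
  define G where "G x = (\<Sum>b\<in>Basis. D b x *\<^sub>R b)" for x
  have Gb: "G x \<bullet> b = D b x" if "b \<in> Basis" for x b
    using that by (simp add: G_def inner_sum_left inner_Basis if_distrib[of "\<lambda>t. D _ _ * t"] sum.delta cong: if_cong)
  have normG: "(norm (G x))\<^sup>2 = (\<Sum>b\<in>Basis. (D b x)\<^sup>2)" for x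
    unfolding power2_norm_eq_inner euclidean_inner[of "G x" "G x"] using Gb by (simp add: power2_eq_square)
  have zL2: "z \<in> L2" by (rule L2c[OF c(1) s])
  have DL2: "D b \<in> L2" if "b \<in> Basis" for b by (rule L2c[OF c(2)[OF that] s'[OF that]])
  have Db: "D b \<in> borel_measurable borel" if "b \<in> Basis" for b by (rule borel_measurable_continuous_onI[OF c(2)[OF that]])
  have zb: "z \<in> borel_measurable borel" by (rule borel_measurable_continuous_onI[OF c(1)])
  have Gm: "G \<in> borel_measurable borel" unfolding G_def[abs_def] using Db by (intro borel_measurable_sum borel_measurable_scaleR) auto
  have iD: "integrable lebesgue (\<lambda>x. (D b x)\<^sup>2)" if "b \<in> Basis" for b using L2_D(2)[OF DL2[OF that]] by simp
  have GL2: "G \<in> L2"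
    unfolding L2_def using Gm iD by (auto simp: normG measurable_completion)
  have "weak_ibp z G" unfolding weak_ibp_def
  proof (intro allI impI ballI)
    fix \<phi> :: "'a \<Rightarrow> real" and b :: 'a assume \<phi>: "test \<phi>" and b: "b \<in> Basis"
    note sm = test_smooth[OF \<phi>] test_smooth[OF test_partial[OF \<phi> b]]
    have "(LINT x|lborel. \<phi> x * D b x) = - (LINT x|lborel. partial b \<phi> x * z x)"
      by (rule integral_by_parts[OF has_ddir_smooth[OF sm(1)] d[OF b] smooth_continuous[OF sm(1)]
            smooth_continuous[OF sm(2)] c(1) c(2)[OF b] s])
    moreover have "(LINT x|lebesgue. z x * partial b \<phi> x) = (LINT x|lborel. z x * partial b \<phi> x)"
      using zb smooth_borel[OF sm(2)] by (intro integral_completion) auto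
    moreover have "(LINT x|lebesgue. D b x * \<phi> x) = (LINT x|lborel. D b x * \<phi> x)"
      using Db[OF b] smooth_borel[OF sm(1)] by (intro integral_completion) auto
    ultimately show "(LINT x|lebesgue. z x * partial b \<phi> x) = - (LINT x|lebesgue. (G x \<bullet> b) * \<phi> x)"
      by (simp add: Gb[OF b] mult.commute)
  qed
  then show "(z, \<lambda>x. \<Sum>b\<in>Basis. D b x *\<^sub>R b) \<in> W12" using zL2 GL2 by (simp add: W12_iff G_def[abs_def])
  have "(LINT x|lebesgue. (D b x)\<^sup>2) = (LINT x|lborel. (D b x)\<^sup>2)" if "b \<in> Basis" for b
    using Db[OF that] by (intro integral_completion) auto
  moreover have "(LINT x|lebesgue. (z x)\<^sup>2) = (LINT x|lborel. (z x)\<^sup>2)" using zb by (intro integral_completion) auto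
  moreover have "(LINT x|lebesgue. (\<Sum>b\<in>Basis. (D b x)\<^sup>2)) = (\<Sum>b\<in>Basis. LINT x|lebesgue. (D b x)\<^sup>2)"
    using iD by (intro Bochner_Integration.integral_sum)
  ultimately show "W12_norm_sq z (\<lambda>x. \<Sum>b\<in>Basis. D b x *\<^sub>R b) = (LINT x|lborel. (z x)\<^sup>2) + (\<Sum>b\<in>Basis. LINT x|lborel. (D b x)\<^sup>2)"
    unfolding W12_norm_sq_def G_def[symmetric] normG by simp
qed

lemma W12_norm_sq_commute:
  "W12_dist f F g G = W12_dist g G f F"
  unfolding W12_norm_sq_def by (simp add: power2_commute[of "f _"] norm_minus_commute[of "F _"])

text \<open>Elements of almost minimal norm of decreasing convex sets form a Cauchy sequence: midpoints
  stay in the set, so the parallelogram law bounds their distance.\<close>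

lemma W12_almost_minimal_Cauchy:
  fixes C :: "nat \<Rightarrow> (('a::euclidean_space \<Rightarrow> real) \<times> ('a \<Rightarrow> 'a)) set"
  assumes ne: "\<And>n. C n \<noteq> {}" and dec: "\<And>n. C (Suc n) \<subseteq> C n" and sub: "C 0 \<subseteq> W12"
    and bd: "\<And>f F. (f, F) \<in> C 0 \<Longrightarrow> W12_norm_sq f F \<le> M"
    and mid: "\<And>n f F g G. (f, F) \<in> C n \<Longrightarrow> (g, G) \<in> C n \<Longrightarrow>
      (\<lambda>x. (1 / 2) * (f x + g x), \<lambda>x. (1 / 2) *\<^sub>R (F x + G x)) \<in> C n"
  shows "\<exists>f F. (\<forall>n. (f n, F n) \<in> C n) \<and>
    Cauchy_seq (\<lambda>m n. W12_dist (f m) (F m) (f n) (F n))"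
proof -
  define N where "N p = W12_norm_sq (fst p) (snd p)" for p :: "('a \<Rightarrow> real) \<times> ('a \<Rightarrow> 'a)"
  define d where "d n = Inf (N ` C n)" for n
  have N0: "0 \<le> N p" for p unfolding N_def by (rule W12_norm_sq_nonneg)
  have anti: "C m \<subseteq> C n" if "n \<le> m" for m n using lift_Suc_antimono_le[of C, OF dec that] .
  have bdd: "bdd_below (N ` C n)" for n using N0 by (intro bdd_belowI2[of _ 0]) auto
  have d_le: "d n \<le> N p" if "p \<in> C n" for n p unfolding d_def using that bdd by (intro cInf_lower) auto
  have d_mono: "d n \<le> d m" if "n \<le> m" for m n
    unfolding d_def using anti[OF that] ne bdd by (intro cInf_superset_mono) auto
  have N_M: "N p \<le> M" if "p \<in> C n" for n p
    using bd[of "fst p" "snd p"] anti[of 0 n] that by (auto simp: N_def)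
  have d_M: "d n \<le> M" for n
  proof -
    obtain p where "p \<in> C n" using ne[of n] by blast
    then show ?thesis using d_le N_M by (meson order_trans)
  qed
  have "\<exists>p\<in>C n. N p < d n + 1 / real (Suc n)" for n
  proof -
    have "Inf (N ` C n) < d n + 1 / real (Suc n)" by (simp add: d_def)
    then show ?thesis using cInf_lessD[of "N ` C n"] ne[of n] by auto
  qed
  then obtain p where p: "\<And>n. p n \<in> C n" "\<And>n. N (p n) < d n + 1 / real (Suc n)" by metis
  define f where "f n = fst (p n)" for n
  define F where "F n = snd (p n)" for n
  have pf: "p n = (f n, F n)" for n by (simp add: f_def F_def)
  have W: "(f n, F n) \<in> W12" for n using p(1)[of n] anti[of 0 n] sub pf by auto
  have "incseq d" using d_mono by (auto simp: incseq_def)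
  then obtain L where L: "d \<longlonglongrightarrow> L" "\<And>n. d n \<le> L" using incseq_convergent[of d M] d_M by blast
  have est: "W12_dist (f m) (F m) (f n) (F n) \<le> 2 * (L - d n) + 4 / real (Suc n)" if "n \<le> m" for m n
  proof -
    have "(f m, F m) \<in> C n" "(f n, F n) \<in> C n" using p(1) pf anti[OF that] by (metis subsetD)+
    from mid[OF this] have "d n \<le> N (\<lambda>x. (1 / 2) * (f m x + f n x), \<lambda>x. (1 / 2) *\<^sub>R (F m x + F n x))" by (rule d_le)
    also have "\<dots> = (1 / 2)\<^sup>2 * W12_norm_sq (\<lambda>x. f m x + f n x) (\<lambda>x. F m x + F n x)"
      unfolding N_def fst_conv snd_conv by (rule W12_norm_sq_scale)
    finally have 1: "4 * d n \<le> W12_norm_sq (\<lambda>x. f m x + f n x) (\<lambda>x. F m x + F n x)" by (simp add: power2_eq_square)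
    have 2: "W12_norm_sq (f m) (F m) \<le> L + 1 / real (Suc n)"
    proof -
      have "1 / real (Suc m) \<le> 1 / real (Suc n)" using that by (simp add: frac_le)
      then show ?thesis using p(2)[of m] L(2)[of m] by (simp add: N_def f_def F_def)
    qed
    have 3: "W12_norm_sq (f n) (F n) \<le> d n + 1 / real (Suc n)" using p(2)[of n] by (simp add: N_def f_def F_def)
    have 4: "4 / real (Suc n) = 4 * (1 / real (Suc n))" by simp
    show ?thesis using W12_parallelogram[OF W[of m] W[of n]] 1 2 3 unfolding 4 right_diff_distrib by linarith
  qed
  have "Cauchy_seq (\<lambda>m n. W12_dist (f m) (F m) (f n) (F n))"
    unfolding Cauchy_seq_def
  proof (intro allI impI)
    fix e :: real assume e: "0 < e"
    have "(\<lambda>n. 2 * (L - d n) + 4 / real (Suc n)) \<longlonglongrightarrow> 2 * (L - L) + 4 * 0"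
      unfolding divide_inverse[of 4] by (intro tendsto_intros L LIMSEQ_inverse_real_of_nat)
    then have "(\<lambda>n. 2 * (L - d n) + 4 / real (Suc n)) \<longlonglongrightarrow> 0" by simp
    from order_tendstoD(2)[OF this e] obtain K where K: "\<And>n. K \<le> n \<Longrightarrow> 2 * (L - d n) + 4 / real (Suc n) < e"
      by (auto simp: eventually_sequentially)
    have "W12_dist (f m) (F m) (f n) (F n) < e" if "K \<le> m" "K \<le> n" for m n
    proof (cases "n \<le> m")
      case True
      then show ?thesis using est[OF True] K[OF that(2)] by linarith
    next
      case False
      then have "m \<le> n" by simp
      then show ?thesis using est[OF \<open>m \<le> n\<close>] K[OF that(1)] W12_norm_sq_commute[of "f m" "f n" "F m" "F n"] by linarith
    qed
    then show "\<exists>N. \<forall>m\<ge>N. \<forall>n\<ge>N. W12_dist (f m) (F m) (f n) (F n) < e" by blast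
  qed
  moreover have "\<forall>n. (f n, F n) \<in> C n" using p(1) pf by metis
  ultimately show ?thesis by blast
qed

section \<open>Capacity\<close>

lemma cap_le:
  assumes "(f, G) \<in> W12" "open V" "A \<subseteq> V" "AE x in lebesgue. x \<in> V \<longrightarrow> 1 \<le> f x"
  shows "cap A \<le> ennreal (W12_norm_sq f G)"
  unfolding cap_def by (rule Inf_lower) (use assms in blast)

lemma cap_lessD:
  assumes "cap A < ennreal e"
  shows "\<exists>f G V. (f, G) \<in> W12 \<and> open V \<and> A \<subseteq> V \<and> (AE x in lebesgue. x \<in> V \<longrightarrow> 1 \<le> f x) \<and> W12_norm_sq f G < e"
proof -
  obtain f G where "(f, G) \<in> W12" "\<exists>V. open V \<and> A \<subseteq> V \<and> (AE x in lebesgue. x \<in> V \<longrightarrow> 1 \<le> f x)"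
    "ennreal (W12_norm_sq f G) < ennreal e"
    using assms unfolding cap_def Inf_less_iff by blast
  moreover from this(3) have "W12_norm_sq f G < e" by (simp add: ennreal_less_iff W12_norm_sq_nonneg)
  ultimately show ?thesis by blast
qed

lemma cap_mono: "A \<subseteq> B \<Longrightarrow> cap A \<le> cap B"
  unfolding cap_def by (rule Inf_superset_mono) blast

text \<open>A Borel--Cantelli lemma. The sum of the \<open>g i\<close> over \<open>i \<ge> k\<close> is at least 1 on each \<open>V i\<close> with
  \<open>i \<ge> k\<close>, and its squared norm is of order \<open>c / 4\<^sup>k\<close>: adding the terms from the last to the first,
  \<open>\<parallel>f + g\<parallel>\<^sup>2 \<le> 2 \<parallel>f\<parallel>\<^sup>2 + 2 \<parallel>g\<parallel>\<^sup>2\<close> doubles the bound of the tail at each step, which the factor 4 beats.\<close>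

lemma cap_limsup_zero:
  fixes g :: "nat \<Rightarrow> 'a::euclidean_space \<Rightarrow> real"
  assumes W: "\<And>i. (g i, H i) \<in> W12" and nn: "\<And>i x. 0 \<le> g i x" and V: "\<And>i. open (V i)"
    and ge: "\<And>i. AE x in lebesgue. x \<in> V i \<longrightarrow> 1 \<le> g i x"
    and N: "\<And>i. W12_norm_sq (g i) (H i) \<le> c / 4 ^ i"
  shows "cap (\<Inter>k. \<Union>i\<in>{k..}. V i) = 0"
proof -
  define s where "s k j x = (\<Sum>i<j. g (k + i) x)" for k j x
  define T where "T k j x = (\<Sum>i<j. H (k + i) x)" for k j x
  have c0: "0 \<le> c" using N[of 0] W12_norm_sq_nonneg[of "g 0" "H 0"] by simp
  have sW: "(s k j, T k j) \<in> W12" for k j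
  proof (induction j)
    case 0 then show ?case using W12_zero by (simp add: s_def[abs_def] T_def[abs_def])
  next
    case (Suc j) then show ?case using W12_add[OF Suc W[of "k + j"]] by (simp add: s_def[abs_def] T_def[abs_def])
  qed
  have sN: "W12_norm_sq (s k j) (T k j) \<le> 4 * c / 4 ^ k" for k j
  proof (induction j arbitrary: k)
    case 0 then show ?case using c0 by (simp add: s_def[abs_def] T_def[abs_def] W12_norm_sq_def)
  next
    case (Suc j)
    have eq: "s k (Suc j) = (\<lambda>x. g k x + s (Suc k) j x)" "T k (Suc j) = (\<lambda>x. H k x + T (Suc k) j x)"
      unfolding s_def[abs_def] T_def[abs_def] sum.lessThan_Suc_shift by simp_all
    have "W12_norm_sq (s k (Suc j)) (T k (Suc j)) \<le> 2 * W12_norm_sq (g k) (H k) + 2 * W12_norm_sq (s (Suc k) j) (T (Suc k) j)"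
      unfolding eq by (rule W12_norm_sq_add_le[OF W sW])
    also have "\<dots> \<le> 2 * (c / 4 ^ k) + 2 * (4 * c / 4 ^ Suc k)"
      using N[of k] Suc[of "Suc k"] by (intro add_mono mult_left_mono) auto
    also have "\<dots> = 4 * c / 4 ^ k" by (simp add: field_simps)
    finally show ?case .
  qed
  have le: "cap (\<Inter>k. \<Union>i\<in>{k..}. V i) \<le> ennreal (8 * c / 4 ^ k)" for k
  proof -
    have diff: "W12_dist (s k m) (T k m) (s k n) (T k n) \<le> 4 * c / 4 ^ (k + n)" if "n \<le> m" for m n
    proof -
      obtain j where m: "m = n + j" using \<open>n \<le> m\<close> le_Suc_ex by blast
      have "s k m x - s k n x = s (k + n) j x" "T k m x - T k n x = T (k + n) j x" for x
        unfolding m s_def T_def by (induction j) (simp_all add: add.assoc algebra_simps)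
      then show ?thesis using sN[of "k + n" j] by simp
    qed
    have "Cauchy_seq (\<lambda>m n. W12_dist (s k m) (T k m) (s k n) (T k n))"
      unfolding Cauchy_seq_def
    proof (intro allI impI)
      fix e :: real assume e: "0 < e"
      have "(\<lambda>n. (4 * c / 4 ^ k) * (1 / 4) ^ n) \<longlonglongrightarrow> (4 * c / 4 ^ k) * 0"
        by (intro tendsto_intros LIMSEQ_power_zero) simp
      then have "(\<lambda>n. 4 * c / 4 ^ (k + n)) \<longlonglongrightarrow> 0" by (simp add: power_add power_one_over field_simps)
      from order_tendstoD(2)[OF this e] obtain K where K: "\<And>n. K \<le> n \<Longrightarrow> 4 * c / 4 ^ (k + n) < e"
        by (auto simp: eventually_sequentially)
      have "W12_dist (s k m) (T k m) (s k n) (T k n) < e" if "K \<le> m" "K \<le> n" for m n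
      proof (cases "n \<le> m")
        case True
        then show ?thesis using diff[OF True] K[OF that(2)] by linarith
      next
        case False
        then have "m \<le> n" by simp
        then show ?thesis using diff[OF \<open>m \<le> n\<close>] K[OF that(1)] W12_norm_sq_commute[of "s k m" "s k n" "T k m" "T k n"] by linarith
      qed
      then show "\<exists>N. \<forall>m\<ge>N. \<forall>n\<ge>N. W12_dist (s k m) (T k m) (s k n) (T k n) < e" by blast
    qed
    then obtain h Hh r where h: "(h, Hh) \<in> W12" "(\<lambda>n. W12_dist (s k n) (T k n) h Hh) \<longlonglongrightarrow> 0"
      "strict_mono (r :: nat \<Rightarrow> nat)" "AE x in lebesgue. (\<lambda>j. s k (r j) x) \<longlonglongrightarrow> h x"
      by (rule W12_complete[OF sW]) (rule that)
    have "AE x in lebesgue. \<forall>i. x \<in> V i \<longrightarrow> 1 \<le> g i x" using ge by (simp add: AE_all_countable)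
    then have AE: "AE x in lebesgue. x \<in> (\<Union>i\<in>{k..}. V i) \<longrightarrow> 1 \<le> h x"
      using h(4)
    proof eventually_elim
      case (elim x)
      show ?case
      proof
        assume "x \<in> (\<Union>i\<in>{k..}. V i)"
        then obtain i where i: "k \<le> i" "x \<in> V i" by auto
        have "1 \<le> s k (r j) x" if "Suc i \<le> j" for j
        proof -
          have "Suc i \<le> r j" using that seq_suble[OF h(3), of j] by linarith
          then have mem: "i - k \<in> {..<r j}" by auto
          have "1 \<le> g (k + (i - k)) x" using elim(1) i by simp
          also have "\<dots> \<le> s k (r j) x" unfolding s_def
            by (rule member_le_sum[OF mem]) (auto simp: nn)
          finally show ?thesis .
        qed
        then show "1 \<le> h x" using elim(2) by (intro LIMSEQ_le_const[of _ _ 1]) blast+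
      qed
    qed
    have "cap (\<Inter>k. \<Union>i\<in>{k..}. V i) \<le> ennreal (W12_norm_sq h Hh)"
      by (rule cap_le[OF h(1) _ _ AE]) (use V in blast)+
    also have "W12_norm_sq h Hh \<le> 8 * c / 4 ^ k"
    proof (rule LIMSEQ_le_const)
      have "(\<lambda>n. 8 * c / 4 ^ k + 2 * W12_dist (s k n) (T k n) h Hh) \<longlonglongrightarrow> 8 * c / 4 ^ k + 2 * 0"
        by (intro tendsto_intros h)
      then show "(\<lambda>n. 8 * c / 4 ^ k + 2 * W12_dist (s k n) (T k n) h Hh) \<longlonglongrightarrow> 8 * c / 4 ^ k" by simp
      have "W12_norm_sq h Hh \<le> 8 * c / 4 ^ k + 2 * W12_dist (s k n) (T k n) h Hh" for n
      proof -
        have "W12_norm_sq (\<lambda>x. s k n x + (h x - s k n x)) (\<lambda>x. T k n x + (Hh x - T k n x))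
          \<le> 2 * W12_norm_sq (s k n) (T k n) + 2 * W12_dist h Hh (s k n) (T k n)"
          by (rule W12_norm_sq_add_le[OF sW W12_diff[OF h(1) sW]])
        then have "W12_norm_sq h Hh \<le> 2 * W12_norm_sq (s k n) (T k n) + 2 * W12_dist h Hh (s k n) (T k n)" by simp
        moreover have "2 * W12_norm_sq (s k n) (T k n) \<le> 8 * c / 4 ^ k" using sN[of k n] by simp
        ultimately show ?thesis using W12_norm_sq_commute[of h "s k n" Hh "T k n"] by linarith
      qed
      then show "\<exists>N. \<forall>n\<ge>N. W12_norm_sq h Hh \<le> 8 * c / 4 ^ k + 2 * W12_dist (s k n) (T k n) h Hh" by blast
    qed
    finally show ?thesis by (simp add: ennreal_leI)
  qed
  have "(\<lambda>k. ennreal ((8 * c) * (1 / 4) ^ k)) \<longlonglongrightarrow> ennreal ((8 * c) * 0)"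
    by (intro tendsto_ennrealI tendsto_intros LIMSEQ_power_zero) simp
  then have "(\<lambda>k. ennreal (8 * c / 4 ^ k)) \<longlonglongrightarrow> 0" by (simp add: power_one_over field_simps)
  then have "cap (\<Inter>k. \<Union>i\<in>{k..}. V i) \<le> 0" by (rule LIMSEQ_le_const) (use le in blast)
  then show ?thesis by simp
qed

text \<open>Chebyshev's inequality for the capacity. The set where \<open>y - w > a\<close> is open only relative to the
  complement of a set \<open>U\<close> of small capacity, but its union with \<open>U\<close> is open. Almost everywhere on
  this union, \<open>f / a \<ge> 1\<close> (off \<open>U\<close>) or \<open>h \<ge> 1\<close> (on \<open>U\<close>), where \<open>h\<close> is admissible for \<open>U\<close>.\<close>

lemma cap_exceed:
  fixes y w f :: "'a::euclidean_space \<Rightarrow> real"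
  assumes "open W" and qc: "quasicontinuous W w" and y: "continuous_on UNIV y" and f: "(f, F) \<in> W12"
    and AE: "AE x in lebesgue. x \<in> W \<longrightarrow> f x = y x - w x" and a: "0 < a" and \<delta>: "0 < \<delta>"
  shows "\<exists>g H V. (g, H) \<in> W12 \<and> (\<forall>x. 0 \<le> g x) \<and> open V \<and> {x\<in>W. a < y x - w x} \<subseteq> V
    \<and> (AE x in lebesgue. x \<in> V \<longrightarrow> 1 \<le> g x) \<and> W12_norm_sq g H \<le> 8 * W12_norm_sq f F / a\<^sup>2 + \<delta>"
proof -
  obtain U where U: "open U" "U \<subseteq> W" "cap U < ennreal (\<delta> / 8)" "continuous_on (W - U) w"
    using qc \<delta> unfolding quasicontinuous_def by (meson divide_pos_pos zero_less_numeral)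
  obtain h K V0 where h: "(h, K) \<in> W12" "U \<subseteq> V0" "AE x in lebesgue. x \<in> V0 \<longrightarrow> 1 \<le> h x" "W12_norm_sq h K < \<delta> / 8"
    using cap_lessD[OF U(3)] by blast
  have fa: "(\<lambda>x. (1 / a) * f x, \<lambda>x. (1 / a) *\<^sub>R F x) \<in> W12" by (rule W12_scale[OF f])
  obtain H1 where H1: "(\<lambda>x. squash ((1 / a) * f x), H1) \<in> W12"
    "W12_norm_sq (\<lambda>x. squash ((1 / a) * f x)) H1 \<le> 4 * W12_norm_sq (\<lambda>x. (1 / a) * f x) (\<lambda>x. (1 / a) *\<^sub>R F x)"
    using W12_squash[OF fa] by blast
  obtain H2 where H2: "(\<lambda>x. squash (h x), H2) \<in> W12" "W12_norm_sq (\<lambda>x. squash (h x)) H2 \<le> 4 * W12_norm_sq h K"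
    using W12_squash[OF h(1)] by blast
  define g where "g x = squash ((1 / a) * f x) + squash (h x)" for x
  have gW: "(g, \<lambda>x. H1 x + H2 x) \<in> W12" unfolding g_def[abs_def] by (rule W12_add[OF H1(1) H2(1)])
  have "W12_norm_sq g (\<lambda>x. H1 x + H2 x) \<le> 2 * W12_norm_sq (\<lambda>x. squash ((1 / a) * f x)) H1 + 2 * W12_norm_sq (\<lambda>x. squash (h x)) H2"
    unfolding g_def[abs_def] by (rule W12_norm_sq_add_le[OF H1(1) H2(1)])
  also have "\<dots> \<le> 8 * W12_norm_sq (\<lambda>x. (1 / a) * f x) (\<lambda>x. (1 / a) *\<^sub>R F x) + \<delta>" using H1(2) H2(2) h(4) by linarith
  also have "W12_norm_sq (\<lambda>x. (1 / a) * f x) (\<lambda>x. (1 / a) *\<^sub>R F x) = (1 / a)\<^sup>2 * W12_norm_sq f F" by (rule W12_norm_sq_scale)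
  also have "8 * ((1 / a)\<^sup>2 * W12_norm_sq f F) = 8 * W12_norm_sq f F / a\<^sup>2" by (simp add: power_divide)
  finally have bound: "W12_norm_sq g (\<lambda>x. H1 x + H2 x) \<le> 8 * W12_norm_sq f F / a\<^sup>2 + \<delta>" .
  have "continuous_on (W - U) (\<lambda>x. y x - w x)" using U(4) y by (intro continuous_intros) (auto intro: continuous_on_subset)
  then have "\<exists>T. open T \<and> T \<inter> (W - U) = (\<lambda>x. y x - w x) -` {a<..} \<inter> (W - U)"
    unfolding continuous_on_open_invariant by simp
  then obtain T where T: "open T" "T \<inter> (W - U) = (\<lambda>x. y x - w x) -` {a<..} \<inter> (W - U)" by blast
  define V where "V = U \<union> (T \<inter> W)"
  have V: "open V" unfolding V_def using U T \<open>open W\<close> by auto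
  have in_T: "x \<in> T \<longleftrightarrow> a < y x - w x" if "x \<in> W" "x \<notin> U" for x using T(2) that by blast
  have sub: "{x\<in>W. a < y x - w x} \<subseteq> V" unfolding V_def using in_T by auto
  have "AE x in lebesgue. x \<in> V \<longrightarrow> 1 \<le> g x"
    using h(3) AE
  proof eventually_elim
    case (elim x)
    show ?case
    proof
      assume x: "x \<in> V"
      show "1 \<le> g x"
      proof (cases "x \<in> U")
        case True
        then have "1 \<le> squash (h x)" using elim(1) h(2) by (intro squash_ge_1) blast
        then show ?thesis using squash_nonneg[of "(1 / a) * f x"] by (simp add: g_def)
      next
        case False
        then have xW: "x \<in> W" "x \<in> T" using x U(2) by (auto simp: V_def)
        then have "a < f x" using in_T[OF xW(1) False] elim(2) by simp
        then have "1 \<le> squash ((1 / a) * f x)" using a by (intro squash_ge_1) (simp add: field_simps)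
        then show ?thesis using squash_nonneg[of "h x"] by (simp add: g_def)
      qed
    qed
  qed
  moreover have "\<forall>x. 0 \<le> g x" by (simp add: g_def squash_nonneg)
  ultimately show ?thesis using gW bound V sub by blast
qed

text \<open>The limit of the \<open>y n\<close> in \<open>W\<^sup>1\<^sup>,\<^sup>2\<close> is \<open>w\<close> almost everywhere. A fast subsequence converges to
  the quasicontinuous representative \<open>w\<close>, hence to 0 on \<open>K\<close>, outside a set of zero capacity,
  which is invisible to \<open>M\<close>.\<close>

lemma diffuse_integral_vanishes:
  fixes y :: "nat \<Rightarrow> 'a::euclidean_space \<Rightarrow> real"
  assumes "open W" "K \<in> sets borel" "K \<subseteq> W" and qc: "quasicontinuous W w" and wK: "\<And>x. x \<in> K \<Longrightarrow> w x = 0"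
    and M: "finite_measure M" "sets M = sets borel"
    and diff: "\<And>A. A \<in> sets borel \<Longrightarrow> A \<subseteq> K \<Longrightarrow> cap A = 0 \<Longrightarrow> emeasure M A = 0"
    and y: "\<And>n. continuous_on UNIV (y n)" "\<And>n x. 0 \<le> y n x" "\<And>n x. y n x \<le> c" "\<And>n. integrable lebesgue (y n)"
    and Y: "\<And>n. (y n, G n) \<in> W12"
    and Cau: "Cauchy_seq (\<lambda>m n. W12_dist (y m) (G m) (y n) (G n))"
    and w1: "integrable lebesgue w1" "AE x in lebesgue. x \<in> W \<longrightarrow> w1 x = w x"
    and L1: "(\<lambda>n. LINT x|lebesgue. \<bar>y n x - w1 x\<bar>) \<longlonglongrightarrow> 0"
    and e: "0 < e"
  shows "\<exists>n. (LINT x|M. indicator K x * y n x) < e"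
proof -
  interpret M: finite_measure M by fact
  obtain h H r where h: "(h, H) \<in> W12" "(\<lambda>n. W12_dist (y n) (G n) h H) \<longlonglongrightarrow> 0"
    "strict_mono (r :: nat \<Rightarrow> nat)" "AE x in lebesgue. (\<lambda>j. y (r j) x) \<longlonglongrightarrow> h x"
    by (rule W12_complete[OF Y Cau]) (rule that)
  have "\<exists>r'. strict_mono r' \<and> (AE x in lebesgue. (\<lambda>n. y (r (r' n)) x - w1 x) \<longlonglongrightarrow> 0)"
  proof (rule tendsto_L1_AE_subseq)
    show "integrable lebesgue (\<lambda>x. y (r n) x - w1 x)" for n using y(4) w1(1) by simp
    show "(\<lambda>n. LINT x|lebesgue. norm (y (r n) x - w1 x)) \<longlonglongrightarrow> 0"
      using LIMSEQ_subseq_LIMSEQ[OF L1 h(3)] by (simp add: o_def)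
  qed
  then obtain r' :: "nat \<Rightarrow> nat" where r': "strict_mono r'" "AE x in lebesgue. (\<lambda>n. y (r (r' n)) x - w1 x) \<longlonglongrightarrow> 0" by blast
  \<comment> \<open>the limits in \<open>W\<^sup>1\<^sup>,\<^sup>2\<close> and in \<open>L\<^sup>1\<close> agree\<close>
  have hw: "AE x in lebesgue. x \<in> W \<longrightarrow> h x = w x"
    using h(4) r'(2) w1(2)
  proof eventually_elim
    case (elim x)
    have "(\<lambda>n. y (r (r' n)) x) \<longlonglongrightarrow> h x" using LIMSEQ_subseq_LIMSEQ[OF elim(1) r'(1)] by (simp add: o_def)
    moreover have "(\<lambda>n. y (r (r' n)) x) \<longlonglongrightarrow> w1 x" using elim(2) by (simp add: LIM_zero_iff)
    ultimately show ?case using elim(3) LIMSEQ_unique by metis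
  qed
  \<comment> \<open>squared distance \<open>16\<^sup>-\<^sup>k\<close> against the threshold \<open>2\<^sup>-\<^sup>k\<close>, whose square is \<open>4\<^sup>-\<^sup>k\<close>, leaves capacities of order \<open>4\<^sup>-\<^sup>k\<close>\<close>
  have "\<exists>n. W12_dist (y n) (G n) h H < (1 / 16) ^ k" for k
    using order_tendstoD(2)[OF h(2), of "(1 / 16) ^ k"] by (auto simp: eventually_sequentially)
  then obtain m where m: "\<And>k. W12_dist (y (m k)) (G (m k)) h H < (1 / 16) ^ k" by metis
  define P where "P k g J V \<longleftrightarrow> (g, J) \<in> W12 \<and> (\<forall>x. 0 \<le> g x) \<and> open V \<and> {x\<in>W. (1 / 2) ^ k < y (m k) x - w x} \<subseteq> V
    \<and> (AE x in lebesgue. x \<in> V \<longrightarrow> 1 \<le> g x) \<and> W12_norm_sq g J \<le> 9 / 4 ^ k" for k g J V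
  have ex: "\<exists>p. P k (fst p) (fst (snd p)) (snd (snd p))" for k
  proof -
    have d: "(\<lambda>x. y (m k) x - h x, \<lambda>x. G (m k) x - H x) \<in> W12" by (rule W12_diff[OF Y h(1)])
    have AE: "AE x in lebesgue. x \<in> W \<longrightarrow> y (m k) x - h x = y (m k) x - w x"
      using hw by eventually_elim simp
    obtain g J V where g: "(g, J) \<in> W12 \<and> (\<forall>x. 0 \<le> g x) \<and> open V \<and> {x\<in>W. (1 / 2) ^ k < y (m k) x - w x} \<subseteq> V
      \<and> (AE x in lebesgue. x \<in> V \<longrightarrow> 1 \<le> g x)
      \<and> W12_norm_sq g J \<le> 8 * W12_dist (y (m k)) (G (m k)) h H / ((1 / 2) ^ k)\<^sup>2 + 1 / 4 ^ k"
      using cap_exceed[OF \<open>open W\<close> qc y(1) d AE, of "(1 / 2) ^ k" "1 / 4 ^ k"] by auto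
    have "8 * W12_dist (y (m k)) (G (m k)) h H / ((1 / 2) ^ k)\<^sup>2 + 1 / 4 ^ k \<le> 9 / 4 ^ k"
    proof -
      have four: "((1 / 2 :: real) ^ k)\<^sup>2 = (1 / 4) ^ k" by (simp add: power2_eq_square flip: power_mult_distrib)
      have "8 * W12_dist (y (m k)) (G (m k)) h H / (1 / 4) ^ k \<le> 8 * (1 / 16) ^ k / (1 / 4) ^ k"
        using m[of k] by (intro divide_right_mono) auto
      also have "\<dots> = 8 * ((1 / 16) / (1 / 4)) ^ k" unfolding power_divide[of "1 / 16"] by simp
      also have "\<dots> = 8 / 4 ^ k" by (simp add: power_one_over)
      finally show ?thesis unfolding four by simp
    qed
    then have "P k g J V" using g unfolding P_def by (auto intro: order_trans)
    then show ?thesis by (intro exI[of _ "(g, J, V)"]) simp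
  qed
  obtain p where p: "\<And>k. P k (fst (p k)) (fst (snd (p k))) (snd (snd (p k)))" using ex by metis
  define g where "g k = fst (p k)" for k
  define J where "J k = fst (snd (p k))" for k
  define V where "V k = snd (snd (p k))" for k
  have g: "\<And>k. (g k, J k) \<in> W12" "\<And>k x. 0 \<le> g k x" "\<And>k. open (V k)"
    "\<And>k. {x\<in>W. (1 / 2) ^ k < y (m k) x - w x} \<subseteq> V k" "\<And>k. AE x in lebesgue. x \<in> V k \<longrightarrow> 1 \<le> g k x"
    "\<And>k. W12_norm_sq (g k) (J k) \<le> 9 / 4 ^ k"
    using p unfolding P_def g_def J_def V_def by blast+
  define E where "E = (\<Inter>k. \<Union>i\<in>{k..}. V i)"
  have capE: "cap E = 0" unfolding E_def by (rule cap_limsup_zero[OF g(1,2,3,5,6)])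
  have "(\<Union>i\<in>{k..}. V i) \<in> sets borel" for k using g(3) by (intro borel_open open_UN) auto
  then have EB: "E \<in> sets borel" unfolding E_def by (intro sets.countable_INT) auto
  have "cap (E \<inter> K) = 0" using cap_mono[of "E \<inter> K" E] capE by simp
  then have null: "emeasure M (E \<inter> K) = 0" using EB assms(2) by (intro diff) auto
  have AE: "AE x in M. (\<lambda>k. indicator K x * y (m k) x) \<longlonglongrightarrow> 0"
  proof (rule AE_I[OF _ null])
    show "E \<inter> K \<in> sets M" using EB assms(2) M(2) by auto
    show "{x \<in> space M. \<not> (\<lambda>k. indicator K x * y (m k) x) \<longlonglongrightarrow> 0} \<subseteq> E \<inter> K"
    proof
      fix x assume x: "x \<in> {x \<in> space M. \<not> (\<lambda>k. indicator K x * y (m k) x) \<longlonglongrightarrow> 0}"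
      then have xK: "x \<in> K" by (cases "x \<in> K") auto
      have "x \<in> E"
      proof (rule ccontr)
        assume "x \<notin> E"
        then obtain k where k: "\<And>i. k \<le> i \<Longrightarrow> x \<notin> V i" by (auto simp: E_def)
        have "(\<lambda>i. y (m i) x) \<longlonglongrightarrow> 0"
        proof (rule tendsto_sandwich[OF _ _ tendsto_const])
          show "(\<lambda>i. (1 / 2 :: real) ^ i) \<longlonglongrightarrow> 0" by (rule LIMSEQ_power_zero) simp
          have "y (m i) x \<le> (1 / 2) ^ i" if "k \<le> i" for i
            using k[OF that] g(4)[of i] xK \<open>K \<subseteq> W\<close> wK[OF xK] by force
          then show "\<forall>\<^sub>F i in sequentially. y (m i) x \<le> (1 / 2) ^ i" by (auto simp: eventually_sequentially)
        qed (simp add: y(2))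
        then show False using x xK by simp
      qed
      then show "x \<in> E \<inter> K" using xK by simp
    qed
  qed
  have ym: "y n \<in> borel_measurable M" for n
    unfolding measurable_cong_sets[OF M(2) refl] by (rule borel_measurable_continuous_onI[OF y(1)])
  have indm: "(indicator K :: 'a \<Rightarrow> real) \<in> borel_measurable M" using assms(2) M(2) by (intro borel_measurable_indicator) simp
  have "(\<lambda>k. LINT x|M. indicator K x * y (m k) x) \<longlonglongrightarrow> (LINT x|M. 0)"
  proof (rule integral_dominated_convergence)
    show "integrable M (\<lambda>x. c)" by simp
    show "(\<lambda>x. indicator K x * y (m k) x) \<in> borel_measurable M" for k using ym indm by (intro borel_measurable_times)
    show "AE x in M. norm (indicator K x * y (m k) x) \<le> c" for k
    proof (rule AE_I2)
      show "norm (indicator K x * y (m k) x) \<le> c" for x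
        using y(2)[of "m k" x] y(3)[of "m k" x] by (auto simp: indicator_def)
    qed
  qed (use AE in auto)
  then have "(\<lambda>k. LINT x|M. indicator K x * y (m k) x) \<longlonglongrightarrow> 0" by simp
  from order_tendstoD(2)[OF this e] show ?thesis by (auto simp: eventually_sequentially)
qed

section \<open>The estimate for mollified functions\<close>

lemma test_continuous: "test \<psi> \<Longrightarrow> continuous_on S \<psi>"
  by (rule smooth_continuous[OF test_smooth])

text \<open>On \<open>t \<ge> 0\<close> this is a concave truncation with values below \<open>e\<close> and slope 1 at 0. Its slope is \<open>(1 - trunc e t / e)\<^sup>2\<close>, and its second derivative
  \<open>- 2 e\<^sup>2 / (e + t)\<^sup>3\<close> dominates the square of the slope up to a factor.\<close>

definition trunc :: "real \<Rightarrow> real \<Rightarrow> real" where "trunc e t = e * t / (e + t)"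

definition slope :: "real \<Rightarrow> real \<Rightarrow> real" where "slope e t = (e / (e + t))\<^sup>2"

lemma trunc_bounds: assumes "0 < e" "0 \<le> t" shows "0 \<le> trunc e t" "trunc e t \<le> e"
  using assms by (auto simp: trunc_def pos_divide_le_eq algebra_simps)

lemma trunc_deriv: assumes "0 < e" "0 \<le> t" shows "(trunc e has_real_derivative slope e t) (at t)"
proof -
  have "e + t \<noteq> 0" using assms by linarith
  then show ?thesis unfolding trunc_def[abs_def] slope_def
    by (auto intro!: derivative_eq_intros simp: field_simps power2_eq_square)
qed

lemma slope_deriv:
  assumes "0 < e" "0 \<le> t" shows "(slope e has_real_derivative - (2 * e\<^sup>2 / (e + t) ^ 3)) (at t)"
proof -
  define w where "w = e + t"
  have w: "w \<noteq> 0" using assms by (simp add: w_def)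
  have "((\<lambda>t. e / (e + t)) has_real_derivative - (e / w\<^sup>2)) (at t)"
    using w unfolding w_def by (auto intro!: derivative_eq_intros simp: power2_eq_square)
  from DERIV_power[OF this, of 2]
  have "((\<lambda>t. (e / (e + t))\<^sup>2) has_real_derivative 2 * (- (e / w\<^sup>2) * (e / w))) (at t)" by (simp add: w_def)
  moreover have "2 * (- (e / w\<^sup>2) * (e / w)) = - (2 * e\<^sup>2 / w ^ 3)"
    using w by (simp add: power2_eq_square power3_eq_cube)
  ultimately show ?thesis unfolding slope_def[abs_def] w_def by simp
qed

lemma slope_bounds: assumes "0 < e" "0 \<le> t" shows "0 \<le> slope e t" "slope e t \<le> 1"
proof -
  have "0 \<le> e / (e + t)" "e / (e + t) \<le> 1" using assms by auto
  then show "0 \<le> slope e t" "slope e t \<le> 1" unfolding slope_def by (simp_all add: power_le_one)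
qed

lemma slope_ge: assumes "0 < e" "0 \<le> t" shows "1 - 2 / e * trunc e t \<le> slope e t"
proof -
  have ne: "e + t \<noteq> 0" using assms by linarith
  define a where "a = t / (e + t)"
  have "trunc e t = e * a" by (simp add: trunc_def a_def)
  moreover have "e / (e + t) = 1 - a" using ne by (simp add: a_def field_simps)
  moreover have "1 - 2 * a \<le> (1 - a)\<^sup>2" by (simp add: power2_diff)
  ultimately show ?thesis using assms by (simp add: slope_def)
qed

lemma slope_sq_le: assumes "0 < e" "0 \<le> t" shows "(2 / e) * (slope e t)\<^sup>2 \<le> 2 * e\<^sup>2 / (e + t) ^ 3"
proof -
  have pos: "0 < e + t" using assms by linarith
  have "(2 / e) * (slope e t)\<^sup>2 = (2 * e\<^sup>2 / (e + t) ^ 3) * (e / (e + t))"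
    using assms pos by (simp add: slope_def field_simps power2_eq_square power3_eq_cube)
  also have "\<dots> \<le> (2 * e\<^sup>2 / (e + t) ^ 3) * 1"
    using assms pos by (intro mult_left_mono) auto
  finally show ?thesis by simp
qed

lemma trunc_lipschitz:
  assumes e: "0 < e" and st: "0 \<le> s" "0 \<le> t" shows "\<bar>trunc e s - trunc e t\<bar> \<le> \<bar>s - t\<bar>"
proof -
  have d: "trunc e s - trunc e t = (e / (e + s)) * (e / (e + t)) * (s - t)"
  proof -
    have "e + s \<noteq> 0" "e + t \<noteq> 0" using assms by linarith+
    then show ?thesis by (simp add: trunc_def field_simps)
  qed
  have b: "0 \<le> e / (e + s)" "e / (e + s) \<le> 1" "0 \<le> e / (e + t)" "e / (e + t) \<le> 1" using assms by auto
  have "(e / (e + s)) * (e / (e + t)) \<le> 1" "0 \<le> (e / (e + s)) * (e / (e + t))"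
    by (rule mult_le_one[OF b(2,3,4)]) (rule mult_nonneg_nonneg[OF b(1,3)])
  moreover have "\<bar>m * x\<bar> \<le> \<bar>x\<bar>" if "0 \<le> m" "m \<le> 1" for m x :: real
    using that by (simp add: abs_mult mult_left_le_one_le)
  ultimately show ?thesis unfolding d by blast
qed

text \<open>With \<open>v = trunc e u\<close>, two integrations by parts give
  \<open>\<integral> v \<Delta>\<phi> = \<integral> \<phi> (slope u) (p - q) - \<integral> \<phi> (2 e\<^sup>2 / (e + u)\<^sup>3) \<bar>\<nabla>u\<bar>\<^sup>2\<close>. In absolute value the left
  side is at most \<open>e \<integral> \<bar>\<Delta>\<phi>\<bar>\<close>, and the last term controls \<open>\<nabla>v\<close>.\<close>

lemma truncated_energy_estimate:
  fixes u p q \<phi> :: "'a::euclidean_space \<Rightarrow> real"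
  assumes e: "0 < e" and u0: "\<And>x. 0 \<le> u x" and cu: "continuous_on UNIV u"
    and D: "\<And>b. b \<in> Basis \<Longrightarrow> has_ddir b u (D b)" "\<And>b. b \<in> Basis \<Longrightarrow> continuous_on UNIV (D b)"
    and DD: "\<And>b. b \<in> Basis \<Longrightarrow> has_ddir b (D b) (DD b)" "\<And>b. b \<in> Basis \<Longrightarrow> continuous_on UNIV (DD b)"
    and \<phi>: "test \<phi>" and \<phi>0: "\<And>x. 0 \<le> \<phi> x"
    and p: "continuous_on UNIV p" "\<And>x. 0 \<le> p x" and q: "continuous_on UNIV q"
    and lap: "\<And>x. \<phi> x \<noteq> 0 \<Longrightarrow> (\<Sum>b\<in>Basis. DD b x) = p x - q x"
  shows "(LINT x|lborel. \<phi> x * slope e (u x) * q x) + (2 / e) * (\<Sum>b\<in>Basis. LINT x|lborel. \<phi> x * (slope e (u x) * D b x)\<^sup>2)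
    \<le> (LINT x|lborel. \<phi> x * p x) + e * (LINT x|lborel. \<bar>laplacian \<phi> x\<bar>)"
proof -
  obtain R where R: "\<forall>x. R < norm x \<longrightarrow> \<phi> x = 0" using test_support[OF \<phi>] ..
  have ne: "e + u x \<noteq> 0" for x using e u0[of x] by linarith
  define v where "v x = trunc e (u x)" for x
  define k where "k x = 2 * e\<^sup>2 / (e + u x) ^ 3" for x
  have c\<phi>: "continuous_on UNIV \<phi>" by (rule test_continuous[OF \<phi>])
  have cv: "continuous_on UNIV v" unfolding v_def trunc_def using ne cu by (intro continuous_intros) auto
  have cs: "continuous_on UNIV (\<lambda>x. slope e (u x))" unfolding slope_def using ne cu by (intro continuous_intros) auto
  have ck: "continuous_on UNIV k" unfolding k_def using ne cu by (intro continuous_intros) auto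
  have I: "integrable lborel (\<lambda>x. \<phi> x * g x)" if "continuous_on UNIV g" for g :: "'a \<Rightarrow> real"
    by (rule integrable_continuous_support[of _ R]) (use that c\<phi> R in \<open>auto intro: continuous_intros\<close>)
  have p\<phi>: "test (partial b \<phi>)" "test (partial b (partial b \<phi>))" if "b \<in> Basis" for b
    using test_partial[OF \<phi> that] test_partial[OF test_partial[OF \<phi> that] that] .
  have R': "\<forall>x. R < norm x \<longrightarrow> partial b \<phi> x = 0" for b
    using has_ddir_support[OF has_ddir_smooth[OF test_smooth[OF \<phi>]], of R] R by blast
  have R'': "\<forall>x. R < norm x \<longrightarrow> partial b (partial b \<phi>) x = 0" if "b \<in> Basis" for b
    using has_ddir_support[OF has_ddir_smooth[OF test_smooth[OF p\<phi>(1)[OF that]]], of R] R' by blast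
  have ibp: "(LINT x|lborel. v x * partial b (partial b \<phi>) x)
      = (LINT x|lborel. \<phi> x * (slope e (u x) * DD b x)) - (LINT x|lborel. \<phi> x * (k x * (D b x)\<^sup>2))" if b: "b \<in> Basis" for b
  proof -
    have dv: "has_ddir b v (\<lambda>x. slope e (u x) * D b x)"
      unfolding v_def[abs_def] by (rule has_ddir_chain[OF D(1)[OF b] trunc_deriv[OF e u0]])
    have ds: "has_ddir b (\<lambda>x. slope e (u x)) (\<lambda>x. - k x * D b x)"
      unfolding k_def[abs_def] by (rule has_ddir_chain[OF D(1)[OF b] slope_deriv[OF e u0]])
    have dd: "has_ddir b (\<lambda>x. slope e (u x) * D b x) (\<lambda>x. - k x * D b x * D b x + slope e (u x) * DD b x)"
      by (rule has_ddir_mult[OF ds DD(1)[OF b]])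
    have "(LINT x|lborel. v x * partial b (partial b \<phi>) x) = - (LINT x|lborel. slope e (u x) * D b x * partial b \<phi> x)"
      by (rule integral_by_parts[OF dv has_ddir_smooth[OF test_smooth[OF p\<phi>(1)[OF b]]], of R])
        (use cv cs D(2)[OF b] p\<phi>[OF b] R' in \<open>auto intro: test_continuous continuous_intros\<close>)
    also have "(LINT x|lborel. slope e (u x) * D b x * partial b \<phi> x)
        = - (LINT x|lborel. (- k x * D b x * D b x + slope e (u x) * DD b x) * \<phi> x)"
    proof (rule integral_by_parts[OF dd has_ddir_smooth[OF test_smooth[OF \<phi>]], of R])
      show "continuous_on UNIV (\<lambda>x. - k x * D b x * D b x + slope e (u x) * DD b x)"
        by (intro continuous_on_add continuous_on_mult continuous_on_minus ck D(2)[OF b] DD(2)[OF b] cs)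
      show "continuous_on UNIV (\<lambda>x. slope e (u x) * D b x)" by (intro continuous_on_mult D(2)[OF b] cs)
    qed (use p\<phi>[OF b] R c\<phi> in \<open>auto intro: test_continuous\<close>)
    also have "(LINT x|lborel. (- k x * D b x * D b x + slope e (u x) * DD b x) * \<phi> x)
      = (LINT x|lborel. \<phi> x * (slope e (u x) * DD b x) - \<phi> x * (k x * (D b x)\<^sup>2))"
      by (rule Bochner_Integration.integral_cong[OF refl]) (simp add: algebra_simps power2_eq_square)
    also have "\<dots> = (LINT x|lborel. \<phi> x * (slope e (u x) * DD b x)) - (LINT x|lborel. \<phi> x * (k x * (D b x)\<^sup>2))"
      by (intro Bochner_Integration.integral_diff I continuous_on_mult continuous_on_power ck D(2)[OF b] DD(2)[OF b] cs)
    finally show ?thesis by simp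
  qed
  have lapc: "continuous_on UNIV (laplacian \<phi>)" unfolding laplacian_def[abs_def]
    by (intro continuous_on_sum test_continuous p\<phi>)
  have lapR: "laplacian \<phi> x = 0" if "R < norm x" for x unfolding laplacian_def using R'' that by simp
  have lapi: "integrable lborel (laplacian \<phi>)" by (rule integrable_continuous_support[OF lapc lapR])
  have vi: "integrable lborel (\<lambda>x. v x * partial b (partial b \<phi>) x)" if "b \<in> Basis" for b
    by (rule integrable_continuous_support[of _ R])
      (use cv p\<phi>[OF that] R''[OF that] in \<open>auto intro: continuous_intros test_continuous\<close>)
  have iD: "integrable lborel (\<lambda>x. \<phi> x * (slope e (u x) * DD b x))" if "b \<in> Basis" for b
    by (intro I continuous_on_mult cs DD(2)[OF that])
  have ik: "integrable lborel (\<lambda>x. \<phi> x * (k x * (D b x)\<^sup>2))" if "b \<in> Basis" for b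
    by (intro I continuous_on_mult continuous_on_power ck D(2)[OF that])
  have iss: "integrable lborel (\<lambda>x. \<phi> x * (slope e (u x) * D b x)\<^sup>2)" if "b \<in> Basis" for b
    by (intro I continuous_on_mult continuous_on_power cs D(2)[OF that])
  have ip: "integrable lborel (\<lambda>x. \<phi> x * p x)" by (rule I[OF p(1)])
  have isp: "integrable lborel (\<lambda>x. \<phi> x * (slope e (u x) * p x))" by (intro I continuous_on_mult cs p(1))
  have isq: "integrable lborel (\<lambda>x. \<phi> x * (slope e (u x) * q x))" by (intro I continuous_on_mult cs q)
  have sumk: "(\<Sum>b\<in>Basis. LINT x|lborel. \<phi> x * (slope e (u x) * DD b x))
      = (LINT x|lborel. \<phi> x * (slope e (u x) * p x)) - (LINT x|lborel. \<phi> x * (slope e (u x) * q x))"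
  proof -
    have "(\<Sum>b\<in>Basis. LINT x|lborel. \<phi> x * (slope e (u x) * DD b x)) = (LINT x|lborel. (\<Sum>b\<in>Basis. \<phi> x * (slope e (u x) * DD b x)))"
      using iD by (intro Bochner_Integration.integral_sum[symmetric])
    also have "\<dots> = (LINT x|lborel. \<phi> x * (slope e (u x) * p x) - \<phi> x * (slope e (u x) * q x))"
    proof (rule Bochner_Integration.integral_cong[OF refl])
      fix x
      have "(\<Sum>b\<in>Basis. \<phi> x * (slope e (u x) * DD b x)) = \<phi> x * (slope e (u x) * (\<Sum>b\<in>Basis. DD b x))"
        by (simp add: sum_distrib_left)
      also have "\<dots> = \<phi> x * (slope e (u x) * p x) - \<phi> x * (slope e (u x) * q x)"
        using lap[of x] by (cases "\<phi> x = 0") (auto simp: right_diff_distrib)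
      finally show "(\<Sum>b\<in>Basis. \<phi> x * (slope e (u x) * DD b x)) = \<phi> x * (slope e (u x) * p x) - \<phi> x * (slope e (u x) * q x)" .
    qed
    also have "\<dots> = (LINT x|lborel. \<phi> x * (slope e (u x) * p x)) - (LINT x|lborel. \<phi> x * (slope e (u x) * q x))"
      by (rule Bochner_Integration.integral_diff[OF isp isq])
    finally show ?thesis .
  qed
  have "(LINT x|lborel. v x * laplacian \<phi> x) = (\<Sum>b\<in>Basis. LINT x|lborel. v x * partial b (partial b \<phi>) x)"
    unfolding laplacian_def sum_distrib_left using vi by (intro Bochner_Integration.integral_sum)
  also have "\<dots> = (LINT x|lborel. \<phi> x * (slope e (u x) * p x)) - (LINT x|lborel. \<phi> x * (slope e (u x) * q x))
      - (\<Sum>b\<in>Basis. LINT x|lborel. \<phi> x * (k x * (D b x)\<^sup>2))"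
    unfolding sumk[symmetric] sum_subtractf[symmetric] by (rule sum.cong[OF refl ibp])
  finally have main: "(LINT x|lborel. v x * laplacian \<phi> x) = (LINT x|lborel. \<phi> x * (slope e (u x) * p x))
      - (LINT x|lborel. \<phi> x * (slope e (u x) * q x)) - (\<Sum>b\<in>Basis. LINT x|lborel. \<phi> x * (k x * (D b x)\<^sup>2))" .
  have "- (e * (LINT x|lborel. \<bar>laplacian \<phi> x\<bar>)) \<le> (LINT x|lborel. v x * laplacian \<phi> x)"
  proof -
    have vb: "0 \<le> v x" "v x \<le> e" for x unfolding v_def using trunc_bounds[OF e u0] by auto
    have "integrable lborel (\<lambda>x. v x * laplacian \<phi> x)"
      by (rule integrable_bounded_mult[OF lapi, of _ e]) (use vb cv in \<open>auto intro: borel_measurable_continuous_onI\<close>)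
    then have "(LINT x|lborel. - (e * \<bar>laplacian \<phi> x\<bar>)) \<le> (LINT x|lborel. v x * laplacian \<phi> x)"
    proof (intro integral_mono)
      fix x
      have "\<bar>v x * laplacian \<phi> x\<bar> \<le> e * \<bar>laplacian \<phi> x\<bar>"
        unfolding abs_mult using vb by (intro mult_right_mono) auto
      then show "- (e * \<bar>laplacian \<phi> x\<bar>) \<le> v x * laplacian \<phi> x" by linarith
    qed (use lapi in auto)
    then show ?thesis by simp
  qed
  moreover have "(LINT x|lborel. \<phi> x * (slope e (u x) * p x)) \<le> (LINT x|lborel. \<phi> x * p x)"
  proof (rule integral_mono[OF isp ip])
    fix x
    have "slope e (u x) * p x \<le> 1 * p x" using slope_bounds[OF e u0] p(2) by (intro mult_right_mono) auto
    then show "\<phi> x * (slope e (u x) * p x) \<le> \<phi> x * p x" using \<phi>0 by (intro mult_left_mono) auto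
  qed
  moreover have "(2 / e) * (\<Sum>b\<in>Basis. LINT x|lborel. \<phi> x * (slope e (u x) * D b x)\<^sup>2)
      \<le> (\<Sum>b\<in>Basis. LINT x|lborel. \<phi> x * (k x * (D b x)\<^sup>2))"
    unfolding sum_distrib_left
  proof (rule sum_mono)
    fix b :: 'a assume b: "b \<in> Basis"
    have "(LINT x|lborel. (2 / e) * (\<phi> x * (slope e (u x) * D b x)\<^sup>2)) \<le> (LINT x|lborel. \<phi> x * (k x * (D b x)\<^sup>2))"
    proof (rule integral_mono)
      fix x
      have "(2 / e) * (slope e (u x))\<^sup>2 * (D b x)\<^sup>2 \<le> k x * (D b x)\<^sup>2"
        unfolding k_def using slope_sq_le[OF e u0] by (intro mult_right_mono) auto
      then have "\<phi> x * ((2 / e) * (slope e (u x))\<^sup>2 * (D b x)\<^sup>2) \<le> \<phi> x * (k x * (D b x)\<^sup>2)"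
        using \<phi>0 by (intro mult_left_mono) auto
      then show "(2 / e) * (\<phi> x * (slope e (u x) * D b x)\<^sup>2) \<le> \<phi> x * (k x * (D b x)\<^sup>2)"
        by (simp add: power_mult_distrib mult_ac)
    qed (use iss[OF b] ik[OF b] in auto)
    then show "2 / e * (LINT x|lborel. \<phi> x * (slope e (u x) * D b x)\<^sup>2) \<le> (LINT x|lborel. \<phi> x * (k x * (D b x)\<^sup>2))" by simp
  qed
  ultimately have "(LINT x|lborel. \<phi> x * (slope e (u x) * q x))
      + (2 / e) * (\<Sum>b\<in>Basis. LINT x|lborel. \<phi> x * (slope e (u x) * D b x)\<^sup>2)
    \<le> (LINT x|lborel. \<phi> x * p x) + e * (LINT x|lborel. \<bar>laplacian \<phi> x\<bar>)"
    using main by linarith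
  then show ?thesis by (simp add: mult.assoc)
qed

text \<open>The mollification of \<open>M\<close> tested with \<open>g\<close> is \<open>M\<close> tested with the mollification of \<open>g\<close>, since the
  mollifier is even.\<close>

lemma integral_conv_measure:
  fixes M :: "'a::euclidean_space measure" and g :: "'a \<Rightarrow> real"
  assumes M: "finite_measure M" "sets M = sets borel" and g: "g \<in> borel_measurable borel" "\<And>x. \<bar>g x\<bar> \<le> C"
    and gi: "integrable lborel g"
  shows "(LINT x|lborel. g x * conv M (moll n) (\<lambda>_. 1) x) = (LINT y|M. mollify n g y)"
    "integrable M (mollify n g)"
proof -
  interpret finite_measure M by fact
  have eq: "(LINT x|lborel. moll n (x - y) * g x) = mollify n g y" for y
    unfolding conv_def by (subst moll_minus) simp
  have sf: "sigma_finite_measure M" by unfold_locales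
  have i1: "integrable M (\<lambda>_. 1 :: real)" by simp
  note F = conv_Fubini[OF sf M(2) i1 moll_borel moll_integrable g, of n]
  show "(LINT x|lborel. g x * conv M (moll n) (\<lambda>_. 1) x) = (LINT y|M. mollify n g y)"
    using F(2) unfolding eq by (simp add: mult.commute)
  show "integrable M (mollify n g)" using F(3) by (simp add: eq)
qed

text \<open>The estimate for \<open>u = \<rho>\<^sub>n * ub\<close>, with the mollifications of \<open>P\<close> and \<open>Q\<close> in the place of \<open>p\<close> and \<open>q\<close>.
  Moving the mollifier onto the test function turns \<open>\<integral> \<phi> (slope u) q\<close> into an integral with respect to
  \<open>Q\<close>. On \<open>K\<close> its integrand is at least \<open>1/2 - (2 / e) z\<close>, because \<open>slope \<ge> 1 - (2 / e) trunc\<close> and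
  \<open>\<phi> \<ge> 1/2\<close> near \<open>K\<close>; elsewhere it is nonnegative. The gradient term of the estimate bounds \<open>z\<close> in
  \<open>W\<^sup>1\<^sup>,\<^sup>2\<close>, with a bound independent of \<open>n\<close>.\<close>

lemma mollified_estimate:
  fixes ub \<phi> :: "'a::euclidean_space \<Rightarrow> real"
  assumes e: "0 < e" and ub: "integrable lborel ub" "\<And>x. 0 \<le> ub x"
    and P: "finite_measure P" "sets P = sets borel" and Q: "finite_measure Q" "sets Q = sets borel"
    and \<phi>: "test \<phi>" "\<And>x. 0 \<le> \<phi> x" "\<And>x. \<phi> x \<le> 1"
    and K: "K \<in> sets borel" "\<And>x y. x \<in> K \<Longrightarrow> dist x y < 1 / real (Suc n) \<Longrightarrow> 1 / 2 \<le> \<phi> y"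
    and lap: "\<And>x. \<phi> x \<noteq> 0 \<Longrightarrow> (\<Sum>b\<in>Basis. conv lborel (partial b (partial b (moll n))) ub x)
        = conv P (moll n) (\<lambda>_. 1) x - conv Q (moll n) (\<lambda>_. 1) x"
  defines "z \<equiv> mollify n (\<lambda>x. \<phi> x * trunc e (mollify n ub x))"
  shows "\<exists>G. (z, G) \<in> W12 \<and> W12_norm_sq z G \<le> e\<^sup>2 * (LINT x|lborel. (\<phi> x)\<^sup>2)
      + e * (measure P UNIV + e * (LINT x|lborel. \<bar>laplacian \<phi> x\<bar>)) + 2 * e\<^sup>2 * (\<Sum>b\<in>Basis. LINT x|lborel. (partial b \<phi> x)\<^sup>2)"
    and "measure Q K / 2 \<le> measure P UNIV + e * (LINT x|lborel. \<bar>laplacian \<phi> x\<bar>) + (2 / e) * (LINT x|Q. indicator K x * z x)"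
    and "continuous_on UNIV z" "\<And>x. 0 \<le> z x" "\<And>x. z x \<le> e" "integrable lborel z"
proof -
  interpret P: finite_measure P by fact
  interpret Q: finite_measure Q by fact
  define u where "u = mollify n ub"
  define D where "D b = conv lborel (partial b (moll n)) ub" for b
  define DD where "DD b = conv lborel (partial b (partial b (moll n))) ub" for b
  define p where "p = conv P (moll n) (\<lambda>_. 1)"
  define q where "q = conv Q (moll n) (\<lambda>_. 1)"
  define v where "v x = trunc e (u x)" for x
  define g where "g x = \<phi> x * v x" for x
  have z: "z = mollify n g" unfolding z_def g_def v_def u_def ..
  have tm: "test (moll n :: 'a \<Rightarrow> real)" by (rule test_moll)
  have tp: "test (partial b (moll n))" if "b \<in> Basis" for b :: 'a by (rule test_partial[OF tm that])
  have tpp: "test (partial b (partial b (moll n)))" if "b \<in> Basis" for b :: 'a by (rule test_partial[OF tp[OF that] that])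
  have sl: "sets (lborel :: 'a measure) = sets borel" by simp
  have u0: "0 \<le> u x" for x unfolding u_def by (rule conv_moll_nonneg[OF ub(2)])
  have cu: "continuous_on UNIV u" unfolding u_def by (rule conv_continuous[OF sl ub(1) tm])
  have Dd: "has_ddir b u (D b)" "continuous_on UNIV (D b)" "has_ddir b (D b) (DD b)" "continuous_on UNIV (DD b)" if "b \<in> Basis" for b
    unfolding u_def D_def DD_def
    using conv_has_ddir[OF sl ub(1) tm that] conv_continuous[OF sl ub(1) tp[OF that]]
      conv_has_ddir[OF sl ub(1) tp[OF that] that] conv_continuous[OF sl ub(1) tpp[OF that]] by auto
  have ic: "integrable P (\<lambda>_. 1 :: real)" "integrable Q (\<lambda>_. 1 :: real)" by simp_all
  have cp: "continuous_on UNIV p" and cq: "continuous_on UNIV q"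
    unfolding p_def q_def using conv_continuous[OF P(2) ic(1) tm] conv_continuous[OF Q(2) ic(2) tm] by auto
  have p0: "0 \<le> p x" and q0: "0 \<le> q x" for x unfolding p_def q_def by (rule conv_moll_nonneg; simp)+
  have lap': "(\<Sum>b\<in>Basis. DD b x) = p x - q x" if "\<phi> x \<noteq> 0" for x
    unfolding DD_def p_def q_def by (rule lap[OF that])
  define T where "T = (\<Sum>b\<in>Basis. LINT x|lborel. \<phi> x * (slope e (u x) * D b x)\<^sup>2)"
  define J where "J = (LINT x|lborel. \<phi> x * slope e (u x) * q x)"
  define \<Lambda> where "\<Lambda> = (LINT x|lborel. \<bar>laplacian \<phi> x\<bar>)"
  have est: "J + (2 / e) * T \<le> (LINT x|lborel. \<phi> x * p x) + e * \<Lambda>"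
    unfolding T_def J_def \<Lambda>_def
    by (rule truncated_energy_estimate[where DD = DD]) (use e u0 cu Dd \<phi> cp p0 cq lap' in auto)
  have \<phi>m: "\<phi> \<in> borel_measurable borel" by (rule smooth_borel[OF test_smooth[OF \<phi>(1)]])
  have \<phi>i: "integrable lborel \<phi>" by (rule test_integrable[OF \<phi>(1)])
  have \<phi>abs: "\<bar>\<phi> x\<bar> \<le> 1" for x using \<phi>(2,3)[of x] by simp
  have est_p: "(LINT x|lborel. \<phi> x * p x) \<le> measure P UNIV"
  proof -
    note F = integral_conv_measure[OF P \<phi>m \<phi>abs \<phi>i, of n]
    have "(LINT y|P. mollify n \<phi> y) \<le> (LINT y|P. 1)"
      using F(2) conv_moll_bounds(2)[OF \<phi>i, of _ n 0 1] \<phi>(2,3) by (intro integral_mono) auto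
    moreover have "space P = UNIV" using sets_eq_imp_space_eq[OF P(2)] by simp
    ultimately show ?thesis using F(1) by (simp add: p_def)
  qed
  obtain R where R: "\<forall>x. R < norm x \<longrightarrow> \<phi> x = 0" using test_support[OF \<phi>(1)] ..
  have ne: "e + u x \<noteq> 0" for x using e u0[of x] by linarith
  have cv: "continuous_on UNIV v" unfolding v_def trunc_def using ne cu by (intro continuous_intros) auto
  have cs: "continuous_on UNIV (\<lambda>x. slope e (u x))" unfolding slope_def using ne cu by (intro continuous_intros) auto
  have c\<phi>: "continuous_on UNIV \<phi>" by (rule test_continuous[OF \<phi>(1)])
  have cg: "continuous_on UNIV g" unfolding g_def by (intro continuous_on_mult c\<phi> cv)
  have gR: "g x = 0" if "R < norm x" for x using R that by (simp add: g_def)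
  have gi: "integrable lborel g" by (rule integrable_continuous_support[OF cg gR])
  have vb: "0 \<le> v x" "v x \<le> e" for x unfolding v_def using trunc_bounds[OF e u0] by auto
  have gb: "0 \<le> g x" "g x \<le> e" for x
  proof -
    show "0 \<le> g x" unfolding g_def using vb \<phi> by simp
    have "\<phi> x * v x \<le> 1 * e" using vb \<phi> e by (intro mult_mono) auto
    then show "g x \<le> e" by (simp add: g_def)
  qed
  show "continuous_on UNIV z" unfolding z by (rule conv_continuous[OF sl gi tm])
  show z0: "0 \<le> z x" for x unfolding z by (rule conv_moll_nonneg[OF gb(1)])
  show ze: "z x \<le> e" for x unfolding z by (rule conv_moll_bounds(2)[OF gi, of x n 0]) (use gb in auto)
  show zi: "integrable lborel z" unfolding z by (rule integral_conv_moll(1)[OF gi])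
  define g' where "g' b x = partial b \<phi> x * v x + \<phi> x * (slope e (u x) * D b x)" for b x
  have cp\<phi>: "continuous_on UNIV (partial b \<phi>)" if "b \<in> Basis" for b by (rule test_continuous[OF test_partial[OF \<phi>(1) that]])
  have dg: "has_ddir b g (g' b)" "continuous_on UNIV (g' b)" if b: "b \<in> Basis" for b
  proof -
    have "has_ddir b v (\<lambda>x. slope e (u x) * D b x)"
      unfolding v_def[abs_def] by (rule has_ddir_chain[OF Dd(1)[OF b] trunc_deriv[OF e u0]])
    then show "has_ddir b g (g' b)" unfolding g_def[abs_def] g'_def[abs_def]
      by (rule has_ddir_mult[OF has_ddir_smooth[OF test_smooth[OF \<phi>(1)]]])
    show "continuous_on UNIV (g' b)" unfolding g'_def[abs_def]
      by (intro continuous_on_add continuous_on_mult c\<phi> cv cs Dd(2)[OF b] cp\<phi>[OF b])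
  qed
  have g'R: "g' b x = 0" if "b \<in> Basis" "R < norm x" for b x by (rule has_ddir_support[OF dg(1)[OF that(1)] gR that(2)])
  have sq: "integrable lborel (\<lambda>x. (h x)\<^sup>2)" if "continuous_on UNIV h" "\<And>x. R < norm x \<Longrightarrow> h x = 0" for h :: "'a \<Rightarrow> real"
    by (rule integrable_continuous_support[of _ R]) (use that in \<open>auto intro: continuous_on_power\<close>)
  have g'i: "integrable lborel (g' b)" if "b \<in> Basis" for b by (rule integrable_continuous_support[OF dg(2)[OF that] g'R[OF that]])
  define Z where "Z b = mollify n (g' b)" for b
  have Zd: "has_ddir b z (Z b)" if b: "b \<in> Basis" for b
  proof -
    have "conv lborel (partial b (moll n)) g = Z b"
      unfolding Z_def by (rule conv_partial[OF test_smooth[OF tm] b dg(1)[OF b] cg dg(2)[OF b] gR])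
    then show ?thesis using conv_has_ddir[OF sl gi tm b] unfolding z by simp
  qed
  have Zc: "continuous_on UNIV (Z b)" if "b \<in> Basis" for b unfolding Z_def by (rule conv_continuous[OF sl g'i[OF that] tm])
  have zR: "z x = 0" if "R + 1 < norm x" for x
    unfolding z
  proof (rule conv_moll_zero)
    fix y assume y: "dist x y < 1 / real (Suc n)"
    have "1 / real (Suc n) \<le> 1" by simp
    moreover have "norm x \<le> norm y + dist x y" using norm_triangle_ineq2[of x y] by (simp add: dist_norm)
    ultimately show "g y = 0" using that y by (intro gR) linarith
  qed
  define G where "G x = (\<Sum>b\<in>Basis. Z b x *\<^sub>R b)" for x
  have zG: "(z, G) \<in> W12" unfolding G_def[abs_def] by (rule W12_classical(1)[OF Zd conv_continuous[OF sl gi tm, folded z] Zc zR])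
  have N: "W12_norm_sq z G = (LINT x|lborel. (z x)\<^sup>2) + (\<Sum>b\<in>Basis. LINT x|lborel. (Z b x)\<^sup>2)"
    unfolding G_def[abs_def] by (rule W12_classical(2)[OF Zd conv_continuous[OF sl gi tm, folded z] Zc zR])
  have "(LINT x|lborel. (z x)\<^sup>2) \<le> (LINT x|lborel. (g x)\<^sup>2)" unfolding z by (rule conv_moll_L2(2)[OF gi sq[OF cg gR]])
  also have "\<dots> \<le> (LINT x|lborel. e\<^sup>2 * (\<phi> x)\<^sup>2)"
  proof (rule integral_mono)
    show "(g x)\<^sup>2 \<le> e\<^sup>2 * (\<phi> x)\<^sup>2" for x
    proof -
      have "(v x)\<^sup>2 \<le> e\<^sup>2" using vb by (intro power_mono) auto
      then have "(v x)\<^sup>2 * (\<phi> x)\<^sup>2 \<le> e\<^sup>2 * (\<phi> x)\<^sup>2" by (rule mult_right_mono) simp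
      then show ?thesis by (simp add: g_def power_mult_distrib mult.commute)
    qed
  qed (use sq[OF cg gR] sq[OF c\<phi>] R in auto)
  finally have N1: "(LINT x|lborel. (z x)\<^sup>2) \<le> e\<^sup>2 * (LINT x|lborel. (\<phi> x)\<^sup>2)" by simp
  have R': "partial b \<phi> x = 0" if "R < norm x" for b x
    using has_ddir_support[OF has_ddir_smooth[OF test_smooth[OF \<phi>(1)]] _ that] R by blast
  have iT: "integrable lborel (\<lambda>x. \<phi> x * (slope e (u x) * D b x)\<^sup>2)" if "b \<in> Basis" for b
    by (rule integrable_continuous_support[of _ R])
      (use R in \<open>auto intro!: continuous_on_mult continuous_on_power c\<phi> cs Dd(2)[OF that]\<close>)
  have ip: "integrable lborel (\<lambda>x. (partial b \<phi> x)\<^sup>2)" if "b \<in> Basis" for b by (rule sq[OF cp\<phi>[OF that] R'])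
  have N2: "(LINT x|lborel. (Z b x)\<^sup>2) \<le> 2 * (LINT x|lborel. \<phi> x * (slope e (u x) * D b x)\<^sup>2) + 2 * e\<^sup>2 * (LINT x|lborel. (partial b \<phi> x)\<^sup>2)"
    if b: "b \<in> Basis" for b
  proof -
    have "(LINT x|lborel. (Z b x)\<^sup>2) \<le> (LINT x|lborel. (g' b x)\<^sup>2)"
      unfolding Z_def by (rule conv_moll_L2(2)[OF g'i[OF b] sq[OF dg(2)[OF b] g'R[OF b]]])
    also have "\<dots> \<le> (LINT x|lborel. 2 * (\<phi> x * (slope e (u x) * D b x)\<^sup>2) + 2 * e\<^sup>2 * (partial b \<phi> x)\<^sup>2)"
    proof (rule integral_mono)
      fix x
      define s where "s = slope e (u x) * D b x"
      have "(g' b x)\<^sup>2 \<le> 2 * (partial b \<phi> x * v x)\<^sup>2 + 2 * (\<phi> x * s)\<^sup>2"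
        using norm_sq_sum_le[of "partial b \<phi> x * v x" "\<phi> x * s"] by (simp add: g'_def s_def)
      moreover have "(partial b \<phi> x * v x)\<^sup>2 \<le> e\<^sup>2 * (partial b \<phi> x)\<^sup>2"
      proof -
        have "(v x)\<^sup>2 \<le> e\<^sup>2" using vb by (intro power_mono) auto
        then have "(v x)\<^sup>2 * (partial b \<phi> x)\<^sup>2 \<le> e\<^sup>2 * (partial b \<phi> x)\<^sup>2" by (rule mult_right_mono) simp
        then show ?thesis by (simp add: power_mult_distrib mult.commute)
      qed
      moreover have "(\<phi> x * s)\<^sup>2 \<le> \<phi> x * s\<^sup>2"
      proof -
        have "\<phi> x * \<phi> x \<le> \<phi> x * 1" by (rule mult_left_mono[OF \<phi>(3) \<phi>(2)])
        then have "(\<phi> x)\<^sup>2 \<le> \<phi> x" by (simp add: power2_eq_square)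
        then show ?thesis unfolding power_mult_distrib by (rule mult_right_mono) simp
      qed
      ultimately show "(g' b x)\<^sup>2 \<le> 2 * (\<phi> x * (slope e (u x) * D b x)\<^sup>2) + 2 * e\<^sup>2 * (partial b \<phi> x)\<^sup>2"
        unfolding s_def by linarith
    qed (use sq[OF dg(2)[OF b] g'R[OF b]] iT[OF b] ip[OF b] in auto)
    also have "\<dots> = 2 * (LINT x|lborel. \<phi> x * (slope e (u x) * D b x)\<^sup>2) + 2 * e\<^sup>2 * (LINT x|lborel. (partial b \<phi> x)\<^sup>2)"
      using iT[OF b] ip[OF b] by simp
    finally show ?thesis .
  qed
  have "(\<Sum>b\<in>Basis. LINT x|lborel. (Z b x)\<^sup>2) \<le> (\<Sum>b\<in>Basis. 2 * (LINT x|lborel. \<phi> x * (slope e (u x) * D b x)\<^sup>2) + 2 * e\<^sup>2 * (LINT x|lborel. (partial b \<phi> x)\<^sup>2))"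
    by (rule sum_mono[OF N2])
  also have "\<dots> = 2 * T + 2 * e\<^sup>2 * (\<Sum>b\<in>Basis. LINT x|lborel. (partial b \<phi> x)\<^sup>2)"
    by (simp add: T_def sum.distrib sum_distrib_left)
  finally have N3: "(\<Sum>b\<in>Basis. LINT x|lborel. (Z b x)\<^sup>2) \<le> 2 * T + 2 * e\<^sup>2 * (\<Sum>b\<in>Basis. LINT x|lborel. (partial b \<phi> x)\<^sup>2)" .
  have q\<phi>: "0 \<le> \<phi> x * slope e (u x) * q x" for x
    using \<phi>(2) slope_bounds(1)[OF e u0] q0 by (intro mult_nonneg_nonneg) auto
  have J0: "0 \<le> J" unfolding J_def using q\<phi> by (intro integral_nonneg_AE) auto
  have "(2 / e) * T \<le> measure P UNIV + e * \<Lambda>" using est est_p J0 by linarith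
  then have "e * ((2 / e) * T) \<le> e * (measure P UNIV + e * \<Lambda>)" using e by (intro mult_left_mono) auto
  then have T2: "2 * T \<le> e * (measure P UNIV + e * \<Lambda>)" using e by simp
  have "W12_norm_sq z G \<le> e\<^sup>2 * (LINT x|lborel. (\<phi> x)\<^sup>2) + e * (measure P UNIV + e * \<Lambda>) + 2 * e\<^sup>2 * (\<Sum>b\<in>Basis. LINT x|lborel. (partial b \<phi> x)\<^sup>2)"
    unfolding N using N1 N3 T2 by linarith
  with zG show "\<exists>G. (z, G) \<in> W12 \<and> W12_norm_sq z G \<le> e\<^sup>2 * (LINT x|lborel. (\<phi> x)\<^sup>2)
      + e * (measure P UNIV + e * (LINT x|lborel. \<bar>laplacian \<phi> x\<bar>)) + 2 * e\<^sup>2 * (\<Sum>b\<in>Basis. LINT x|lborel. (partial b \<phi> x)\<^sup>2)"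
    unfolding \<Lambda>_def by blast
  have T0: "0 \<le> T" unfolding T_def using \<phi>(2) by (intro sum_nonneg integral_nonneg_AE) auto
  define s where "s x = \<phi> x * slope e (u x)" for x
  have cs': "continuous_on UNIV s" unfolding s_def by (intro continuous_on_mult c\<phi> cs)
  have sR: "s x = 0" if "R < norm x" for x using R that by (simp add: s_def)
  have si: "integrable lborel s" by (rule integrable_continuous_support[OF cs' sR])
  have sb: "0 \<le> s x" "s x \<le> 1" for x
  proof -
    show "0 \<le> s x" unfolding s_def using \<phi>(2) slope_bounds(1)[OF e u0] by simp
    have "\<phi> x * slope e (u x) \<le> 1 * 1" using \<phi> slope_bounds[OF e u0] by (intro mult_mono) auto
    then show "s x \<le> 1" by (simp add: s_def)
  qed
  have sm: "s \<in> borel_measurable borel" by (rule borel_measurable_continuous_onI[OF cs'])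
  have sabs: "\<bar>s x\<bar> \<le> 1" for x using sb[of x] by simp
  note FQ = integral_conv_measure[OF Q sm sabs si, of n]
  have Jeq: "J = (LINT y|Q. mollify n s y)" using FQ(1) by (simp add: J_def s_def q_def)
  have KQ: "K \<in> sets Q" using K(1) Q(2) by simp
  have low: "1 / 2 - (2 / e) * z y \<le> mollify n s y" if y: "y \<in> K" for y
  proof -
    have half: "1 / 2 \<le> mollify n \<phi> y"
      by (rule conv_moll_bounds(1)[OF \<phi>i, of y n "1 / 2" 1]) (use K(2)[OF y] \<phi>(3) in auto)
    have gi': "integrable lborel (\<lambda>x. (2 / e) * g x)" using gi by simp
    have d: "integrable lborel (\<lambda>x. \<phi> x - (2 / e) * g x)" using \<phi>i gi' by simp
    have "mollify n (\<lambda>x. \<phi> x - (2 / e) * g x) y \<le> mollify n s y"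
      unfolding conv_def
    proof (rule integral_mono)
      show "integrable lborel (\<lambda>x. moll n (y - x) * (\<phi> x - (2 / e) * g x))" by (rule conv_integrable[OF sl d tm])
      show "integrable lborel (\<lambda>x. moll n (y - x) * s x)" by (rule conv_integrable[OF sl si tm])
      fix x
      have "\<phi> x * (1 - 2 / e * v x) \<le> \<phi> x * slope e (u x)"
        unfolding v_def by (rule mult_left_mono[OF slope_ge[OF e u0] \<phi>(2)])
      then have "\<phi> x - (2 / e) * g x \<le> s x" by (simp add: s_def g_def algebra_simps)
      then show "moll n (y - x) * (\<phi> x - (2 / e) * g x) \<le> moll n (y - x) * s x" by (rule mult_left_mono[OF _ moll_nonneg])
    qed
    moreover have "mollify n (\<lambda>x. \<phi> x - (2 / e) * g x) y = mollify n \<phi> y - mollify n (\<lambda>x. (2 / e) * g x) y"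
      by (rule conv_diff[OF sl \<phi>i gi' tm])
    moreover have "mollify n (\<lambda>x. (2 / e) * g x) y = (2 / e) * z y"
      unfolding z conv_def by (subst integral_mult_right_zero[symmetric]) (simp add: mult_ac)
    ultimately show ?thesis using half by linarith
  qed
  have zQ: "z \<in> borel_measurable Q" unfolding measurable_cong_sets[OF Q(2) refl]
    using conv_moll_borel[OF gi, of n] by (simp add: z)
  have izQ: "integrable Q (\<lambda>x. indicator K x * z x)"
  proof (rule Q.integrable_const_bound)
    show "AE x in Q. norm (indicator K x * z x) \<le> e" using z0 ze e by (auto simp: indicator_def)
    show "(\<lambda>x. indicator K x * z x) \<in> borel_measurable Q" using zQ KQ by (intro borel_measurable_times borel_measurable_indicator)
  qed
  have iKQ: "integrable Q (indicator K :: 'a \<Rightarrow> real)" using KQ by (intro Q.integrable_const_bound[where B = 1]) (auto simp: indicator_def)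
  have "measure Q K / 2 - (2 / e) * (LINT x|Q. indicator K x * z x)
      = (LINT x|Q. indicator K x * (1 / 2) - (2 / e) * (indicator K x * z x))"
  proof -
    have "(LINT x|Q. indicator K x * (1 / 2) - (2 / e) * (indicator K x * z x))
      = (LINT x|Q. indicator K x * (1 / 2)) - (LINT x|Q. (2 / e) * (indicator K x * z x))"
      using iKQ izQ by (intro Bochner_Integration.integral_diff) auto
    moreover have "(LINT x|Q. indicator K x) = measure Q K" using KQ by simp
    ultimately show ?thesis by simp
  qed
  also have "\<dots> \<le> (LINT y|Q. mollify n s y)"
  proof (rule integral_mono)
    show "integrable Q (\<lambda>x. indicator K x * (1 / 2) - (2 / e) * (indicator K x * z x))" using iKQ izQ by simp
    show "integrable Q (mollify n s)" by (rule FQ(2))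
    show "indicator K x * (1 / 2) - (2 / e) * (indicator K x * z x) \<le> mollify n s x" for x
      using low[of x] conv_moll_nonneg[of s lborel n x] sb(1) by (cases "x \<in> K") auto
  qed
  finally have "measure Q K / 2 - (2 / e) * (LINT x|Q. indicator K x * z x) \<le> J" by (simp add: Jeq)
  moreover have "0 \<le> (2 / e) * T" using T0 e by simp
  ultimately show "measure Q K / 2 \<le> measure P UNIV + e * (LINT x|lborel. \<bar>laplacian \<phi> x\<bar>) + (2 / e) * (LINT x|Q. indicator K x * z x)"
    using est est_p unfolding \<Lambda>_def by linarith
qed

section \<open>Passing to the limit in the mollification\<close>

lemma trunc_borel: "trunc e \<in> borel_measurable borel"
proof -
  have "(\<lambda>t. e * t / (e + t)) \<in> borel_measurable (borel :: real measure)" by measurable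
  then show ?thesis by (simp add: trunc_def[abs_def])
qed

text \<open>Mollification is a contraction of \<open>L\<^sup>1\<close> that converges to the identity, and the truncation is
  1-Lipschitz.\<close>

lemma truncated_mollification_converges:
  fixes ub \<phi> :: "'a::euclidean_space \<Rightarrow> real"
  assumes e: "0 < e" and ub: "integrable lborel ub" "\<And>x. 0 \<le> ub x"
    and \<phi>: "test \<phi>" "\<And>x. 0 \<le> \<phi> x" "\<And>x. \<phi> x \<le> 1"
  shows "integrable lborel (\<lambda>x. \<phi> x * trunc e (ub x))"
    and "(\<lambda>n. LINT x|lborel. \<bar>mollify n (\<lambda>x. \<phi> x * trunc e (mollify n ub x)) x
      - \<phi> x * trunc e (ub x)\<bar>) \<longlonglongrightarrow> 0"
proof -
  have \<phi>m: "\<phi> \<in> borel_measurable borel" by (rule smooth_borel[OF test_smooth[OF \<phi>(1)]])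
  have i: "integrable lborel (\<lambda>x. \<phi> x * trunc e (h x))" if "integrable lborel h" "\<And>x. 0 \<le> h x" for h
  proof -
    have "(\<lambda>x. trunc e (h x)) \<in> borel_measurable lborel"
      by (rule measurable_compose[OF _ trunc_borel]) (use that in auto)
    then have "integrable lborel (\<lambda>x. trunc e (h x) * \<phi> x)"
      by (intro integrable_bounded_mult[OF test_integrable[OF \<phi>(1)], of _ e]) (use trunc_bounds[OF e that(2)] in auto)
    then show ?thesis by (simp add: mult.commute)
  qed
  define u where "u n = mollify n ub" for n
  define w where "w x = \<phi> x * trunc e (ub x)" for x
  define g where "g n x = \<phi> x * trunc e (u n x)" for n x
  have ui: "integrable lborel (u n)" and u0: "0 \<le> u n x" for n x
    unfolding u_def by (rule integral_conv_moll(1)[OF ub(1)], rule conv_moll_nonneg[OF ub(2)])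
  have wi: "integrable lborel w" unfolding w_def by (rule i[OF ub])
  then show "integrable lborel (\<lambda>x. \<phi> x * trunc e (ub x))" by (simp add: w_def[abs_def])
  have gi: "integrable lborel (g n)" for n unfolding g_def by (rule i[OF ui u0])
  have "(\<lambda>n. L1_dist (mollify n (g n)) w) \<longlonglongrightarrow> 0"
  proof (rule tendsto_sandwich[OF _ _ tendsto_const])
    have "(\<lambda>n. (L1_dist (u n) ub) + (L1_dist (mollify n w) w)) \<longlonglongrightarrow> 0 + 0"
      unfolding u_def by (intro tendsto_add conv_moll_converges_L1 ub(1) wi)
    then show "(\<lambda>n. (L1_dist (u n) ub) + (L1_dist (mollify n w) w)) \<longlonglongrightarrow> 0" by simp
    have "(L1_dist (mollify n (g n)) w)
        \<le> (L1_dist (u n) ub) + (L1_dist (mollify n w) w)" for n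
    proof -
      have d: "integrable lborel (\<lambda>x. g n x - w x)" using gi wi by simp
      note c = integral_conv_moll(1)[OF gi[of n], of n] integral_conv_moll(1)[OF wi, of n] integral_conv_moll(1)[OF d, of n]
      have cd: "mollify n (\<lambda>x. g n x - w x) x = mollify n (g n) x - mollify n w x" for x
        by (rule conv_diff[OF _ gi wi test_moll]) simp
      have "(L1_dist (mollify n (g n)) w)
        \<le> (LINT x|lborel. \<bar>mollify n (\<lambda>x. g n x - w x) x\<bar> + \<bar>mollify n w x - w x\<bar>)"
        by (rule integral_mono) (use c wi cd in auto)
      also have "\<dots> = (LINT x|lborel. \<bar>mollify n (\<lambda>x. g n x - w x) x\<bar>) + (L1_dist (mollify n w) w)"
        by (rule Bochner_Integration.integral_add) (use c wi in auto)
      also have "(LINT x|lborel. \<bar>mollify n (\<lambda>x. g n x - w x) x\<bar>) \<le> (L1_dist (g n) w)"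
        by (rule conv_moll_L1[OF d])
      also have "(L1_dist (g n) w) \<le> (L1_dist (u n) ub)"
      proof (rule integral_mono)
        fix x
        have "\<bar>\<phi> x\<bar> * \<bar>trunc e (u n x) - trunc e (ub x)\<bar> \<le> 1 * \<bar>u n x - ub x\<bar>"
          by (rule mult_mono) (use \<phi> trunc_lipschitz[OF e u0 ub(2)] in auto)
        then show "\<bar>g n x - w x\<bar> \<le> \<bar>u n x - ub x\<bar>"
          unfolding g_def w_def right_diff_distrib[symmetric] abs_mult by simp
      qed (use d ui ub(1) in auto)
      finally show ?thesis by simp
    qed
    then show "\<forall>\<^sub>F n in sequentially. (L1_dist (mollify n (g n)) w)
      \<le> (L1_dist (u n) ub) + (L1_dist (mollify n w) w)" by simp
  qed (auto intro!: integral_nonneg_AE)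
  then show "(\<lambda>n. LINT x|lborel. \<bar>mollify n (\<lambda>x. \<phi> x * trunc e (mollify n ub x)) x
      - \<phi> x * trunc e (ub x)\<bar>) \<longlonglongrightarrow> 0"
    by (simp add: g_def[abs_def] w_def[abs_def] u_def)
qed

text \<open>If \<open>\<integral>\<^sub>K z\<^sub>n dQ \<ge> c\<close> for all large \<open>n\<close>, then the functions with this property that are bounded in
  \<open>W\<^sup>1\<^sup>,\<^sup>2\<close> like the \<open>z\<^sub>n\<close> and close to \<open>\<phi> trunc(ub)\<close> in \<open>L\<^sup>1\<close> form nonempty convex sets, decreasing as
  the distance shrinks. Their elements of almost minimal norm converge strongly, and then the
  integrals over \<open>K\<close> tend to 0.\<close>

lemma limit_estimate:
  fixes ub \<phi> :: "'a::euclidean_space \<Rightarrow> real"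
  assumes e: "0 < e" and ub: "integrable lborel ub" "\<And>x. 0 \<le> ub x"
    and P: "finite_measure P" "sets P = sets borel" and Q: "finite_measure Q" "sets Q = sets borel"
    and \<phi>: "test \<phi>" "\<And>x. 0 \<le> \<phi> x" "\<And>x. \<phi> x \<le> 1"
    and K: "K \<in> sets borel" "\<And>n x y. n0 \<le> n \<Longrightarrow> x \<in> K \<Longrightarrow> dist x y < 1 / real (Suc n) \<Longrightarrow> 1 / 2 \<le> \<phi> y"
    and lap: "\<And>n x. n0 \<le> n \<Longrightarrow> \<phi> x \<noteq> 0 \<Longrightarrow> (\<Sum>b\<in>Basis. conv lborel (partial b (partial b (moll n))) ub x)
        = conv P (moll n) (\<lambda>_. 1) x - conv Q (moll n) (\<lambda>_. 1) x"
    and W: "open W" "K \<subseteq> W" and qc: "quasicontinuous W w" "\<And>x. x \<in> K \<Longrightarrow> w x = 0"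
      "AE x in lebesgue. x \<in> W \<longrightarrow> \<phi> x * trunc e (ub x) = w x"
    and diff: "\<And>A. A \<in> sets borel \<Longrightarrow> A \<subseteq> K \<Longrightarrow> cap A = 0 \<Longrightarrow> emeasure Q A = 0"
  shows "measure Q K / 2 \<le> measure P UNIV + e * (LINT x|lborel. \<bar>laplacian \<phi> x\<bar>)"
proof -
  interpret Q: finite_measure Q by fact
  define w1 where "w1 x = \<phi> x * trunc e (ub x)" for x
  define z where "z n = mollify n (\<lambda>x. \<phi> x * trunc e (mollify n ub x))" for n
  define M where "M = e\<^sup>2 * (LINT x|lborel. (\<phi> x)\<^sup>2) + e * (measure P UNIV + e * (LINT x|lborel. \<bar>laplacian \<phi> x\<bar>))
    + 2 * e\<^sup>2 * (\<Sum>b\<in>Basis. LINT x|lborel. (partial b \<phi> x)\<^sup>2)"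
  note TM = truncated_mollification_converges[OF e ub \<phi>]
  have w1i: "integrable lborel w1" unfolding w1_def[abs_def] by (rule TM(1))
  have L1: "(\<lambda>n. L1_dist (z n) w1) \<longlonglongrightarrow> 0" unfolding w1_def[abs_def] z_def by (rule TM(2))
  note ME = mollified_estimate[OF e ub P Q \<phi> K(1)]
  have E: "\<exists>G. (z n, G) \<in> W12 \<and> W12_norm_sq (z n) G \<le> M"
    "measure Q K / 2 \<le> measure P UNIV + e * (LINT x|lborel. \<bar>laplacian \<phi> x\<bar>) + (2 / e) * (LINT x|Q. indicator K x * z n x)"
    "continuous_on UNIV (z n)" "0 \<le> z n x" "z n x \<le> e" "integrable lborel (z n)" if n: "n0 \<le> n" for n x
    unfolding z_def M_def
    by ((rule ME(1) ME(2) ME(3) ME(4) ME(5) ME(6)); use K(2)[OF n] lap[OF n] in blast)+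
  have small: "\<exists>n\<ge>n0. (LINT x|Q. indicator K x * z n x) < c" if c: "0 < c" for c
  proof (rule ccontr)
    assume "\<not> ?thesis"
    then have ge: "c \<le> (LINT x|Q. indicator K x * z n x)" if "n0 \<le> n" for n using that by (meson not_less)
    define C where "C n = {(y, G). (y, G) \<in> W12 \<and> continuous_on UNIV y \<and> (\<forall>x. 0 \<le> y x \<and> y x \<le> e) \<and> integrable lborel y
      \<and> W12_norm_sq y G \<le> M \<and> (L1_dist y w1) \<le> 1 / real (Suc n)
      \<and> c \<le> (LINT x|Q. indicator K x * y x)}" for n
    have iQ: "integrable Q (\<lambda>x. indicator K x * y x)" if "continuous_on UNIV y" "\<forall>x. 0 \<le> y x \<and> y x \<le> e" for y
    proof (rule Q.integrable_const_bound)
      have "y \<in> borel_measurable Q" unfolding measurable_cong_sets[OF Q(2) refl] by (rule borel_measurable_continuous_onI[OF that(1)])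
      then show "(\<lambda>x. indicator K x * y x) \<in> borel_measurable Q"
        using K(1) Q(2) by (intro borel_measurable_times borel_measurable_indicator) auto
      show "AE x in Q. norm (indicator K x * y x) \<le> e" using that(2) e by (auto simp: indicator_def)
    qed
    have "\<exists>f F. (\<forall>n. (f n, F n) \<in> C n) \<and> Cauchy_seq (\<lambda>m n. W12_dist (f m) (F m) (f n) (F n))"
    proof (rule W12_almost_minimal_Cauchy[of C M])
      show "C n \<noteq> {}" for n
      proof -
        have "\<forall>\<^sub>F k in sequentially. (L1_dist (z k) w1) < 1 / real (Suc n)"
          by (rule order_tendstoD(2)[OF L1]) simp
        then have "\<forall>\<^sub>F k in sequentially. (L1_dist (z k) w1) < 1 / real (Suc n) \<and> n0 \<le> k"
          using eventually_ge_at_top[of n0] by (rule eventually_conj)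
        then obtain k where k: "n0 \<le> k" "(L1_dist (z k) w1) < 1 / real (Suc n)"
          by (auto simp: eventually_sequentially)
        obtain G where "(z k, G) \<in> W12" "W12_norm_sq (z k) G \<le> M" using E(1)[OF k(1)] by blast
        then have "(z k, G) \<in> C n" unfolding C_def
          using k ge[OF k(1)] E(3,4,5,6)[OF k(1)] by auto
        then show ?thesis by blast
      qed
      show "C (Suc n) \<subseteq> C n" for n
      proof -
        have "1 / real (Suc (Suc n)) \<le> 1 / real (Suc n)" by (simp add: frac_le)
        then show ?thesis unfolding C_def by fastforce
      qed
      show "C 0 \<subseteq> W12" unfolding C_def by auto
      show "W12_norm_sq f F \<le> M" if "(f, F) \<in> C 0" for f F using that by (simp add: C_def)
      fix n f F g G assume f: "(f, F) \<in> C n" and g: "(g, G) \<in> C n"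
      have fW: "(f, F) \<in> W12" "(g, G) \<in> W12" using f g by (auto simp: C_def)
      have fi: "integrable lborel f" "integrable lborel g" using f g by (auto simp: C_def)
      have fb: "continuous_on UNIV f" "\<forall>x. 0 \<le> f x \<and> f x \<le> e" "continuous_on UNIV g" "\<forall>x. 0 \<le> g x \<and> g x \<le> e"
        using f g by (auto simp: C_def)
      define h where "h x = (1 / 2) * (f x + g x)" for x
      define H where "H x = (1 / 2) *\<^sub>R (F x + G x)" for x
      have "(h, H) \<in> W12" unfolding h_def[abs_def] H_def[abs_def] by (rule W12_scale[OF W12_add[OF fW]])
      moreover have "continuous_on UNIV h" unfolding h_def[abs_def] using fb by (intro continuous_intros)
      moreover have "\<forall>x. 0 \<le> h x \<and> h x \<le> e"
      proof
        fix x show "0 \<le> h x \<and> h x \<le> e" using fb(2,4)[rule_format, of x] by (simp add: h_def)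
      qed
      moreover have "integrable lborel h" unfolding h_def[abs_def] using fi by simp
      moreover have "W12_norm_sq h H \<le> M"
      proof -
        have "W12_norm_sq h H = (1 / 2)\<^sup>2 * W12_norm_sq (\<lambda>x. f x + g x) (\<lambda>x. F x + G x)"
          unfolding h_def[abs_def] H_def[abs_def] by (rule W12_norm_sq_scale)
        also have "\<dots> \<le> (1 / 2)\<^sup>2 * (2 * W12_norm_sq f F + 2 * W12_norm_sq g G)"
          by (rule mult_left_mono[OF W12_norm_sq_add_le[OF fW]]) simp
        also have "\<dots> \<le> (1 / 2)\<^sup>2 * (2 * M + 2 * M)"
          using f g by (intro mult_left_mono add_mono) (auto simp: C_def)
        also have "\<dots> = M" by (simp add: power2_eq_square)
        finally show ?thesis .
      qed
      moreover have "(L1_dist h w1) \<le> 1 / real (Suc n)"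
      proof -
        have "(L1_dist h w1) \<le> (LINT x|lborel. (1 / 2) * \<bar>f x - w1 x\<bar> + (1 / 2) * \<bar>g x - w1 x\<bar>)"
        proof (rule integral_mono)
          show "integrable lborel (\<lambda>x. \<bar>h x - w1 x\<bar>)" unfolding h_def[abs_def] using fi w1i by simp
          show "integrable lborel (\<lambda>x. (1 / 2) * \<bar>f x - w1 x\<bar> + (1 / 2) * \<bar>g x - w1 x\<bar>)" using fi w1i by simp
          show "\<bar>h x - w1 x\<bar> \<le> (1 / 2) * \<bar>f x - w1 x\<bar> + (1 / 2) * \<bar>g x - w1 x\<bar>" for x
          proof -
            have "h x - w1 x = (1 / 2) * (f x - w1 x) + (1 / 2) * (g x - w1 x)" by (simp add: h_def field_simps)
            then show ?thesis using abs_triangle_ineq[of "(1 / 2) * (f x - w1 x)" "(1 / 2) * (g x - w1 x)"] by (simp add: abs_mult)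
          qed
        qed
        also have "\<dots> = (1 / 2) * (L1_dist f w1) + (1 / 2) * (L1_dist g w1)"
          using fi w1i by simp
        also have "\<dots> \<le> 1 / real (Suc n)" using f g by (simp add: C_def)
        finally show ?thesis .
      qed
      moreover have "c \<le> (LINT x|Q. indicator K x * h x)"
      proof -
        have "(LINT x|Q. indicator K x * h x) = (LINT x|Q. (1 / 2) * (indicator K x * f x) + (1 / 2) * (indicator K x * g x))"
          unfolding h_def by (rule Bochner_Integration.integral_cong[OF refl]) (simp add: algebra_simps)
        also have "\<dots> = (1 / 2) * (LINT x|Q. indicator K x * f x) + (1 / 2) * (LINT x|Q. indicator K x * g x)"
          using iQ[OF fb(1,2)] iQ[OF fb(3,4)] by simp
        finally show ?thesis using f g by (simp add: C_def)
      qed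
      ultimately have "(h, H) \<in> C n" unfolding C_def by blast
      then show "(\<lambda>x. (1 / 2) * (f x + g x), \<lambda>x. (1 / 2) *\<^sub>R (F x + G x)) \<in> C n"
        by (simp add: h_def[abs_def] H_def[abs_def])
    qed
    then obtain f F where fC: "\<And>n. (f n, F n) \<in> C n"
      and Cau: "Cauchy_seq (\<lambda>m n. W12_dist (f m) (F m) (f n) (F n))" by blast
    have f: "(f n, F n) \<in> W12" "continuous_on UNIV (f n)" "0 \<le> f n x" "f n x \<le> e" "integrable lborel (f n)"
      "(L1_dist (f n) w1) \<le> 1 / real (Suc n)" "c \<le> (LINT x|Q. indicator K x * f n x)" for n x
      using fC[of n] by (auto simp: C_def)
    have fl: "integrable lebesgue (f n)" for n
      using f(5)[of n] borel_measurable_continuous_onI[OF f(2)] by (simp add: integrable_completion)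
    have w1m: "w1 \<in> borel_measurable lborel" using w1i by simp
    have w1l: "integrable lebesgue w1" using w1i w1m by (simp add: integrable_completion)
    have "(\<lambda>n. LINT x|lebesgue. \<bar>f n x - w1 x\<bar>) \<longlonglongrightarrow> 0"
    proof (rule tendsto_sandwich[OF _ _ tendsto_const LIMSEQ_inverse_real_of_nat])
      have "(LINT x|lebesgue. \<bar>f n x - w1 x\<bar>) = (L1_dist (f n) w1)" for n
        by (rule integral_completion)
          (use w1m borel_measurable_continuous_onI[OF f(2)[of n]] in \<open>auto intro!: borel_measurable_abs borel_measurable_diff\<close>)
      then show "\<forall>\<^sub>F n in sequentially. (LINT x|lebesgue. \<bar>f n x - w1 x\<bar>) \<le> inverse (real (Suc n))"
        using f(6) by (simp add: inverse_eq_divide)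
    qed (auto intro!: integral_nonneg_AE)
    moreover have "AE x in lebesgue. x \<in> W \<longrightarrow> w1 x = w x" using qc(3) by (simp add: w1_def)
    ultimately have "\<exists>n. (LINT x|Q. indicator K x * f n x) < c"
      by (intro diffuse_integral_vanishes[OF W(1) K(1) W(2) qc(1,2) Q diff f(2,3,4) fl f(1) Cau w1l _ _ c])
    then show False using f(7) by (meson not_less)
  qed
  show ?thesis
  proof (rule field_le_epsilon)
    fix d :: real assume d: "0 < d"
    obtain n where n: "n0 \<le> n" "(LINT x|Q. indicator K x * z n x) < d * e / 2" using small[of "d * e / 2"] d e by auto
    have "(2 / e) * (LINT x|Q. indicator K x * z n x) \<le> (2 / e) * (d * e / 2)"
      using n(2) e by (intro mult_left_mono) auto
    also have "\<dots> = d" using e by simp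
    finally show "measure Q K / 2 \<le> measure P UNIV + e * (LINT x|lborel. \<bar>laplacian \<phi> x\<bar>) + d"
      using E(2)[OF n(1)] by simp
  qed
qed

section \<open>Localisation\<close>

text \<open>The measures of the theorem are finite only on compact subsets of the open set and live on its
  subspace algebra. Their restriction to a compact set \<open>L\<close> is viewed as a finite Borel measure on the
  whole space, to which Fubini's theorem and the regularity theorems apply.\<close>

definition localize :: "'a::euclidean_space measure \<Rightarrow> 'a set \<Rightarrow> 'a measure" where
  "localize M L = distr (density M (\<lambda>x. ennreal (indicator L x))) borel (\<lambda>x. x)"

lemma localize_properties:
  fixes M :: "'a::euclidean_space measure"
  assumes M: "sets M = sets (restrict_space borel W)" and W: "W \<in> sets borel"
    and L: "L \<in> sets borel" "L \<subseteq> W" "emeasure M L < \<infinity>"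
  shows "sets (localize M L) = sets borel" "finite_measure (localize M L)"
    "\<And>A. A \<in> sets borel \<Longrightarrow> emeasure (localize M L) A = emeasure M (A \<inter> L)"
    "\<And>f :: 'a \<Rightarrow> real. f \<in> borel_measurable borel \<Longrightarrow> (\<And>x. x \<notin> L \<Longrightarrow> f x = 0) \<Longrightarrow> (LINT x|localize M L. f x) = (LINT x|M. f x)"
proof -
  have sp: "space M = W" using sets_eq_imp_space_eq[OF M] by (simp add: space_restrict_space)
  have idM: "(\<lambda>x. x) \<in> measurable M borel"
    unfolding measurable_cong_sets[OF M refl] by (rule measurable_restrict_space1) simp
  have idD: "(\<lambda>x. x) \<in> measurable (density M (\<lambda>x. ennreal (indicator L x))) borel" using idM by simp
  have setM: "A \<in> sets M" if "A \<in> sets borel" "A \<subseteq> W" for A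
    using that W unfolding M sets_restrict_space by (auto intro!: image_eqI[of _ _ A])
  have LM: "L \<in> sets M" by (rule setM[OF L(1,2)])
  have ind: "(indicator L :: 'a \<Rightarrow> real) \<in> borel_measurable M" by (rule borel_measurable_indicator[OF LM])
  show s: "sets (localize M L) = sets borel" by (simp add: localize_def)
  show em: "emeasure (localize M L) A = emeasure M (A \<inter> L)" if A: "A \<in> sets borel" for A
  proof -
    have AW: "A \<inter> W \<in> sets M" using A W by (intro setM) auto
    have "emeasure (localize M L) A = emeasure (density M (\<lambda>x. ennreal (indicator L x))) (A \<inter> W)"
      unfolding localize_def using A idD by (subst emeasure_distr) (auto simp: sp vimage_def Int_def)
    also have "\<dots> = (\<integral>\<^sup>+x. ennreal (indicator L x) * indicator (A \<inter> W) x \<partial>M)"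
      by (rule emeasure_density) (use ind AW in auto)
    also have "\<dots> = (\<integral>\<^sup>+x. indicator (A \<inter> L) x \<partial>M)"
      using L(2) by (intro nn_integral_cong) (auto simp: indicator_def)
    also have "\<dots> = emeasure M (A \<inter> L)" using A L by (intro nn_integral_indicator setM) auto
    finally show ?thesis .
  qed
  show "finite_measure (localize M L)"
  proof (rule finite_measureI)
    have "space (localize M L) = UNIV" using sets_eq_imp_space_eq[OF s] by simp
    then show "emeasure (localize M L) (space (localize M L)) \<noteq> \<infinity>" using em[of UNIV] L(3) by simp
  qed
  fix f :: "'a \<Rightarrow> real" assume f: "f \<in> borel_measurable borel" and out: "\<And>x. x \<notin> L \<Longrightarrow> f x = 0"
  have fM: "f \<in> borel_measurable M" by (rule measurable_compose[OF idM f])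
  have "(LINT x|localize M L. f x) = (LINT x|density M (\<lambda>x. ennreal (indicator L x)). f x)"
    unfolding localize_def by (rule integral_distr[OF idD f])
  also have "\<dots> = (LINT x|M. indicator L x *\<^sub>R f x)" by (rule integral_density[OF fM ind]) simp
  also have "\<dots> = (LINT x|M. f x)" using out by (intro Bochner_Integration.integral_cong) (auto simp: indicator_def)
  finally show "(LINT x|localize M L. f x) = (LINT x|M. f x)" .
qed

lemma pos_radon_sets: "P \<in> pos_radon W \<Longrightarrow> sets P = sets (restrict_space borel W)"
  by (simp add: pos_radon_def)

lemma pos_radon_finite: "P \<in> pos_radon W \<Longrightarrow> compact K \<Longrightarrow> K \<subseteq> W \<Longrightarrow> emeasure P K < \<infinity>"
  by (simp add: pos_radon_def)

lemma L1_loc_borel_version: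
  fixes u :: "'a::euclidean_space \<Rightarrow> real"
  assumes u: "u \<in> L1_loc W" and L: "compact L" "L \<subseteq> W" and nn: "AE x in lebesgue. x \<in> W \<longrightarrow> 0 \<le> u x"
  shows "\<exists>ub\<in>borel_measurable borel. integrable lborel ub \<and> (\<forall>x. 0 \<le> ub x) \<and> (\<forall>x. x \<notin> L \<longrightarrow> ub x = 0)
    \<and> (AE x in lebesgue. x \<in> L \<longrightarrow> ub x = u x)"
proof -
  have i: "integrable lebesgue (\<lambda>x. indicator L x *\<^sub>R u x)"
    using u L by (simp add: L1_loc_def set_integrable_def)
  obtain h where h: "h \<in> borel_measurable lborel" "AE x in lborel. indicator L x *\<^sub>R u x = h x"
    using completion_ex_borel_measurable_real[OF borel_measurable_integrable[OF i]] by blast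
  define ub where "ub x = indicator L x * max 0 (h x)" for x
  have ind: "(indicator L :: 'a \<Rightarrow> real) \<in> borel_measurable borel"
    by (rule borel_measurable_indicator) (simp add: L(1) compact_imp_closed)
  have m: "ub \<in> borel_measurable borel"
    unfolding ub_def[abs_def] by (rule borel_measurable_times[OF ind borel_measurable_max]) (use h(1) in auto)
  have AE: "AE x in lebesgue. indicator L x *\<^sub>R u x = ub x"
    using AE_completion[OF h(2)] nn
  proof eventually_elim
    case (elim x) then show ?case using L(2) by (cases "x \<in> L") (auto simp: ub_def)
  qed
  have "integrable lebesgue ub"
    by (rule integrable_cong_AE_imp[OF i _ AE]) (use m in \<open>simp add: measurable_completion\<close>)
  then have "integrable lborel ub" using m by (simp add: integrable_completion)
  moreover have "AE x in lebesgue. x \<in> L \<longrightarrow> ub x = u x" using AE by eventually_elim (auto simp: indicator_def)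
  ultimately show ?thesis using m by (intro bexI[of _ ub]) (auto simp: ub_def)
qed

text \<open>The function \<open>\<lambda>y. moll n (x - y)\<close> is an admissible test function as soon as the ball of radius
  \<open>1 / (n + 1)\<close> about \<open>x\<close> stays in the open set, and two reflections leave the sign of its Laplacian
  unchanged.\<close>

lemma mollified_laplacian:
  fixes u :: "'a::euclidean_space \<Rightarrow> real"
  assumes W: "open W" and PQ: "P \<in> pos_radon W" "Q \<in> pos_radon W" and lap: "has_distr_laplacian W u (P, Q)"
    and u: "u \<in> L1_loc W" and L: "compact L" "L \<subseteq> W" and x: "cball x (1 / real (Suc n)) \<subseteq> L"
    and ub: "ub \<in> borel_measurable borel" "integrable lborel ub" "AE x in lebesgue. x \<in> L \<longrightarrow> ub x = u x"
  shows "(\<Sum>b\<in>Basis. conv lborel (partial b (partial b (moll n))) ub x)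
    = conv (localize P L) (moll n) (\<lambda>_. 1) x - conv (localize Q L) (moll n) (\<lambda>_. 1) x"
proof -
  define \<psi> where "\<psi> y = moll n (x - y)" for y
  have tm: "test (moll n :: 'a \<Rightarrow> real)" by (rule test_moll)
  have \<psi>UNIV: "test \<psi>" unfolding \<psi>_def by (rule test_reflect[OF tm])
  have out: "\<psi> y = 0" if "y \<notin> cball x (1 / real (Suc n))" for y
    unfolding \<psi>_def by (rule moll_support) (use that in \<open>simp add: dist_norm\<close>)
  have \<psi>: "\<psi> \<in> test_functions W"
    by (rule test_functionsI[OF test_smooth[OF \<psi>UNIV] closed_cball bounded_cball _ out]) (use x L in auto)
  have \<psi>L: "\<psi> \<in> test_functions L"
    by (rule test_functionsI[OF test_smooth[OF \<psi>UNIV] closed_cball bounded_cball x out])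
  have outL: "f y = 0" if "f \<in> test_functions L" "y \<notin> L" for f :: "'a \<Rightarrow> real" and y
    using that closure_subset[of "{x. f x \<noteq> 0}"] by (auto simp: test_functions_def)
  have dd: "partial b (partial b \<psi>) = (\<lambda>y. partial b (partial b (moll n)) (x - y))" if b: "b \<in> Basis" for b
  proof -
    have 1: "partial b \<psi> = (\<lambda>y. - partial b (moll n) (x - y))"
      unfolding \<psi>_def by (rule partial_reflect[OF test_smooth[OF tm]])
    have 2: "partial b (\<lambda>y. - partial b (moll n) (x - y)) = (\<lambda>y. partial b (partial b (moll n)) (x - y))"
    proof
      fix y
      have t: "test (partial b (moll n))" by (rule test_partial[OF tm b])
      have r: "((\<lambda>y. partial b (moll n) (x - y)) has_derivative frechet_derivative (\<lambda>y. partial b (moll n) (x - y)) (at y)) (at y)"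
        by (rule smooth_has_derivative[OF test_smooth[OF test_reflect[OF t]]])
      have "partial b (\<lambda>y. - partial b (moll n) (x - y)) y = - partial b (\<lambda>y. partial b (moll n) (x - y)) y"
        by (subst partial_eq[OF has_derivative_minus[OF r]]) (simp add: partial_def)
      also have "\<dots> = partial b (partial b (moll n)) (x - y)"
        by (simp add: partial_reflect[OF test_smooth[OF t]])
      finally show "partial b (\<lambda>y. - partial b (moll n) (x - y)) y = partial b (partial b (moll n)) (x - y)" .
    qed
    show ?thesis unfolding 1 2 ..
  qed
  have lapm: "laplacian \<psi> \<in> borel_measurable borel"
    unfolding laplacian_def[abs_def]
    by (intro borel_measurable_sum smooth_borel test_smooth[of _ UNIV] test_partial \<psi>UNIV)
  have lapL: "laplacian \<psi> y = 0" if "y \<notin> L" for y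
    unfolding laplacian_def by (intro sum.neutral ballI outL[OF _ that] test_partial \<psi>L)
  have "(\<Sum>b\<in>Basis. conv lborel (partial b (partial b (moll n))) ub x) = (LINT y|lborel. ub y * laplacian \<psi> y)"
  proof -
    have i: "integrable lborel (\<lambda>y. partial b (partial b (moll n)) (x - y) * ub y)" if "b \<in> Basis" for b
      by (rule conv_integrable[OF _ ub(2) test_partial[OF test_partial[OF tm that] that]]) simp
    have "(LINT y|lborel. ub y * laplacian \<psi> y) = (LINT y|lborel. (\<Sum>b\<in>Basis. partial b (partial b (moll n)) (x - y) * ub y))"
      unfolding laplacian_def sum_distrib_left
      by (intro Bochner_Integration.integral_cong[OF refl] sum.cong[OF refl]) (simp add: dd)
    also have "\<dots> = (\<Sum>b\<in>Basis. conv lborel (partial b (partial b (moll n))) ub x)"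
      unfolding conv_def by (rule Bochner_Integration.integral_sum[OF i])
    finally show ?thesis by simp
  qed
  also have "\<dots> = (LINT y|lebesgue. ub y * laplacian \<psi> y)"
    by (rule integral_completion[symmetric]) (use ub(1) lapm in auto)
  also have "\<dots> = (LINT y|lebesgue. (indicator L y *\<^sub>R u y) * laplacian \<psi> y)"
  proof (rule integral_cong_AE)
    show "AE y in lebesgue. ub y * laplacian \<psi> y = (indicator L y *\<^sub>R u y) * laplacian \<psi> y"
      using ub(3)
    proof eventually_elim
      case (elim y) then show ?case using lapL[of y] by (cases "y \<in> L") auto
    qed
    have "(\<lambda>y. indicator L y *\<^sub>R u y) \<in> borel_measurable lebesgue"
      using u L by (intro borel_measurable_integrable) (simp add: L1_loc_def set_integrable_def)
    then show "(\<lambda>y. (indicator L y *\<^sub>R u y) * laplacian \<psi> y) \<in> borel_measurable lebesgue"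
      by (rule borel_measurable_times) (use lapm in \<open>simp add: measurable_completion\<close>)
    show "(\<lambda>y. ub y * laplacian \<psi> y) \<in> borel_measurable lebesgue"
      by (rule borel_measurable_times) (use ub(1) lapm in \<open>simp_all add: measurable_completion\<close>)
  qed
  also have "\<dots> = (LINT y:W|lebesgue. u y * laplacian \<psi> y)"
    unfolding set_lebesgue_integral_def
  proof (rule Bochner_Integration.integral_cong[OF refl])
    show "(indicator L y *\<^sub>R u y) * laplacian \<psi> y = indicator W y *\<^sub>R (u y * laplacian \<psi> y)" for y
      using lapL[of y] L(2) by (cases "y \<in> L") auto
  qed
  also have "\<dots> = signed_integral (P, Q) \<psi>" using lap \<psi> by (simp add: has_distr_laplacian_def)
  also have "\<dots> = (LINT y|localize P L. \<psi> y) - (LINT y|localize Q L. \<psi> y)"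
  proof -
    have Wb: "W \<in> sets borel" using W by simp
    have Lb: "L \<in> sets borel" using L(1) by (simp add: compact_imp_closed)
    have \<psi>m: "\<psi> \<in> borel_measurable borel" by (rule smooth_borel[OF test_smooth[OF \<psi>UNIV]])
    note lP = localize_properties(4)[OF pos_radon_sets[OF PQ(1)] Wb Lb L(2) pos_radon_finite[OF PQ(1) L] \<psi>m outL[OF \<psi>L]]
    note lQ = localize_properties(4)[OF pos_radon_sets[OF PQ(2)] Wb Lb L(2) pos_radon_finite[OF PQ(2) L] \<psi>m outL[OF \<psi>L]]
    show ?thesis unfolding signed_integral_def using lP lQ by simp
  qed
  finally show ?thesis by (simp add: conv_def \<psi>_def)
qed

section \<open>The negative part on the zero set\<close>

text \<open>Since \<open>P K = 0\<close>, some closed neighbourhood \<open>L\<close> of \<open>K\<close> has \<open>P\<close>-mass below \<open>\<eta>\<close>. There the estimate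
  gives \<open>Q K / 2 \<le> \<eta> + e \<Lambda>\<close> for every \<open>e > 0\<close>, where \<open>\<Lambda>\<close> depends on the cutoff function only.\<close>

lemma negative_diffuse_mass_vanishes:
  fixes u u' :: "'a::euclidean_space \<Rightarrow> real"
  assumes W: "open W" and u: "u \<in> L1_loc W" and PQ: "P \<in> pos_radon W" "Q \<in> pos_radon W"
    and lap: "has_distr_laplacian W u (P, Q)" and nn: "AE x in lebesgue. x \<in> W \<longrightarrow> 0 \<le> u x"
    and qc: "quasicontinuous W u'" and uu: "AE x in lebesgue. x \<in> W \<longrightarrow> u x = u' x"
    and K: "compact K" "K \<subseteq> W" "\<And>x. x \<in> K \<Longrightarrow> u' x = 0" and PK: "emeasure P K = 0"
    and diff: "\<And>A. A \<in> sets borel \<Longrightarrow> A \<subseteq> K \<Longrightarrow> cap A = 0 \<Longrightarrow> emeasure Q A = 0"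
  shows "emeasure Q K = 0"
proof -
  have Wb: "W \<in> sets borel" using W by simp
  have Kb: "K \<in> sets borel" using K(1) by (simp add: compact_imp_closed)
  have finK: "emeasure Q K < \<infinity>" by (rule pos_radon_finite[OF PQ(2) K(1,2)])
  have bound: "measure Q K / 2 \<le> \<eta>" if \<eta>: "0 < \<eta>" for \<eta>
  proof -
    define B where "B r = (\<Union>x\<in>K. cball x r)" for r
    have Bc: "compact (B r)" for r unfolding B_def by (rule compact_minkowski_sum_cball[OF K(1)])
    have Bmono: "B r \<subseteq> B s" if "r \<le> s" for r s unfolding B_def using that by (force simp: subset_eq)
    have KB: "K \<subseteq> B r" if "0 \<le> r" for r unfolding B_def using that by force
    obtain r0 where r0: "0 < r0" "B r0 \<subseteq> W"
      unfolding B_def by (rule compact_subset_open_imp_cball_epsilon_subset[OF K(1) W K(2)])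
    have B0: "B r0 \<in> sets borel" using Bc by (simp add: compact_imp_closed)
    define P0 where "P0 = localize P (B r0)"
    note lP0 = localize_properties[OF pos_radon_sets[OF PQ(1)] Wb B0 r0(2) pos_radon_finite[OF PQ(1) Bc r0(2)], folded P0_def]
    have "emeasure P0 K = (INF U\<in>{U. K \<subseteq> U \<and> open U}. emeasure P0 U)"
      by (rule outer_regular[OF lP0(1) _ Kb]) (use finite_measure.emeasure_finite[OF lP0(2), of "space P0"] in simp)
    moreover have "emeasure P0 K = 0"
      using lP0(3)[OF Kb] KB[of r0] r0(1) PK by (simp add: Int_absorb2)
    ultimately have "(INF U\<in>{U. K \<subseteq> U \<and> open U}. emeasure P0 U) < ennreal \<eta>" using \<eta> by simp
    then obtain U where U: "K \<subseteq> U" "open U" "emeasure P0 U < ennreal \<eta>" unfolding INF_less_iff by blast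
    obtain r1 where r1: "0 < r1" "B r1 \<subseteq> U"
      unfolding B_def by (rule compact_subset_open_imp_cball_epsilon_subset[OF K(1) U(2,1)])
    define r where "r = min r0 r1"
    have r: "0 < r" "B r \<subseteq> W" "B r \<subseteq> U" "B r \<subseteq> B r0"
      using r0 r1 Bmono[of r r0] Bmono[of r r1] by (auto simp: r_def)
    define L where "L = B r"
    have L: "compact L" "L \<subseteq> W" and Lb: "L \<in> sets borel" using Bc r by (auto simp: L_def compact_imp_closed)
    note finL = pos_radon_finite[OF PQ(1) L] pos_radon_finite[OF PQ(2) L]
    have PL: "measure (localize P L) UNIV < \<eta>"
    proof -
      have "emeasure (localize P L) UNIV = emeasure P L"
        using localize_properties(3)[OF pos_radon_sets[OF PQ(1)] Wb Lb L(2) finL(1), of UNIV] by simp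
      also have "\<dots> = emeasure P0 L" using lP0(3)[OF Lb] r(4) by (simp add: L_def Int_absorb2)
      also have "\<dots> \<le> emeasure P0 U" using r(3) U(2) lP0(1) by (intro emeasure_mono) (auto simp: L_def)
      finally have lt: "emeasure (localize P L) UNIV < ennreal \<eta>" using U(3) by simp
      then have "emeasure (localize P L) UNIV = ennreal (measure (localize P L) UNIV)"
        by (intro emeasure_eq_ennreal_measure) auto
      then show ?thesis using lt by (simp add: ennreal_less_iff)
    qed
    \<comment> \<open>at distance up to \<open>r / 4\<close> from \<open>K\<close> the cutoff function is at least 1/2, and its support is within
      distance \<open>r / 2\<close>, so mollifying at scales below \<open>r / 4\<close> stays inside \<open>L\<close>\<close>
    define V where "V = (\<Union>x\<in>K. ball x (r / 2))"
    have V: "open V" unfolding V_def by auto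
    have BV: "B (r / 4) \<subseteq> V" unfolding B_def V_def using r(1) by (force simp: subset_eq)
    obtain \<phi> where \<phi>: "\<phi> \<in> test_functions V" "\<And>x. 0 \<le> \<phi> x" "\<And>x. \<phi> x \<le> 1" "\<And>x. x \<in> B (r / 4) \<Longrightarrow> 1 / 2 \<le> \<phi> x"
      by (rule cutoff_exists[OF Bc V BV]) (rule that)
    have \<phi>t: "test \<phi>" by (rule test_UNIV[OF \<phi>(1)])
    have \<phi>V: "x \<in> V" if "\<phi> x \<noteq> 0" for x
      using \<phi>(1) that closure_subset[of "{x. \<phi> x \<noteq> 0}"] by (auto simp: test_functions_def)
    obtain n0 where n0: "1 / real (Suc n0) < r / 4" using nat_approx_posE[of "r / 4"] r(1) by auto
    have small: "1 / real (Suc n) < r / 4" if "n0 \<le> n" for n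
    proof -
      have "1 / real (Suc n) \<le> 1 / real (Suc n0)" using that by (simp add: frac_le)
      then show ?thesis using n0 by linarith
    qed
    have near: "1 / 2 \<le> \<phi> y" if n: "n0 \<le> n" and xy: "x \<in> K" "dist x y < 1 / real (Suc n)" for n x y
    proof (rule \<phi>(4))
      have "dist x y \<le> r / 4" using small[OF n] xy(2) by linarith
      then show "y \<in> B (r / 4)" unfolding B_def using xy(1) by auto
    qed
    have inL: "cball x (1 / real (Suc n)) \<subseteq> L" if n: "n0 \<le> n" and x: "\<phi> x \<noteq> 0" for n x
    proof
      fix y assume "y \<in> cball x (1 / real (Suc n))"
      then have xy: "dist x y \<le> 1 / real (Suc n)" by simp
      obtain k where k: "k \<in> K" "dist k x < r / 2" using \<phi>V[OF x] by (auto simp: V_def)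
      have "dist k y \<le> dist k x + dist x y" by (rule dist_triangle)
      then have "dist k y \<le> r" using k(2) xy small[OF n] r(1) by linarith
      then show "y \<in> L" unfolding L_def B_def using k(1) by auto
    qed
    obtain ub where ub: "ub \<in> borel_measurable borel" "integrable lborel ub" "\<And>x. 0 \<le> ub x"
      "AE x in lebesgue. x \<in> L \<longrightarrow> ub x = u x"
      using L1_loc_borel_version[OF u L nn] by blast
    note lap' = mollified_laplacian[OF W PQ lap u L inL ub(1,2,4)]
    define Pl where "Pl = localize P L"
    define Ql where "Ql = localize Q L"
    note lP = localize_properties[OF pos_radon_sets[OF PQ(1)] Wb Lb L(2) finL(1), folded Pl_def]
    note lQ = localize_properties[OF pos_radon_sets[OF PQ(2)] Wb Lb L(2) finL(2), folded Ql_def]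
    have KL: "K \<subseteq> L" unfolding L_def by (rule KB) (use r(1) in simp)
    have QlA: "emeasure Ql A = emeasure Q A" if "A \<in> sets borel" "A \<subseteq> K" for A
      using lQ(3)[OF that(1)] that(2) KL by (simp add: Int_absorb2 subset_trans)
    define \<Lambda> where "\<Lambda> = (LINT x|lborel. \<bar>laplacian \<phi> x\<bar>)"
    have \<Lambda>0: "0 \<le> \<Lambda>" unfolding \<Lambda>_def by (intro integral_nonneg_AE) auto
    have est: "measure Ql K / 2 \<le> measure Pl UNIV + e * \<Lambda>" if e: "0 < e" for e
    proof -
      \<comment> \<open>\<open>u'\<close> may be negative on a null set, where \<open>trunc e\<close> could be singular\<close>
      define w where "w x = \<phi> x * trunc e (max 0 (u' x))" for x
      have qcw: "quasicontinuous W w" unfolding quasicontinuous_def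
      proof (intro allI impI)
        fix \<epsilon> :: real assume "0 < \<epsilon>"
        then obtain U where U: "open U" "U \<subseteq> W" "cap U < ennreal \<epsilon>" "continuous_on (W - U) u'"
          using qc unfolding quasicontinuous_def by blast
        have ne: "e + max 0 (u' x) \<noteq> 0" for x using e by linarith
        have "continuous_on (W - U) w"
          unfolding w_def trunc_def using U(4) ne
          by (intro continuous_on_mult test_continuous[OF \<phi>t] continuous_on_divide continuous_on_add continuous_on_max continuous_on_const) auto
        with U show "\<exists>U. open U \<and> U \<subseteq> W \<and> cap U < ennreal \<epsilon> \<and> continuous_on (W - U) w" by blast
      qed
      have wK: "w x = 0" if "x \<in> K" for x using K(3)[OF that] by (simp add: w_def trunc_def)
      have wAE: "AE x in lebesgue. x \<in> W \<longrightarrow> \<phi> x * trunc e (ub x) = w x"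
        using ub(4) nn uu
      proof eventually_elim
        case (elim x)
        show ?case
        proof (cases "\<phi> x = 0")
          case False
          have "x \<in> L" using inL[OF order_refl False] by (simp add: subset_eq)
          then show ?thesis using elim by (simp add: w_def max_def)
        qed (simp add: w_def)
      qed
      have dQ: "emeasure Ql A = 0" if "A \<in> sets borel" "A \<subseteq> K" "cap A = 0" for A
        using QlA[OF that(1,2)] diff[OF that] by simp
      show ?thesis unfolding \<Lambda>_def
      proof (rule limit_estimate[where ?n0.0 = n0 and W = W and w = w, OF e ub(2,3) lP(2,1) lQ(2,1) \<phi>t \<phi>(2,3) Kb])
        show "1 / 2 \<le> \<phi> y" if "n0 \<le> n" "x \<in> K" "dist x y < 1 / real (Suc n)" for n x y by (rule near[OF that])
        show "(\<Sum>b\<in>Basis. conv lborel (partial b (partial b (moll n))) ub x)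
          = conv Pl (moll n) (\<lambda>_. 1) x - conv Ql (moll n) (\<lambda>_. 1) x" if "n0 \<le> n" "\<phi> x \<noteq> 0" for n x
          unfolding Pl_def Ql_def by (rule lap'[OF that])
        show "emeasure Ql A = 0" if "A \<in> sets borel" "A \<subseteq> K" "cap A = 0" for A by (rule dQ[OF that])
      qed (rule W K(2) qcw wAE wK; assumption?)+
    qed
    have "measure Ql K / 2 \<le> measure Pl UNIV"
    proof (rule field_le_epsilon)
      fix d :: real assume d: "0 < d"
      have "measure Ql K / 2 \<le> measure Pl UNIV + d / (\<Lambda> + 1) * \<Lambda>" by (rule est) (use d \<Lambda>0 in simp)
      also have "d / (\<Lambda> + 1) * \<Lambda> \<le> d"
      proof -
        have "\<Lambda> * d \<le> (\<Lambda> + 1) * d" using d by (intro mult_right_mono) auto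
        then show ?thesis using \<Lambda>0 by (simp add: pos_divide_le_eq mult.commute)
      qed
      finally show "measure Ql K / 2 \<le> measure Pl UNIV + d" by simp
    qed
    moreover have "measure Ql K = measure Q K" using QlA[OF Kb subset_refl] by (simp add: measure_def)
    ultimately show ?thesis using PL by (simp add: Pl_def)
  qed
  have "measure Q K / 2 \<le> 0" by (rule field_le_epsilon) (use bound in simp)
  then have "measure Q K = 0" using measure_nonneg[of Q K] by linarith
  moreover have "emeasure Q K = ennreal (measure Q K)" using finK by (intro emeasure_eq_ennreal_measure) auto
  ultimately show ?thesis by simp
qed

lemma sets_pos_radon: "P \<in> pos_radon W \<Longrightarrow> W \<in> sets borel \<Longrightarrow> A \<in> sets borel \<Longrightarrow> A \<subseteq> W \<Longrightarrow> A \<in> sets P"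
  unfolding pos_radon_sets sets_restrict_space by (auto intro!: image_eqI[of _ _ A])

lemma rel_compact_subset: "rel_compact W A \<Longrightarrow> B \<subseteq> A \<Longrightarrow> rel_compact W B"
  unfolding rel_compact_def
proof -
  assume A: "compact (closure A) \<and> closure A \<subseteq> W" and "B \<subseteq> A"
  then have sub: "closure B \<subseteq> closure A" by (simp add: closure_mono)
  then have "closure B = closure A \<inter> closure B" by auto
  then have "compact (closure B)" using A compact_Int_closed[of "closure A" "closure B"] by simp
  then show "compact (closure B) \<and> closure B \<subseteq> W" using A sub by auto
qed

lemma rel_compact_finite:
  assumes "P \<in> pos_radon W" "W \<in> sets borel" "A \<in> sets borel" "rel_compact W A"
  shows "emeasure P A < \<infinity>" "emeasure P A = ennreal (measure P A)"
proof -
  have c: "compact (closure A)" "closure A \<subseteq> W" using assms(4) by (auto simp: rel_compact_def)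
  have "emeasure P A \<le> emeasure P (closure A)"
    using c by (intro emeasure_mono closure_subset sets_pos_radon[OF assms(1,2)]) auto
  also have "\<dots> < \<infinity>" by (rule pos_radon_finite[OF assms(1) c])
  finally show f: "emeasure P A < \<infinity>" .
  then show "emeasure P A = ennreal (measure P A)" by (intro emeasure_eq_ennreal_measure) auto
qed

theorem corollary1p3:
  fixes \<Omega> :: "'a::euclidean_space set"
    and u u' :: "'a \<Rightarrow> real"
    and \<mu> \<mu>d \<mu>c :: "'a signed_measure"
  assumes "open \<Omega>" and "bounded \<Omega>"
    and "u \<in> L1_loc \<Omega>"
    and "\<mu> \<in> radon \<Omega>" and "has_distr_laplacian \<Omega> u \<mu>"
    and "AE x in lebesgue. x \<in> \<Omega> \<longrightarrow> 0 \<le> u x"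
    and "cap_decomposition \<Omega> \<mu> \<mu>d \<mu>c"
    and "quasicontinuous \<Omega> u'" and "AE x in lebesgue. x \<in> \<Omega> \<longrightarrow> u x = u' x"
  shows "nonneg_on \<Omega> \<mu>d {x \<in> \<Omega>. u' x = 0}"
proof -
  have \<Omega>b: "\<Omega> \<in> sets borel" using assms(1) by simp
  obtain P Q where \<mu>: "\<mu> = (P, Q)" by (cases \<mu>)
  obtain Pd Qd where \<mu>d: "\<mu>d = (Pd, Qd)" by (cases \<mu>d)
  obtain Pc Qc where \<mu>c: "\<mu>c = (Pc, Qc)" by (cases \<mu>c)
  obtain H where PQ: "P \<in> pos_radon \<Omega>" "Q \<in> pos_radon \<Omega>"
    and H: "H \<in> sets borel" "H \<subseteq> \<Omega>" "emeasure P (\<Omega> - H) = 0" "emeasure Q H = 0"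
    using assms(4) unfolding \<mu> radon_def by blast
  have dec: "\<mu>d \<in> radon \<Omega>" "\<mu>c \<in> radon \<Omega>" "diffuse \<Omega> \<mu>d" "concentrated \<Omega> \<mu>c"
    "\<And>A. A \<in> sets borel \<Longrightarrow> rel_compact \<Omega> A \<Longrightarrow> val \<mu> A = val \<mu>d A + val \<mu>c A"
    using assms(7) unfolding cap_decomposition_def by auto
  have Pdc: "Pd \<in> pos_radon \<Omega>" "Qd \<in> pos_radon \<Omega>" "Pc \<in> pos_radon \<Omega>" "Qc \<in> pos_radon \<Omega>"
    using dec(1,2) unfolding \<mu>d \<mu>c radon_def by auto
  obtain F where F: "F \<in> sets borel" "F \<subseteq> \<Omega>" "cap F = 0" "total_var \<mu>c (\<Omega> - F) = 0"
    using dec(4) unfolding concentrated_def by blast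
  have Fc: "emeasure Pc (\<Omega> - F) = 0" "emeasure Qc (\<Omega> - F) = 0" using F(4) by (simp_all add: total_var_def \<mu>c)
  have d0: "emeasure Pd A = 0" "emeasure Qd A = 0" if "A \<in> sets borel" "A \<subseteq> \<Omega>" "cap A = 0" for A
    using dec(3) that by (auto simp: diffuse_def total_var_def \<mu>d)
  have cap0: "cap A = 0" if "A \<subseteq> B" "cap B = 0" for A B :: "'a set" using cap_mono[OF that(1)] that(2) by simp
  have null_mono: "emeasure M A = 0" if "M \<in> pos_radon \<Omega>" "A \<subseteq> B" "B \<in> sets borel" "B \<subseteq> \<Omega>" "emeasure M B = 0" for M A B
    using emeasure_mono[OF that(2) sets_pos_radon[OF that(1) \<Omega>b that(3,4)]] that(5) by simp
  have \<mu>c0: "val \<mu>c A = 0" if "A \<subseteq> \<Omega> - F" for A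
    using null_mono[OF Pdc(3) that _ _ Fc(1)] null_mono[OF Pdc(4) that _ _ Fc(2)] \<Omega>b F(1) by (simp add: val_def \<mu>c measure_def)
  \<comment> \<open>outside the set carrying the concentrated part the diffuse part is the whole measure\<close>
  have \<mu>_eq: "val \<mu> A = val \<mu>d A" if "A \<in> sets borel" "rel_compact \<Omega> A" "A \<subseteq> \<Omega> - F" for A
    using dec(5)[OF that(1,2)] \<mu>c0[OF that(3)] by simp
  \<comment> \<open>\<open>H\<close> carries \<open>P\<close>, and \<open>A\<close> avoids it\<close>
  have key: "emeasure Q A = 0"
    if A: "A \<in> sets borel" "rel_compact \<Omega> A" "A \<subseteq> \<Omega> - F" "A \<subseteq> \<Omega> - H" and zero: "\<And>x. x \<in> A \<Longrightarrow> u' x = 0" for A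
  proof -
    define L where "L = closure A"
    have L: "compact L" "L \<subseteq> \<Omega>" "A \<subseteq> L" "L \<in> sets borel" using A(2) closure_subset by (auto simp: L_def rel_compact_def)
    note lQ = localize_properties[OF pos_radon_sets[OF PQ(2)] \<Omega>b L(4,2) pos_radon_finite[OF PQ(2) L(1,2)]]
    have K0: "emeasure (localize Q L) K = 0" if K: "K \<subseteq> A" "compact K" for K
    proof -
      have Kb: "K \<in> sets borel" using K(2) by (simp add: compact_imp_closed)
      have "emeasure Q K = 0"
      proof (rule negative_diffuse_mass_vanishes[OF assms(1,3) PQ assms(5)[unfolded \<mu>] assms(6,8,9) K(2)])
        show "K \<subseteq> \<Omega>" using K(1) A(3) by blast
        show "u' x = 0" if "x \<in> K" for x using zero K(1) that by blast
        show "emeasure P K = 0"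
          by (rule null_mono[OF PQ(1) _ _ _ H(3)]) (use K(1) A(4) \<Omega>b H(1) in auto)
        show "emeasure Q S = 0" if S: "S \<in> sets borel" "S \<subseteq> K" "cap S = 0" for S
        proof -
          have SA: "S \<subseteq> A" using S(2) K(1) by blast
          have rc: "rel_compact \<Omega> S" by (rule rel_compact_subset[OF A(2) SA])
          have "emeasure P S = 0" by (rule null_mono[OF PQ(1) _ _ _ H(3)]) (use SA A(4) \<Omega>b H(1) in auto)
          moreover have "val \<mu> S = val \<mu>d S" by (rule \<mu>_eq[OF S(1) rc]) (use SA A(3) in blast)
          moreover have "val \<mu>d S = 0" using d0[OF S(1) _ S(3)] SA A(3) by (simp add: val_def \<mu>d measure_def subset_iff)
          ultimately have "measure Q S = 0" by (simp add: val_def \<mu> measure_def)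
          then show ?thesis using rel_compact_finite(2)[OF PQ(2) \<Omega>b S(1) rc] by simp
        qed
      qed
      then show ?thesis using lQ(3)[OF Kb] K(1) L(3) by (simp add: Int_absorb2 subset_trans)
    qed
    have "emeasure (localize Q L) A = (SUP K\<in>{K. K \<subseteq> A \<and> compact K}. emeasure (localize Q L) K)"
      by (rule inner_regular[OF lQ(1) _ A(1)]) (use finite_measure.emeasure_finite[OF lQ(2), of "space (localize Q L)"] in simp)
    also have "\<dots> \<le> 0" by (rule SUP_least) (use K0 in auto)
    finally show ?thesis using lQ(3)[OF A(1)] L(3) by (simp add: Int_absorb2)
  qed
  have "\<exists>U. open U \<and> U \<subseteq> \<Omega> \<and> cap U < ennreal (1 / real (Suc n)) \<and> continuous_on (\<Omega> - U) u'" for n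
    using assms(8) unfolding quasicontinuous_def by simp
  then obtain U where U: "\<And>n. open (U n)" "\<And>n. U n \<subseteq> \<Omega>" "\<And>n. cap (U n) < ennreal (1 / real (Suc n))"
    "\<And>n. continuous_on (\<Omega> - U n) u'" by metis
  \<comment> \<open>off \<open>Z\<close> the zero set is a countable union of relatively closed sets, hence Borel\<close>
  define Z where "Z = (\<Inter>n. U n)"
  have Zb: "Z \<in> sets borel" unfolding Z_def using U(1) by (intro sets.countable_INT) auto
  have Z\<Omega>: "Z \<subseteq> \<Omega>" unfolding Z_def using U(2) by blast
  have "cap Z \<le> ennreal (1 / real (Suc n))" for n
  proof -
    have "cap Z \<le> cap (U n)" unfolding Z_def by (rule cap_mono) blast
    then show ?thesis using U(3)[of n] by (meson less_imp_le order_trans)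
  qed
  moreover have "(\<lambda>n. ennreal (1 / real (Suc n))) \<longlonglongrightarrow> ennreal 0"
    using LIMSEQ_inverse_real_of_nat by (intro tendsto_ennrealI) (simp add: inverse_eq_divide)
  ultimately have "cap Z \<le> ennreal 0" by (intro LIMSEQ_le_const) auto
  then have Z0: "total_var \<mu>d Z = 0" using d0[OF Zb Z\<Omega>] by (simp add: total_var_def \<mu>d)
  define B where "B = {x \<in> \<Omega>. u' x = 0} - Z"
  have "{x \<in> \<Omega> - U n. u' x = 0} \<in> sets borel" for n
  proof -
    obtain T where T: "closed T" "T \<inter> (\<Omega> - U n) = u' -` {0} \<inter> (\<Omega> - U n)"
      using U(4)[of n] unfolding continuous_on_closed_invariant by (metis closed_singleton)
    then have "{x \<in> \<Omega> - U n. u' x = 0} = T \<inter> (\<Omega> - U n)" by auto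
    also have "\<dots> \<in> sets borel" using T(1) \<Omega>b U(1)[of n] by auto
    finally show ?thesis .
  qed
  moreover have "B = (\<Union>n. {x \<in> \<Omega> - U n. u' x = 0})" by (auto simp: B_def Z_def)
  ultimately have Bb: "B \<in> sets borel" by auto
  have pos: "0 \<le> val \<mu>d A" if A: "A \<in> sets borel" "A \<subseteq> B" "rel_compact \<Omega> A" for A
  proof -
    have A\<Omega>: "A \<subseteq> \<Omega>" using A(2) by (auto simp: B_def)
    have AF: "emeasure Pd (A \<inter> F) = 0" "emeasure Qd (A \<inter> F) = 0"
      by (rule d0; use A F A\<Omega> cap0[of "A \<inter> F" F] in auto)+
    define D where "D = A - F"
    have Db: "D \<in> sets borel" and DA: "D \<subseteq> A" and DF: "D \<subseteq> \<Omega> - F" using A F A\<Omega> by (auto simp: D_def)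
    have rD: "rel_compact \<Omega> D" by (rule rel_compact_subset[OF A(3) DA])
    have meas: "measure M A = measure M D" if "M \<in> pos_radon \<Omega>" "emeasure M (A \<inter> F) = 0" for M
    proof -
      have "A \<inter> F \<in> null_sets M" using that(2) sets_pos_radon[OF that(1) \<Omega>b, of "A \<inter> F"] A F A\<Omega> by auto
      then have "emeasure M (A - A \<inter> F) = emeasure M A"
        by (rule emeasure_Diff_null_set) (rule sets_pos_radon[OF that(1) \<Omega>b A(1) A\<Omega>])
      moreover have "A - A \<inter> F = D" by (auto simp: D_def)
      ultimately show ?thesis by (simp add: measure_def)
    qed
    have "val \<mu>d A = val \<mu>d D" using meas[OF Pdc(1) AF(1)] meas[OF Pdc(2) AF(2)] by (simp add: val_def \<mu>d)
    also have "\<dots> = val \<mu> D" using \<mu>_eq[OF Db rD DF] by simp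
    also have "\<dots> = measure P D - measure Q D" by (simp add: val_def \<mu>)
    also have "measure Q D = 0"
    proof -
      have n1: "emeasure Q (D - H) = 0"
        by (rule key) (use Db H(1) DF rel_compact_subset[OF rD, of "D - H"] DA A(2) in \<open>auto simp: B_def\<close>)
      have n2: "emeasure Q (D \<inter> H) = 0" by (rule null_mono[OF PQ(2) _ H(1,2,4)]) auto
      have "D - H \<in> null_sets Q" "D \<inter> H \<in> null_sets Q"
        using n1 n2 DF Db H(1) by (auto intro!: null_setsI sets_pos_radon[OF PQ(2) \<Omega>b])
      then have "(D - H) \<union> (D \<inter> H) \<in> null_sets Q" by (rule null_sets.Un)
      moreover have "(D - H) \<union> (D \<inter> H) = D" by blast
      ultimately show ?thesis by (simp add: measure_def null_sets_def)
    qed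
    finally show ?thesis by simp
  qed
  show ?thesis unfolding nonneg_on_def
  proof (rule exI[of _ B], rule exI[of _ Z], intro conjI allI impI)
    show "B \<subseteq> \<Omega>" "({x \<in> \<Omega>. u' x = 0} - B) \<union> (B - {x \<in> \<Omega>. u' x = 0}) \<subseteq> Z" by (auto simp: B_def)
    show "0 \<le> val \<mu>d A" if "A \<in> sets borel \<and> A \<subseteq> B \<and> rel_compact \<Omega> A" for A
      using pos[of A] that by simp
  qed (fact Bb Zb Z\<Omega> Z0)+
qed

end
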